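(* Let $p_1=\frac12(e_{11}-e_{22})$, $p_2=\frac12(e_{12}+e_{21})$, $k=\frac12(e_{21}-e_{12})$ be the basis of the Lie algebra $\mathfrak{sl}(2)$, let $D(e)=\operatorname{Lin}(p_1,p_2)$, and let $\langle\cdot,\cdot\rangle$ be the scalar product on $D(e)$ with orthonormal basis $p_1,p_2$. Then the left-invariant distribution $D$ on the Lie group $SL(2)$ with the given $D(e)$ is totally nonholonomic, and the pair $(D(e),\langle\cdot,\cdot\rangle)$ defines a left-invariant sub-Riemannian metric $\delta$ on $SL(2)$. Moreover, any geodesic $\gamma=\gamma(t)$, $t\in\mathbb{R}$, parametrized by arclength, in $(SL(2),\delta)$ with $\gamma(0)=e$ is a product of two 1-parameter subgroups: $$\gamma(t)=\gamma(\beta,\phi;t)=\exp\bigl(t(\cos\phi\, p_1+\sin\phi\, p_2+\beta k)\bigr)\exp(-t\beta k),$$ where $\phi,\beta$ are arbitrary real constants.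
   Context: $SL(2)$ is the Lie group of real $2\times2$ matrices with determinant 1, $e$ is its unit, and $\mathfrak{sl}(2)$ is its Lie algebra of real traceless $2\times2$ matrices with bracket $[a,b]=ab-ba$. $e_{ij}$ is the $2\times2$ matrix with 1 in row $i$, column $j$ and 0 elsewhere; $\operatorname{Lin}$ denotes linear span. Totally nonholonomic means bracket generating. The sub-Riemannian metric $\delta$ is the distance given by the infimum of lengths of curves tangent to $D$, with lengths measured by the left-invariant extension of $\langle\cdot,\cdot\rangle$. A shortest arc is a curve whose length equals the $\delta$-distance between its endpoints; a geodesic is a curve that is locally a shortest arc. *)

theory Defs
  imports "HOL-Analysis.Analysis"
begin

section \<open>The group SL(2) and its Lie algebra\<close>

type_synonym mat2 = "real ^ 2 ^ 2"

definition SL2 :: "mat2 set" where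
  "SL2 = {g. det g = 1}"

definition sl2 :: "mat2 set" where
  "sl2 = {a. trace a = 0}"

definition matrix_unit :: "2 \<Rightarrow> 2 \<Rightarrow> mat2" where
  "matrix_unit i j = (\<chi> r c. if r = i \<and> c = j then 1 else 0)"

definition p1 :: mat2 where
  "p1 = (1/2) *\<^sub>R (matrix_unit 1 1 - matrix_unit 2 2)"

definition p2 :: mat2 where
  "p2 = (1/2) *\<^sub>R (matrix_unit 1 2 + matrix_unit 2 1)"

definition k_so :: mat2 where
  "k_so = (1/2) *\<^sub>R (matrix_unit 2 1 - matrix_unit 1 2)"

text \<open>
  The type-class operations \<open>*\<close>, \<open>^\<close> on vectors act componentwise, so powers and the
  exponential are formed here from the matrix product \<open>**\<close>.
\<close>

definition mat_exp :: "real ^ 'n ^ 'n \<Rightarrow> real ^ 'n ^ 'n" where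
  "mat_exp A = (\<Sum>n. (1 / fact n) *\<^sub>R (((**) A ^^ n) (mat 1)))"

definition tangent_SL2 :: "mat2 \<Rightarrow> mat2 set" where
  "tangent_SL2 g = (\<lambda>a. g ** a) ` sl2"


section \<open>Totally nonholonomic distributions\<close>

primrec Ck :: "nat \<Rightarrow> ('a::real_normed_vector \<Rightarrow> 'b::real_normed_vector) \<Rightarrow> bool" where
  "Ck 0 f \<longleftrightarrow> continuous_on UNIV f"
| "Ck (Suc n) f \<longleftrightarrow>
     (\<forall>x. f differentiable (at x)) \<and> (\<forall>v. Ck n (\<lambda>x. frechet_derivative f (at x) v))"

definition smooth :: "('a::real_normed_vector \<Rightarrow> 'b::real_normed_vector) \<Rightarrow> bool" where
  "smooth f \<longleftrightarrow> (\<forall>n. Ck n f)"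

text \<open>
  A smooth vector field on SL(2) is represented by a smooth map on the whole matrix space; every
  smooth field on the closed submanifold SL(2) has such an extension.  For fields tangent to
  SL(2), the values on SL(2) of the bracket below do not depend on the extension.
  On left-invariant fields \<open>g \<mapsto> g a\<close> it agrees with \<open>[a, b] = a b - b a\<close>.
\<close>

definition lie_bracket :: "(mat2 \<Rightarrow> mat2) \<Rightarrow> (mat2 \<Rightarrow> mat2) \<Rightarrow> mat2 \<Rightarrow> mat2" where
  "lie_bracket X Y g = frechet_derivative Y (at g) (X g) - frechet_derivative X (at g) (Y g)"

definition sections :: "(mat2 \<Rightarrow> mat2 set) \<Rightarrow> (mat2 \<Rightarrow> mat2) set" where
  "sections \<Delta> = {X. smooth X \<and> (\<forall>g\<in>SL2. X g \<in> \<Delta> g)}"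

inductive_set iterated_brackets :: "(mat2 \<Rightarrow> mat2) set \<Rightarrow> (mat2 \<Rightarrow> mat2) set" for F where
  base: "X \<in> F \<Longrightarrow> X \<in> iterated_brackets F"
| bracket: "X \<in> iterated_brackets F \<Longrightarrow> Y \<in> iterated_brackets F \<Longrightarrow>
    lie_bracket X Y \<in> iterated_brackets F"

definition totally_nonholonomic :: "(mat2 \<Rightarrow> mat2 set) \<Rightarrow> bool" where
  "totally_nonholonomic \<Delta> \<longleftrightarrow>
     (\<forall>g\<in>SL2. span {X g | X. X \<in> iterated_brackets (sections \<Delta>)} = tangent_SL2 g)"


section \<open>The left-invariant sub-Riemannian structure\<close>

definition De :: "mat2 set" where
  "De = span {p1, p2}"

definition D :: "mat2 \<Rightarrow> mat2 set" where
  "D g = (\<lambda>v. g ** v) ` De"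

text \<open>The scalar product on \<open>De\<close> for which \<open>p1\<close>, \<open>p2\<close> is an orthonormal basis.\<close>

definition De_inner :: "mat2 \<Rightarrow> mat2 \<Rightarrow> real" where
  "De_inner v w = (\<Sum>b\<in>{p1, p2}. representation {p1, p2} v b * representation {p1, p2} w b)"

definition D_norm :: "mat2 \<Rightarrow> mat2 \<Rightarrow> real" where
  "D_norm g v = sqrt (De_inner (matrix_inv g ** v) (matrix_inv g ** v))"

text \<open>
  \<open>has_sr_length \<gamma> a b l\<close>: on \<open>[a, b]\<close>, \<open>\<gamma>\<close> is an absolutely continuous curve in SL(2) which is
  tangent to \<open>D\<close> almost everywhere and has length \<open>l\<close>.  Absolute continuity is expressed by
  \<open>\<gamma>\<close> being an indefinite Lebesgue integral of some \<open>v\<close>; this \<open>v\<close> is the derivative of \<open>\<gamma>\<close>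
  almost everywhere, so the length does not depend on its choice.
\<close>

definition has_sr_length :: "(real \<Rightarrow> mat2) \<Rightarrow> real \<Rightarrow> real \<Rightarrow> real \<Rightarrow> bool" where
  "has_sr_length \<gamma> a b l \<longleftrightarrow> a \<le> b \<and> (\<forall>t\<in>{a..b}. \<gamma> t \<in> SL2) \<and>
     (\<exists>v. v absolutely_integrable_on {a..b} \<and>
          (\<forall>t\<in>{a..b}. \<gamma> t = \<gamma> a + integral {a..t} v) \<and>
          (AE t in lebesgue. t \<in> {a..b} \<longrightarrow> v t \<in> D (\<gamma> t)) \<and>
          ((\<lambda>t. D_norm (\<gamma> t) (v t)) has_integral l) {a..b})"

definition joining_lengths :: "mat2 \<Rightarrow> mat2 \<Rightarrow> real set" where
  "joining_lengths x y = {l. \<exists>\<gamma> a b. \<gamma> a = x \<and> \<gamma> b = y \<and> has_sr_length \<gamma> a b l}"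

text \<open>
  The value outside SL(2) is irrelevant; 0 is chosen because the locale \<open>Metric_space\<close> requires
  nonnegativity and symmetry off the carrier as well.
\<close>

definition sr_dist :: "mat2 \<Rightarrow> mat2 \<Rightarrow> real" where
  "sr_dist x y = (if x \<in> SL2 \<and> y \<in> SL2 then Inf (joining_lengths x y) else 0)"

definition shortest_arc :: "(real \<Rightarrow> mat2) \<Rightarrow> real \<Rightarrow> real \<Rightarrow> bool" where
  "shortest_arc \<gamma> a b \<longleftrightarrow> has_sr_length \<gamma> a b (sr_dist (\<gamma> a) (\<gamma> b))"

definition geodesic :: "(real \<Rightarrow> mat2) \<Rightarrow> bool" where
  "geodesic \<gamma> \<longleftrightarrow> (\<forall>t. \<exists>\<epsilon>>0. shortest_arc \<gamma> (t - \<epsilon>) (t + \<epsilon>))"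

definition arclength_parametrized :: "(real \<Rightarrow> mat2) \<Rightarrow> bool" where
  "arclength_parametrized \<gamma> \<longleftrightarrow> (\<forall>s t. s \<le> t \<longrightarrow> has_sr_length \<gamma> s t (t - s))"

end

theory Submission
  imports Defs
begin

text \<open>
  Read the rows of a matrix in SL(2) as two complex numbers \<open>w\<close>, \<open>z\<close>.  A curve is tangent to
  \<open>D\<close> with left-invariant velocity \<open>u\<^sub>1 p\<^sub>1 + u\<^sub>2 p\<^sub>2\<close> exactly if both rows solve
  \<open>z' = cnj z * U / 2\<close> with the control \<open>U = u\<^sub>1 + \<i> u\<^sub>2\<close>, and its length is the integral of
  \<open>cmod U\<close> (\<open>has_sr_length_iff\<close>).  The quotient \<open>w / z = x - \<i> y\<close> is the complex conjugate of the
  image of \<open>\<i>\<close> under the Moebius action on the upper half-plane.  With \<open>z = exp \<Lambda>\<close> and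
  \<open>V = cnj z / z * U\<close> the equations become explicit integrals: \<open>\<Lambda>' = V / 2\<close>,
  \<open>y = exp (- 2 Re \<Lambda>)\<close>, \<open>x' = - y Im V\<close> (\<open>horizontal_curve_coords\<close>,
  \<open>horizontal_curve_of_coords\<close>).  Hence a horizontal curve is an arbitrary integrable \<open>V\<close>, its
  length is that of its projection to the hyperbolic plane, and its end point is determined by the
  integrals of \<open>Re V\<close>, \<open>Im V\<close> and \<open>y * Im V\<close>: finding shortest arcs is an isoperimetric
  problem.  The same description shows that any two points are joined by an explicit curve with
  polynomial \<open>y\<close> and \<open>Im \<Lambda>\<close> (\<open>joining_lengths_nonempty\<close>), and that a short curve cannot move
  the rows far, so that \<open>sr_dist\<close> separates points (\<open>Metric_space_sr_dist\<close>).

  The curves of the theorem are precisely those starting at the unit whose control rotates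
  uniformly, \<open>U = c * exp (\<i> \<beta> t)\<close> with \<open>cmod c = 1\<close>: differentiating the product of
  exponentials gives \<open>U = exp (\<i> \<phi>) * exp (\<i> \<beta> t)\<close>, because conjugation by \<open>exp (s k)\<close>
  rotates the plane spanned by \<open>p\<^sub>1\<close>, \<open>p\<^sub>2\<close> by the angle \<open>s\<close>.

  Short pieces of these curves are shortest arcs by a calibration
  (\<open>rotating_control_minimal\<close>).  After a left translation, such a curve satisfies
  \<open>Re V = sqrt (1 - P\<^sup>2)\<close> and \<open>Im V = P\<close> with \<open>P = \<beta> (1 - y)\<close>.  On every horizontal curve with
  \<open>\<bar>P\<bar> \<le> 1\<close> one has \<open>cmod V \<ge> sqrt (1 - P\<^sup>2) * Re V + P * Im V\<close>, and the right-hand side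
  is the derivative of a function of \<open>\<Lambda>\<close> and \<open>x\<close> alone, so its integral depends on the end points
  only; on the given curve equality holds.

  Conversely, let an arc of unit speed be shortest (\<open>minimizer_control\<close>).  Replacing \<open>Im V\<close> by
  its \<open>L\<^sup>2\<close> projection to the span of \<open>1\<close> and \<open>y\<close> changes neither \<open>y\<close> nor the end points, and it
  strictly shortens the arc unless \<open>Im V = c\<^sub>0 + c\<^sub>1 y\<close> almost everywhere already.  By left
  invariance this holds for three different frames \<open>z\<close>, \<open>w\<close>, \<open>w + z\<close>; the three equations
  determine \<open>U\<close> as a polynomial in the rows, so \<open>U\<close> is continuously differentiable, and
  differentiating them again shows that it rotates at one of three constant rates
  (\<open>minimizer_rotating_control\<close>).  The rate is locally constant along a geodesic, hence constant.
\<close>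


section \<open>Indefinite Lebesgue integrals\<close>

text \<open>
  This is absolute continuity of \<open>f\<close> on \<open>[a, b]\<close> together with a choice \<open>v\<close> of its derivative,
  in the form in which it enters the definition of length.  Differential
  equations are stated in this way as long as the control is only known to be integrable.
\<close>

definition primitive_on :: "real \<Rightarrow> real \<Rightarrow> (real \<Rightarrow> 'a::euclidean_space) \<Rightarrow> (real \<Rightarrow> 'a) \<Rightarrow> bool" where
  "primitive_on a b f v \<longleftrightarrow> v absolutely_integrable_on {a..b} \<and>
     (\<forall>t\<in>{a..b}. (v has_integral f t - f a) {a..t})"

lemma primitive_on_absolutely_integrable: "primitive_on a b f v \<Longrightarrow> v absolutely_integrable_on {a..b}"
  by (simp add: primitive_on_def)

lemma primitive_on_diff:
  assumes "primitive_on a b f v" "a \<le> s" "s \<le> t" "t \<le> b"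
  shows "(v has_integral f t - f s) {s..t}"
proof -
  have s: "(v has_integral f s - f a) {a..s}" and t: "(v has_integral f t - f a) {a..t}"
    using assms by (auto simp: primitive_on_def)
  have "v integrable_on {s..t}"
    by (rule integrable_subinterval_real[of v a b])
       (use assms in \<open>auto simp: primitive_on_def absolutely_integrable_on_def\<close>)
  then obtain i where i: "(v has_integral i) {s..t}" by blast
  have "(v has_integral (f s - f a + i)) {a..t}"
    by (rule has_integral_combine[OF _ _ s i]) (use assms in auto)
  with t have "f t - f a = f s - f a + i" by (rule has_integral_unique)
  then have "i = f t - f s" by simp
  with i show ?thesis by simp
qed

lemma primitive_on_subinterval:
  assumes "primitive_on a b f v" "a \<le> c" "d \<le> b"
  shows "primitive_on c d f v"
  unfolding primitive_on_def
  using primitive_on_diff[OF assms(1,2)] assms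
    absolutely_integrable_on_subinterval[OF primitive_on_absolutely_integrable[OF assms(1)]]
  by auto

lemma primitive_on_continuous:
  assumes "primitive_on a b f v" shows "continuous_on {a..b} f"
proof -
  have "v integrable_on {a..b}"
    using assms by (simp add: primitive_on_def absolutely_integrable_on_def)
  then have "continuous_on {a..b} (\<lambda>t. f a + integral {a..t} v)"
    by (intro continuous_intros indefinite_integral_continuous_1)
  moreover have "f a + integral {a..t} v = f t" if "t \<in> {a..b}" for t
    using assms that by (auto simp: primitive_on_def dest!: bspec[OF _ that] integral_unique)
  ultimately show ?thesis by (subst continuous_on_cong[OF refl]) auto
qed

lemma primitive_on_norm_bound:
  assumes "primitive_on a b f v" "a \<le> s" "s \<le> t" "t \<le> b"
  shows "norm (f t - f s) \<le> integral {s..t} (\<lambda>x. norm (v x))"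
proof -
  have "v absolutely_integrable_on {s..t}"
    using assms primitive_on_subinterval[of a b f v s t] by (auto simp: primitive_on_def)
  moreover have "f t - f s = integral {s..t} v"
    using primitive_on_diff[OF assms] by (simp add: integral_unique)
  ultimately show ?thesis
    by (auto simp: absolutely_integrable_on_def intro!: integral_norm_bound_integral)
qed

lemma primitive_on_linear:
  fixes h :: "'a::euclidean_space \<Rightarrow> 'b::euclidean_space"
  assumes "primitive_on a b f v" and h: "bounded_linear h"
  shows "primitive_on a b (\<lambda>t. h (f t)) (\<lambda>t. h (v t))"
  using assms(1) absolutely_integrable_linear[OF _ h, where f=v]
    has_integral_linear[OF _ h, of v]
  by (auto simp: primitive_on_def o_def bounded_linear.linear[OF h] linear_diff[symmetric])

lemma primitive_on_add:
  assumes "primitive_on a b f v" "primitive_on a b g w"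
  shows "primitive_on a b (\<lambda>t. f t + g t) (\<lambda>t. v t + w t)"
  using assms has_integral_add[of v _ _ w]
  by (fastforce simp: primitive_on_def add_diff_add intro: set_integral_add)

lemma primitive_on_minus:
  assumes "primitive_on a b f v"
  shows "primitive_on a b (\<lambda>t. - f t) (\<lambda>t. - v t)"
  using primitive_on_linear[OF assms bounded_linear_minus[OF bounded_linear_ident]] .

lemma primitive_on_sub:
  assumes "primitive_on a b f v" "primitive_on a b g w"
  shows "primitive_on a b (\<lambda>t. f t - g t) (\<lambda>t. v t - w t)"
  using primitive_on_add[OF assms(1) primitive_on_minus[OF assms(2)]] by simp

lemma primitive_on_cong:
  assumes "primitive_on a b f v" "negligible N" "\<And>t. t \<in> {a..b} \<Longrightarrow> f t = g t"
    "\<And>t. t \<in> {a..b} - N \<Longrightarrow> w t = v t"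
  shows "primitive_on a b g w"
  unfolding primitive_on_def
proof (intro conjI ballI)
  show "w absolutely_integrable_on {a..b}"
    by (rule absolutely_integrable_spike[OF _ assms(2)]) (use assms in \<open>auto simp: primitive_on_def\<close>)
  fix t assume t: "t \<in> {a..b}"
  show "(w has_integral g t - g a) {a..t}"
    by (rule has_integral_spike[OF assms(2)]) (use assms t in \<open>auto simp: primitive_on_def\<close>)
qed

lemma primitive_on_const: "primitive_on a b (\<lambda>t. c) (\<lambda>t. 0)"
  by (simp add: primitive_on_def)

lemma primitive_on_zero_imp_const:
  assumes "primitive_on a b f (\<lambda>t. 0)" "t \<in> {a..b}" shows "f t = f a"
  using primitive_on_norm_bound[OF assms(1), of a t] assms(2) by auto

lemma primitive_on_integral:
  assumes "v absolutely_integrable_on {a..b}"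
  shows "primitive_on a b (\<lambda>t. c + integral {a..t} v) v"
  using assms
  by (auto simp: primitive_on_def absolutely_integrable_on_def 
    intro!: integrable_integral integrable_subinterval_real[of v a b])

lemma primitive_on_C1:
  assumes "\<And>t. t \<in> {a..b} \<Longrightarrow> (f has_vector_derivative v t) (at t within {a..b})"
    and "continuous_on {a..b} v"
  shows "primitive_on a b f v"
  unfolding primitive_on_def
proof (intro conjI ballI)
  show "v absolutely_integrable_on {a..b}"
    using assms(2) by (simp add: absolutely_integrable_continuous_real)
  fix t assume t: "t \<in> {a..b}"
  show "(v has_integral f t - f a) {a..t}"
    using t by (intro fundamental_theorem_of_calculus)
      (auto intro!: has_vector_derivative_within_subset[OF assms(1)])
qed

lemma primitive_on_deriv:
  assumes "primitive_on a b f v" "continuous_on {a..b} v" "t \<in> {a..b}"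
  shows "(f has_vector_derivative v t) (at t within {a..b})"
proof -
  have "((\<lambda>s. integral {a..s} v) has_vector_derivative v t) (at t within {a..b})"
    by (rule integral_has_vector_derivative[OF assms(2,3)])
  then have "((\<lambda>s. f a + integral {a..s} v) has_vector_derivative v t) (at t within {a..b})"
    by (auto intro!: derivative_eq_intros)
  then show ?thesis
    by (rule has_vector_derivative_transform[OF assms(3), rotated])
       (use assms in \<open>auto simp: primitive_on_def dest!: bspec integral_unique\<close>)
qed

lemma absolutely_integrable_continuous_mult:
  fixes g :: "real \<Rightarrow> 'a::{euclidean_space, real_normed_field}"
  assumes "continuous_on {a..b} g" "v absolutely_integrable_on {a..b}"
  shows "(\<lambda>t. g t * v t) absolutely_integrable_on {a..b}"
proof (rule absolutely_integrable_bounded_measurable_product[of "(*)", OF _ _ _ _ assms(2)])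
  show "bilinear ((*) :: 'a \<Rightarrow> 'a \<Rightarrow> 'a)" by (rule bilinear_times)
  show "bounded (g ` {a..b})"
    using assms(1) compact_continuous_image compact_imp_bounded by blast
  show "g \<in> borel_measurable (lebesgue_on {a..b})"
    using assms(1) by (intro continuous_imp_measurable_on_sets_lebesgue) auto
qed auto

text \<open>
  The error of the claimed identity between \<open>s\<close> and \<open>t\<close> is at most \<open>\<epsilon>\<close> times the integral of
  \<open>norm v\<close> over \<open>[s, t]\<close>.  This estimate is additive in the interval, so by bisection it has to
  be checked for small intervals only, where it follows from strict differentiability of \<open>F\<close> and
  continuity of \<open>F'\<close> along \<open>f\<close>.
\<close>

lemma primitive_on_chain:
  fixes f v :: "real \<Rightarrow> 'a::{euclidean_space, real_normed_field}"
  assumes f: "primitive_on a b f v" and S: "open S" "f ` {a..b} \<subseteq> S"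
    and F: "\<And>z. z \<in> S \<Longrightarrow> (F has_field_derivative F' z) (at z)" and F': "continuous_on S F'"
  shows "primitive_on a b (\<lambda>t. F (f t)) (\<lambda>t. F' (f t) * v t)"
proof -
  have cf: "continuous_on {a..b} f" using f by (rule primitive_on_continuous)
  have cF'f: "continuous_on {a..b} (\<lambda>t. F' (f t))"
    using continuous_on_compose2[OF F' cf S(2)] .
  have vi: "v absolutely_integrable_on {a..b}" using f by (simp add: primitive_on_def)
  have ai: "(\<lambda>t. F' (f t) * v t) absolutely_integrable_on {a..b}"
    by (rule absolutely_integrable_continuous_mult[OF cF'f vi])
  define H where "H = (\<lambda>t. integral {a..t} (\<lambda>t. F' (f t) * v t))"
  have H: "primitive_on a b H (\<lambda>t. F' (f t) * v t)"
    using primitive_on_integral[OF ai, of 0] by (simp add: H_def)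
  define G where "G = (\<lambda>t. F (f t) - H t)"
  have step: "norm (G t - G s) \<le> \<epsilon> * integral {s..t} (\<lambda>x. norm (v x))"
    if eps: "0 < \<epsilon>" and st: "a \<le> s" "s \<le> t" "t \<le> b" for \<epsilon> s t
  proof -
    let ?P = "\<lambda>s t. a \<le> s \<and> s \<le> t \<and> t \<le> b \<longrightarrow>
       norm (G t - G s) \<le> \<epsilon> * integral {s..t} (\<lambda>x. norm (v x))"
    have nint: "(\<lambda>x. norm (v x)) integrable_on {s..t}" if "a \<le> s" "t \<le> b" for s t
      by (rule integrable_subinterval_real[of _ a b])
        (use vi that in \<open>auto simp: absolutely_integrable_on_def\<close>)
    have "?P s t"
    proof (rule Bolzano[of s t ?P])
      show "s \<le> t" by fact
    next
      fix p q r assume pq: "?P p q" and qr: "?P q r" and "p \<le> q" "q \<le> r"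
      show "?P p r"
      proof
        assume *: "a \<le> p \<and> p \<le> r \<and> r \<le> b"
        have "norm (G r - G p) \<le> norm (G q - G p) + norm (G r - G q)"
          using norm_triangle_ineq[of "G q - G p" "G r - G q"] by simp
        also have "\<dots> \<le> \<epsilon> * integral {p..q} (\<lambda>x. norm (v x)) + \<epsilon> * integral {q..r} (\<lambda>x. norm (v x))"
          using pq qr * \<open>p \<le> q\<close> \<open>q \<le> r\<close> by (intro add_mono) auto
        also have "\<dots> = \<epsilon> * integral {p..r} (\<lambda>x. norm (v x))"
          using Henstock_Kurzweil_Integration.integral_combine[OF \<open>p \<le> q\<close> \<open>q \<le> r\<close> nint] *
          by (simp flip: distrib_left)
        finally show "norm (G r - G p) \<le> \<epsilon> * integral {p..r} (\<lambda>x. norm (v x))" .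
      qed
    next
      fix x assume "s \<le> x" "x \<le> t"
      then have x: "x \<in> {a..b}" using st by auto
      then have fx: "f x \<in> S" using S by auto
      have "isCont F' (f x)" using F' S(1) fx by (simp add: continuous_on_eq_continuous_at)
      then obtain \<rho>0 where \<rho>0: "\<rho>0 > 0" "\<And>z. dist z (f x) < \<rho>0 \<Longrightarrow> dist (F' z) (F' (f x)) < \<epsilon>/2"
        using eps unfolding continuous_at_eps_delta by (metis half_gt_zero)
      obtain \<rho>1 where \<rho>1: "\<rho>1 > 0" "ball (f x) \<rho>1 \<subseteq> S" using S(1) fx open_contains_ball by blast
      define \<rho> where "\<rho> = min \<rho>0 \<rho>1"
      have \<rho>: "\<rho> > 0" "ball (f x) \<rho> \<subseteq> S" 
         "\<And>z. z \<in> ball (f x) \<rho> \<Longrightarrow> norm (F' z - F' (f x)) \<le> \<epsilon>/2"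
        using \<rho>0 \<rho>1 by (auto simp: \<rho>_def dist_commute dist_norm[symmetric] less_imp_le)
      obtain d where d: "d > 0" "\<And>y. y \<in> {a..b} \<Longrightarrow> dist y x < d \<Longrightarrow> dist (f y) (f x) < \<rho>"
        using cf x \<rho>(1) unfolding continuous_on_iff by metis
      have "?P p q" if pq: "p \<le> x" "x \<le> q" "q - p < d" for p q
      proof
        assume *: "a \<le> p \<and> p \<le> q \<and> q \<le> b"
        have near: "f y \<in> ball (f x) \<rho>" if "y \<in> {p..q}" for y
          using d(2)[of y] that pq * by (auto simp: dist_real_def dist_commute)
        let ?c = "F' (f x)"
        have "norm ((F (f q) - ?c * f q) - (F (f p) - ?c * f p)) \<le> \<epsilon>/2 * norm (f q - f p)"
        proof (rule field_differentiable_bound[of "ball (f x) \<rho>" _ "\<lambda>z. F' z - ?c"])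
          fix z assume z: "z \<in> ball (f x) \<rho>"
          then have "(F has_field_derivative F' z) (at z within ball (f x) \<rho>)"
            using F \<rho>(2) has_field_derivative_at_within by blast
          then show "((\<lambda>z. F z - ?c * z) has_field_derivative F' z - ?c) (at z within ball (f x) \<rho>)"
            by (auto intro!: derivative_eq_intros)
        qed (use \<rho>(3) near * in auto)
        then have 1: "norm (F (f q) - F (f p) - ?c * (f q - f p)) \<le> \<epsilon>/2 * norm (f q - f p)"
          by (simp add: algebra_simps)
        also have "\<dots> \<le> \<epsilon>/2 * integral {p..q} (\<lambda>x. norm (v x))"
          using primitive_on_norm_bound[OF f, of p q] * eps by (intro mult_left_mono) auto
        finally have 1: "norm (F (f q) - F (f p) - ?c * (f q - f p)) \<le> \<epsilon>/2 * integral {p..q} (\<lambda>x. norm (v x))" .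
        have hi: "((\<lambda>y. F' (f y) * v y - ?c * v y) has_integral (H q - H p) - ?c * (f q - f p)) {p..q}"
          using primitive_on_diff[OF H, of p q] primitive_on_diff[OF f, of p q] *
          by (intro has_integral_diff has_integral_mult_right) auto
        have "norm ((H q - H p) - ?c * (f q - f p)) \<le> integral {p..q} (\<lambda>x. \<epsilon>/2 * norm (v x))"
          unfolding integral_unique[OF hi, symmetric]
        proof (rule integral_norm_bound_integral)
          show "(\<lambda>y. F' (f y) * v y - ?c * v y) integrable_on {p..q}" using hi by blast
          show "(\<lambda>x. \<epsilon>/2 * norm (v x)) integrable_on {p..q}"
            using nint[of p q] * by (intro integrable_on_mult_right) auto
          show "norm (F' (f y) * v y - ?c * v y) \<le> \<epsilon>/2 * norm (v y)" if "y \<in> {p..q}" for y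
            using mult_right_mono[OF \<rho>(3)[OF near[OF that]], of "norm (v y)"]
            by (simp add: norm_mult[symmetric] left_diff_distrib)
        qed
        then have 2: "norm ((H q - H p) - ?c * (f q - f p)) \<le> \<epsilon>/2 * integral {p..q} (\<lambda>x. norm (v x))"
          by simp
        have "G q - G p = (F (f q) - F (f p) - ?c * (f q - f p)) - ((H q - H p) - ?c * (f q - f p))"
          by (simp add: G_def)
        then have "norm (G q - G p) \<le> \<epsilon>/2 * integral {p..q} (\<lambda>x. norm (v x)) + \<epsilon>/2 * integral {p..q} (\<lambda>x. norm (v x))"
          using norm_triangle_le_diff[OF add_mono[OF 1 2]] by simp
        then show "norm (G q - G p) \<le> \<epsilon> * integral {p..q} (\<lambda>x. norm (v x))" by simp
      qed
      then show "\<exists>d>0. \<forall>p q. p \<le> x \<and> x \<le> q \<and> q - p < d \<longrightarrow> ?P p q" using d(1) by blast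
    qed
    with st show ?thesis by blast
  qed
  have "G t = G a" if t: "t \<in> {a..b}" for t
  proof -
    let ?I = "integral {a..t} (\<lambda>x. norm (v x))"
    have "norm (G t - G a) \<le> 0"
    proof (rule field_le_epsilon)
      fix e :: real assume e: "e > 0"
      have "(\<lambda>x. norm (v x)) integrable_on {a..t}"
        by (rule integrable_subinterval_real[of _ a b])
          (use vi t in \<open>auto simp: absolutely_integrable_on_def\<close>)
      then have I: "?I \<ge> 0" by (intro Henstock_Kurzweil_Integration.integral_nonneg) auto
      have "norm (G t - G a) \<le> e / (?I + 1) * ?I"
        using t e I by (intro step) auto
      also have "\<dots> \<le> e" using I e by (simp add: field_simps)
      finally show "norm (G t - G a) \<le> 0 + e" by simp
    qed
    then show ?thesis by simp
  qed
  then have eq: "F (f a) - H a + H t = F (f t)" if "t \<in> {a..b}" for t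
    using that by (fastforce simp: G_def algebra_simps)
  have "primitive_on a b (\<lambda>t. F (f a) - H a + H t) (\<lambda>t. F' (f t) * v t)"
    using primitive_on_add[OF primitive_on_const H] by simp
  then show ?thesis
    by (rule primitive_on_cong[OF _ negligible_empty]) (auto intro: eq)
qed

text \<open>
  The product rule follows from the chain rule for the square function by polarization.
\<close>

lemma primitive_on_mult:
  fixes f v :: "real \<Rightarrow> 'a::{euclidean_space, real_normed_field}"
  assumes f: "primitive_on a b f v" and g: "primitive_on a b g w"
  shows "primitive_on a b (\<lambda>t. f t * g t) (\<lambda>t. v t * g t + f t * w t)"
proof -
  have sq: "primitive_on a b (\<lambda>t. (h t)\<^sup>2) (\<lambda>t. (2 * h t) * u t)" if "primitive_on a b h u" for h u :: "real \<Rightarrow> 'a"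
    by (rule primitive_on_chain[OF that, of UNIV])
       (auto intro!: derivative_eq_intros continuous_intros)
  have "primitive_on a b (\<lambda>t. (1/4) *\<^sub>R ((f t + g t)\<^sup>2 - (f t - g t)\<^sup>2))
     (\<lambda>t. (1/4) *\<^sub>R (2 * (f t + g t) * (v t + w t) - 2 * (f t - g t) * (v t - w t)))"
    by (intro primitive_on_linear[OF _ bounded_linear_scaleR_right] primitive_on_sub primitive_on_add sq f g)
  then show ?thesis
    by (rule primitive_on_cong[where N="{}"])
       (auto simp: algebra_simps power2_eq_square scaleR_conv_of_real)
qed

text \<open>
  Almost every point is a Lebesgue point of \<open>v\<close>, and all averages of \<open>v\<close> vanish.
\<close>

lemma primitive_on_zero_ae:
  fixes v :: "real \<Rightarrow> 'a::euclidean_space"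
  assumes v: "primitive_on a b (\<lambda>t. c) v"
  shows "\<exists>N. negligible N \<and> (\<forall>t\<in>{a..b} - N. v t = 0)"
proof -
  define w where "w = (\<lambda>t. if t \<in> {a..b} then v t else 0)"
  have vi: "v integrable_on {a..b}"
    using v by (simp add: primitive_on_def absolutely_integrable_on_def)
  have "w integrable_on UNIV"
    unfolding w_def using vi by (rule Henstock_Kurzweil_Integration.integrable_restrict_UNIV[THEN iffD2])
  then have "w integrable_on cbox x y" for x y
    using integrable_on_subcbox by blast
  then obtain N where N: "negligible N" "\<And>x e. x \<notin> N \<Longrightarrow> 0 < e \<Longrightarrow>
       \<exists>d>0. \<forall>h. 0 < h \<and> h < d \<longrightarrow> norm(integral (cbox x (x + h *\<^sub>R One)) w /\<^sub>R h ^ DIM(real) - w x) < e"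
    using integrable_ccontinuous_explicit[of w] by metis
  have "v t = 0" if t: "t \<in> {a..b}" "t \<noteq> b" "t \<notin> N" for t
  proof (rule ccontr)
    assume "v t \<noteq> 0"
    then obtain d where d: "d > 0" 
      "\<And>h. 0 < h \<and> h < d \<Longrightarrow> norm(integral {t..t+h} w /\<^sub>R h - w t) < norm (v t)"
      using N(2)[OF t(3), of "norm (v t)"] by auto
    define h where "h = min (d/2) (b - t)"
    have h: "0 < h" "h < d" "t + h \<le> b" using d(1) t by (auto simp: h_def)
    have "(v has_integral 0) {t..t+h}" using primitive_on_diff[OF v, of t "t+h"] t h by simp
    then have "(w has_integral 0) {t..t+h}"
      by (rule has_integral_eq[rotated]) (use t h in \<open>auto simp: w_def\<close>)
    then show False using d(2)[of h] h t by (simp add: integral_unique w_def)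
  qed
  then show ?thesis using N(1) by (intro exI[of _ "N \<union> {b}"]) auto
qed

lemma primitive_on_unique_ae:
  assumes "primitive_on a b f v" "primitive_on a b f w"
  shows "\<exists>N. negligible N \<and> (\<forall>t\<in>{a..b} - N. v t = w t)"
  using primitive_on_zero_ae[of a b 0 "\<lambda>t. v t - w t"] primitive_on_sub[OF assms]
  unfolding diff_self right_minus_eq by blast

lemma primitive_on_combine:
  assumes f: "primitive_on a b f v" and g: "primitive_on b c g w" and "f b = g b" "a \<le> b" "b \<le> c"
  shows "primitive_on a c (\<lambda>t. if t \<le> b then f t else g t) (\<lambda>t. if t \<le> b then v t else w t)"
    (is "primitive_on a c ?f ?v")
proof -
  have w': "(?v has_integral g t - g b) {b..t}" if "t \<in> {b..c}" for t
    by (rule has_integral_spike[of "{b}" _ _ w]) (use that g in \<open>auto simp: primitive_on_def\<close>)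
  have v': "(?v has_integral f t - f a) {a..t}" if "t \<in> {a..b}" for t
    by (rule has_integral_eq[of _ v]) (use that f in \<open>auto simp: primitive_on_def\<close>)
  have "?v absolutely_integrable_on {b..c}"
    by (rule absolutely_integrable_spike[OF _ negligible_sing[of b], where f=w]) (use g in \<open>auto simp: primitive_on_def\<close>)
  moreover have "?v absolutely_integrable_on {a..b}"
    by (rule absolutely_integrable_spike[OF _ negligible_empty, where f=v]) (use f in \<open>auto simp: primitive_on_def\<close>)
  ultimately have ai: "?v absolutely_integrable_on {a..c}"
    using absolutely_integrable_on_combine assms(4,5) by blast
  show ?thesis unfolding primitive_on_def
  proof (intro conjI ballI ai)
    fix t assume t: "t \<in> {a..c}"
    show "(?v has_integral (if t \<le> b then f t else g t) - (if a \<le> b then f a else g a)) {a..t}"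
    proof (cases "t \<le> b")
      case True then show ?thesis using v'[of t] t assms by auto
    next
      case False
      have "(?v has_integral (f b - f a) + (g t - g b)) {a..t}"
        by (rule has_integral_combine[of a b t]) (use False t assms v'[of b] w'[of t] in auto)
      then show ?thesis using False assms by simp
    qed
  qed
qed

lemma absolutely_integrable_shift:
  fixes v :: "real \<Rightarrow> 'a::euclidean_space"
  assumes "v absolutely_integrable_on {a..b}"
  shows "(\<lambda>t. v (t + c)) absolutely_integrable_on {a - c..b - c}"
    "(\<lambda>t. v (c - t)) absolutely_integrable_on {c - b..c - a}"
proof -
  have 1: "(\<lambda>t. w (t + c)) integrable_on {a - c..b - c}" if "w integrable_on {a..b}" for w :: "real \<Rightarrow> 'c::euclidean_space" and a b c
  proof -
    from that obtain i where "(w has_integral i) (cbox a b)" by auto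
    from has_integral_affinity[OF this, of 1 c] show ?thesis
      by (auto simp: integrable_on_def image_affinity_atLeastAtMost_diff algebra_simps image_diff_atLeastAtMost split: if_splits)
  qed
  show "(\<lambda>t. v (t + c)) absolutely_integrable_on {a - c..b - c}"
    using assms 1[of v a b c] 1[of "\<lambda>t. norm (v t)" a b c] by (simp add: absolutely_integrable_on_def)
  have "(\<lambda>t. v (- t)) absolutely_integrable_on {- b..- a}" using assms by simp
  then show "(\<lambda>t. v (c - t)) absolutely_integrable_on {c - b..c - a}"
    using 1[of "\<lambda>t. v (- t)" "-b" "-a" "-c"] 1[of "\<lambda>t. norm (v (- t))" "-b" "-a" "-c"]
    by (simp add: absolutely_integrable_on_def)
qed

lemma has_integral_shift:
  fixes v :: "real \<Rightarrow> 'a::euclidean_space"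
  assumes "(v has_integral i) {a..b}"
  shows "((\<lambda>t. v (t + c)) has_integral i) {a - c..b - c}"
    "((\<lambda>t. v (c - t)) has_integral i) {c - b..c - a}"
proof -
  have 1: "((\<lambda>t. w (t + c)) has_integral i) {a - c..b - c}" if "(w has_integral i) {a..b}" for w :: "real \<Rightarrow> 'a" and a b c
    using has_integral_affinity[of w i a b 1 c] that
      by (auto simp: integrable_on_def image_affinity_atLeastAtMost_diff algebra_simps image_diff_atLeastAtMost split: if_splits)
  show "((\<lambda>t. v (t + c)) has_integral i) {a - c..b - c}" by (rule 1[OF assms])
  have "((\<lambda>t. v (- t)) has_integral i) {- b..- a}" using assms by simp
  from 1[OF this, of "-c"] show "((\<lambda>t. v (c - t)) has_integral i) {c - b..c - a}" by simp
qed

lemma primitive_on_shift: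
  assumes "primitive_on a b f v"
  shows "primitive_on (a - c) (b - c) (\<lambda>t. f (t + c)) (\<lambda>t. v (t + c))"
  unfolding primitive_on_def
proof (intro conjI ballI)
  fix t assume "t \<in> {a - c..b - c}"
  then have "(v has_integral f (t+c) - f a) {a..t+c}" using assms by (auto simp: primitive_on_def)
  from has_integral_shift(1)[OF this, of c]
  show "((\<lambda>t. v (t + c)) has_integral f (t + c) - f (a - c + c)) {a - c..t}" by simp
qed (use assms in \<open>auto simp: primitive_on_def absolutely_integrable_shift\<close>)

lemma primitive_on_reflect:
  assumes f: "primitive_on a b f v" and "a \<le> b"
  shows "primitive_on (c - b) (c - a) (\<lambda>t. f (c - t)) (\<lambda>t. - v (c - t))"
  unfolding primitive_on_def
proof (intro conjI ballI)
  fix t assume t: "t \<in> {c - b..c - a}"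
  then have "(v has_integral f b - f (c - t)) {c - t..b}" using primitive_on_diff[OF f, of "c - t" b] by auto
  from has_integral_neg[OF has_integral_shift(2)[OF this, of c]]
  show "((\<lambda>t. - v (c - t)) has_integral f (c - t) - f (c - (c - b))) {c - b..t}" by simp
next
  show "(\<lambda>t. - v (c - t)) absolutely_integrable_on {c - b..c - a}"
    using absolutely_integrable_shift(2)[OF primitive_on_absolutely_integrable[OF f], of c] by (auto simp: primitive_on_def absolutely_integrable_on_def integrable_neg_iff)
qed


section \<open>Horizontal curves through the complex rows of a matrix\<close>

definition cplx_row :: "2 \<Rightarrow> mat2 \<Rightarrow> complex" where
  "cplx_row i g = Complex (g $ i $ 1) (g $ i $ 2)"

definition of_rows :: "complex \<Rightarrow> complex \<Rightarrow> mat2" where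
  "of_rows w z = (\<chi> i j. if j = 1 then Re (if i = 1 then w else z) else Im (if i = 1 then w else z))"

definition horiz :: "complex \<Rightarrow> mat2" where
  "horiz U = Re U *\<^sub>R p1 + Im U *\<^sub>R p2"

lemma mat2_eq_iff: "(A::mat2) = B \<longleftrightarrow>
   A$1$1 = B$1$1 \<and> A$1$2 = B$1$2 \<and> A$2$1 = B$2$1 \<and> A$2$2 = B$2$2"
  by (auto simp: vec_eq_iff forall_2)

lemma basis_entries:
  "p1$1$1 = 1/2" "p1$1$2 = 0" "p1$2$1 = 0" "p1$2$2 = -1/2"
  "p2$1$1 = 0" "p2$1$2 = 1/2" "p2$2$1 = 1/2" "p2$2$2 = 0"
  "k_so$1$1 = 0" "k_so$1$2 = -1/2" "k_so$2$1 = 1/2" "k_so$2$2 = 0"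
  by (simp_all add: p1_def p2_def k_so_def matrix_unit_def)

lemma matrix_mult_entry: "((A::mat2) ** B)$i$j = A$i$1 * B$1$j + A$i$2 * B$2$j"
  by (simp add: matrix_matrix_mult_def sum_2)

lemma mat_1_entries: "(mat 1 :: mat2)$1$1 = 1" "(mat 1 :: mat2)$1$2 = 0" "(mat 1 :: mat2)$2$1 = 0" "(mat 1 :: mat2)$2$2 = 1"
  by (simp_all add: mat_def)

lemma horiz_entries: "horiz U$1$1 = Re U/2" "horiz U$1$2 = Im U/2" "horiz U$2$1 = Im U/2" "horiz U$2$2 = - Re U/2"
  by (simp_all add: horiz_def basis_entries)

lemma cplx_row_of_rows [simp]: "cplx_row 1 (of_rows w z) = w" "cplx_row 2 (of_rows w z) = z"
  by (simp_all add: cplx_row_def of_rows_def)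

lemma of_rows_cplx_row [simp]: "of_rows (cplx_row 1 g) (cplx_row 2 g) = g"
  by (simp add: cplx_row_def of_rows_def mat2_eq_iff)

lemma cplx_row_eq_iff: "g = h \<longleftrightarrow> cplx_row 1 g = cplx_row 1 h \<and> cplx_row 2 g = cplx_row 2 h"
  by (auto simp: cplx_row_def mat2_eq_iff)

lemma SL2_iff_rows: "g \<in> SL2 \<longleftrightarrow> Im (cnj (cplx_row 1 g) * cplx_row 2 g) = 1"
  by (simp add: SL2_def det_2 cplx_row_def)

lemma cplx_row_nonzero: "g \<in> SL2 \<Longrightarrow> cplx_row i g \<noteq> 0"
proof -
  assume "g \<in> SL2"
  then have "cplx_row 1 g \<noteq> 0 \<and> cplx_row 2 g \<noteq> 0" by (auto simp: SL2_iff_rows)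
  then show ?thesis by (metis exhaust_2)
qed

text \<open>
  The reason for using complex rows: on each row, multiplication by a horizontal matrix from the
  right is conjugation followed by a complex multiplication, and the two rows decouple.
\<close>

lemma cplx_row_mult_horiz: "cplx_row i (g ** horiz U) = cnj (cplx_row i g) * U / 2"
  by (simp add: complex_eq_iff cplx_row_def matrix_mult_entry horiz_entries field_simps)

lemma cplx_row_mult: "cplx_row i (h ** g) = of_real (h$i$1) * cplx_row 1 g + of_real (h$i$2) * cplx_row 2 g"
  by (simp add: complex_eq_iff cplx_row_def matrix_mult_entry)

lemma bounded_linear_cplx_row: "bounded_linear (cplx_row i)"
proof -
  have "cplx_row i = (\<lambda>g. of_real (g$i$1) + \<i> * of_real (g$i$2))"
    by (auto simp: cplx_row_def complex_eq_iff fun_eq_iff)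
  then show ?thesis
    by (simp add: bounded_linear_add bounded_linear_const_mult bounded_linear_compose[OF bounded_linear_of_real]
       bounded_linear_compose[OF bounded_linear_vec_nth] bounded_linear_vec_nth)
qed

lemma of_rows_plus: "of_rows w z = of_rows w 0 + of_rows 0 z"
  by (simp add: mat2_eq_iff of_rows_def)

lemma bounded_linear_of_rows: "bounded_linear (\<lambda>w. of_rows w 0)" "bounded_linear (\<lambda>z. of_rows 0 z)"
  by (auto intro!: linear_conv_bounded_linear[THEN iffD1] linearI simp: mat2_eq_iff of_rows_def)

lemma SL2_mult: "g \<in> SL2 \<Longrightarrow> h \<in> SL2 \<Longrightarrow> g ** h \<in> SL2"
  by (simp add: SL2_def det_mul)

lemma SL2_matrix_inv: 
  assumes "g \<in> SL2"
  shows "matrix_inv g ** g = mat 1" "g ** matrix_inv g = mat 1" "matrix_inv g \<in> SL2"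
proof -
  have inv: "invertible g" using assms by (simp add: SL2_def invertible_det_nz)
  then have "\<exists>h. g ** h = mat 1 \<and> h ** g = mat 1" by (simp add: invertible_def)
  then have "g ** matrix_inv g = mat 1 \<and> matrix_inv g ** g = mat 1"
    unfolding matrix_inv_def by (rule someI_ex)
  then show 1: "matrix_inv g ** g = mat 1" "g ** matrix_inv g = mat 1" by auto
  have "det (matrix_inv g) * det g = 1" using arg_cong[OF 1(1), of det] by (simp add: det_mul)
  then show "matrix_inv g \<in> SL2" using assms by (simp add: SL2_def)
qed

lemma SL2_matrix_inv_cancel: "g \<in> SL2 \<Longrightarrow> matrix_inv g ** (g ** h) = h" for h :: mat2
  by (simp add: matrix_mul_assoc SL2_matrix_inv(1))

lemma mat_1_in_SL2: "mat 1 \<in> SL2" by (simp add: SL2_def)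

text \<open>
  Complex numbers serve as coordinates on the plane spanned by \<open>p1\<close> and \<open>p2\<close>; by
  \<open>De_inner_horiz\<close> below they are orthonormal.
\<close>

lemma De_eq: "De = range horiz"
proof
  show "range horiz \<subseteq> De"
    unfolding De_def horiz_def by (intro image_subsetI span_add span_scale span_base) auto
  show "De \<subseteq> range horiz" unfolding De_def
  proof (rule span_minimal)
    have "p1 = horiz 1" "p2 = horiz \<i>" by (simp_all add: horiz_def)
    then show "{p1, p2} \<subseteq> range horiz" by auto
    have lin: "linear horiz" by (rule linearI) (simp_all add: horiz_def algebra_simps)
    show "subspace (range horiz)" by (rule linear_subspace_image[OF lin subspace_UNIV])
  qed
qed

lemma independent_p1_p2: "independent {p1, p2}"
proof -
  have "p2 \<noteq> 0" by (simp add: mat2_eq_iff basis_entries)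
  moreover have "p1 \<notin> span {p2}"
    by (auto simp: span_singleton mat2_eq_iff basis_entries)
  ultimately show ?thesis by (simp add: independent_insert)
qed

lemma De_inner_horiz: "De_inner (horiz U) (horiz U) = (cmod U)\<^sup>2"
proof -
  have ne: "p1 \<noteq> p2" by (simp add: mat2_eq_iff basis_entries)
  have rep: "representation {p1, p2} (horiz U) b
      = Re U * (if b = p1 then 1 else 0) + Im U * (if b = p2 then 1 else 0)" for b
    unfolding horiz_def using independent_p1_p2
    by (simp add: real_vector.representation_add real_vector.representation_scale
         real_vector.representation_basis span_scale span_base)
  show ?thesis using ne by (simp add: De_inner_def rep cmod_power2 flip: power2_eq_square)
qed

lemma D_norm_horiz: "g \<in> SL2 \<Longrightarrow> D_norm g (g ** horiz U) = cmod U"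
  by (simp add: D_norm_def matrix_mul_assoc SL2_matrix_inv De_inner_horiz)

text \<open>
  A horizontal curve together with its control, the complex coordinate of its left-invariant
  velocity.
\<close>

definition horizontal_curve :: "real \<Rightarrow> real \<Rightarrow> (real \<Rightarrow> mat2) \<Rightarrow> (real \<Rightarrow> complex) \<Rightarrow> bool" where
  "horizontal_curve a b \<gamma> U \<longleftrightarrow> a \<le> b \<and> (\<forall>t\<in>{a..b}. \<gamma> t \<in> SL2) \<and> U absolutely_integrable_on {a..b} \<and>
     (\<forall>i. primitive_on a b (\<lambda>t. cplx_row i (\<gamma> t)) (\<lambda>t. cnj (cplx_row i (\<gamma> t)) * U t / 2))"

text \<open>
  The control is obtained from \<open>v\<close> by multiplying with the inverse of \<open>\<gamma>\<close>.  This is written with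
  the entries of the adjugate matrix, so that \<open>U\<close> is integrable as a sum of products of a continuous
  and an integrable function.
\<close>

lemma has_sr_length_imp_horizontal:
  assumes "has_sr_length \<gamma> a b l"
  shows "\<exists>U. horizontal_curve a b \<gamma> U \<and> l = integral {a..b} (\<lambda>t. cmod (U t))"
proof -
  from assms obtain v where ab: "a \<le> b" and SL: "\<And>t. t \<in> {a..b} \<Longrightarrow> \<gamma> t \<in> SL2"
    and v: "v absolutely_integrable_on {a..b}"
    and \<gamma>: "\<And>t. t \<in> {a..b} \<Longrightarrow> \<gamma> t = \<gamma> a + integral {a..t} v"
    and ae: "AE t in lebesgue. t \<in> {a..b} \<longrightarrow> v t \<in> D (\<gamma> t)"
    and l: "((\<lambda>t. D_norm (\<gamma> t) (v t)) has_integral l) {a..b}"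
    unfolding has_sr_length_def by blast
  obtain N where N: "negligible N" and ND: "{t. \<not> (t \<in> {a..b} \<longrightarrow> v t \<in> D (\<gamma> t))} \<subseteq> N"
    using ae unfolding eventually_ae_filter_negligible by blast
  have "primitive_on a b (\<lambda>t. \<gamma> a + integral {a..t} v) v" by (rule primitive_on_integral[OF v])
  then have prim: "primitive_on a b \<gamma> v"
    by (rule primitive_on_cong[OF _ negligible_empty]) (auto intro: \<gamma>[symmetric])
  have row: "primitive_on a b (\<lambda>t. cplx_row i (\<gamma> t)) (\<lambda>t. cplx_row i (v t))" for i
    by (rule primitive_on_linear[OF prim bounded_linear_cplx_row])
  define U where "U = (\<lambda>t. 2 * (of_real (\<gamma> t$2$2) * cplx_row 1 (v t) - of_real (\<gamma> t$1$2) * cplx_row 2 (v t)))"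
  have c\<gamma>: "continuous_on {a..b} \<gamma>" using prim by (rule primitive_on_continuous)
  have U: "U absolutely_integrable_on {a..b}"
    unfolding U_def using primitive_on_absolutely_integrable[OF row]
    by (intro set_integrable_mult_right set_integral_diff absolutely_integrable_continuous_mult continuous_intros c\<gamma>) auto
  have vU: "v t = \<gamma> t ** horiz (U t)" if t: "t \<in> {a..b} - N" for t
  proof -
    obtain u where u: "v t = \<gamma> t ** horiz u" using t ND unfolding D_def De_eq by blast
    have "det (\<gamma> t) = 1" using SL t by (auto simp: SL2_def)
    then have d: "\<gamma> t$1$1 * \<gamma> t$2$2 = 1 + \<gamma> t$1$2 * \<gamma> t$2$1" by (simp add: det_2)
    have "Re (U t) = (\<gamma> t$1$1 * \<gamma> t$2$2 - \<gamma> t$1$2 * \<gamma> t$2$1) * Re u"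
      "Im (U t) = (\<gamma> t$1$1 * \<gamma> t$2$2 - \<gamma> t$1$2 * \<gamma> t$2$1) * Im u"
      by (simp_all add: U_def u cplx_row_def matrix_mult_entry horiz_entries algebra_simps)
    then have "U t = u" unfolding d by (simp add: complex_eq_iff)
    then show ?thesis using u by simp
  qed
  have "primitive_on a b (\<lambda>t. cplx_row i (\<gamma> t)) (\<lambda>t. cnj (cplx_row i (\<gamma> t)) * U t / 2)" for i
    by (rule primitive_on_cong[OF row N]) (auto simp: vU cplx_row_mult_horiz)
  then have "horizontal_curve a b \<gamma> U" by (auto simp: horizontal_curve_def ab SL U)
  moreover have "((\<lambda>t. cmod (U t)) has_integral l) {a..b}"
    by (rule has_integral_spike[OF N _ l]) (auto simp: vU D_norm_horiz SL)
  ultimately show ?thesis by (auto dest!: integral_unique)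
qed

lemma horizontal_imp_has_sr_length:
  assumes "horizontal_curve a b \<gamma> U"
  shows "has_sr_length \<gamma> a b (integral {a..b} (\<lambda>t. cmod (U t)))"
proof -
  from assms have ab: "a \<le> b" and SL: "\<And>t. t \<in> {a..b} \<Longrightarrow> \<gamma> t \<in> SL2"
    and U: "U absolutely_integrable_on {a..b}"
    and row: "\<And>i. primitive_on a b (\<lambda>t. cplx_row i (\<gamma> t)) (\<lambda>t. cplx_row i (\<gamma> t ** horiz (U t)))"
    by (auto simp: horizontal_curve_def cplx_row_mult_horiz)
  let ?v = "\<lambda>t. \<gamma> t ** horiz (U t)"
  have "primitive_on a b (\<lambda>t. of_rows (cplx_row 1 (\<gamma> t)) 0 + of_rows 0 (cplx_row 2 (\<gamma> t)))
     (\<lambda>t. of_rows (cplx_row 1 (?v t)) 0 + of_rows 0 (cplx_row 2 (?v t)))"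
    by (intro primitive_on_add primitive_on_linear[OF row] bounded_linear_of_rows)
  then have prim: "primitive_on a b \<gamma> ?v"
    unfolding of_rows_plus[symmetric] by simp
  have "((\<lambda>t. cmod (U t)) has_integral integral {a..b} (\<lambda>t. cmod (U t))) {a..b}"
    using U by (auto simp: absolutely_integrable_on_def)
  then have "((\<lambda>t. D_norm (\<gamma> t) (?v t)) has_integral integral {a..b} (\<lambda>t. cmod (U t))) {a..b}"
    by (rule has_integral_eq[rotated]) (auto simp: D_norm_horiz SL)
  moreover have "AE t in lebesgue. t \<in> {a..b} \<longrightarrow> ?v t \<in> D (\<gamma> t)"
    by (auto simp: D_def De_eq)
  moreover have "\<gamma> t = \<gamma> a + integral {a..t} ?v" if "t \<in> {a..b}" for t
    using prim that by (auto simp: primitive_on_def dest!: bspec[OF _ that] integral_unique)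
  ultimately show ?thesis
    unfolding has_sr_length_def using ab SL primitive_on_absolutely_integrable[OF prim] by blast
qed

lemma has_sr_length_iff:
  "has_sr_length \<gamma> a b l \<longleftrightarrow> (\<exists>U. horizontal_curve a b \<gamma> U \<and> l = integral {a..b} (\<lambda>t. cmod (U t)))"
  using has_sr_length_imp_horizontal horizontal_imp_has_sr_length by blast


section \<open>Half-plane coordinates\<close>

lemma norm_exp_power2: "(cmod (exp l))\<^sup>2 * exp (- 2 * Re l) = 1"
  by (simp add: power2_eq_square flip: exp_add)

text \<open>
  A continuous logarithm of a row exists because \<open>z' / z = cnj z / z * U / 2\<close> is integrable: the
  product of \<open>z\<close> with the exponential of the negative integral has derivative zero.
\<close>

lemma exponential_lift:
  assumes z: "primitive_on a b z (\<lambda>t. cnj (z t) * U t / 2)" and nz: "\<And>t. t \<in> {a..b} \<Longrightarrow> z t \<noteq> 0"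
    and U: "U absolutely_integrable_on {a..b}"
  shows "\<exists>\<Lambda>. primitive_on a b \<Lambda> (\<lambda>t. cnj (z t) / z t * U t / 2) \<and> (\<forall>t\<in>{a..b}. z t = exp (\<Lambda> t))"
proof -
  let ?W = "\<lambda>t. cnj (z t) / z t * U t / 2"
  have cz: "continuous_on {a..b} z" by (rule primitive_on_continuous[OF z])
  have W: "?W absolutely_integrable_on {a..b}"
    by (intro set_integrable_divide absolutely_integrable_continuous_mult U continuous_intros cz) (use nz in auto)
  define \<Lambda> where "\<Lambda> = (\<lambda>t. (Ln (z a) - integral {a..a} ?W) + integral {a..t} ?W)"
  have \<Lambda>: "primitive_on a b \<Lambda> ?W" unfolding \<Lambda>_def by (rule primitive_on_integral[OF W])
  have E: "primitive_on a b (\<lambda>t. exp (- \<Lambda> t)) (\<lambda>t. - exp (- \<Lambda> t) * ?W t)"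
    by (rule primitive_on_chain[OF \<Lambda>, of UNIV]) (auto intro!: derivative_eq_intros continuous_intros)
  have "primitive_on a b (\<lambda>t. z t * exp (- \<Lambda> t)) (\<lambda>t. 0)"
    by (rule primitive_on_cong[OF primitive_on_mult[OF z E] negligible_empty])
       (use nz in \<open>auto simp: field_simps\<close>)
  from primitive_on_zero_imp_const[OF this]
  have c: "z t * exp (- \<Lambda> t) = z a * exp (- \<Lambda> a)" if "t \<in> {a..b}" for t using that .
  have "z t = exp (\<Lambda> t)" if t: "t \<in> {a..b}" for t
  proof -
    have "z a * exp (- \<Lambda> a) = 1" using nz[of a] t by (simp add: \<Lambda>_def exp_minus exp_Ln)
    with c[OF t] show ?thesis by (simp add: exp_minus field_simps)
  qed
  with \<Lambda> show ?thesis by blast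
qed

text \<open>
  The parameters are those of the Iwasawa decomposition \<open>N A K\<close>: \<open>x\<close> for the unipotent part,
  \<open>Re l\<close> for the diagonal part and \<open>Im l\<close> for the rotation.
\<close>

definition iwasawa :: "complex \<Rightarrow> real \<Rightarrow> mat2" where
  "iwasawa l x = of_rows (exp l * Complex x (- exp (- 2 * Re l))) (exp l)"

text \<open>
  The equations of a horizontal curve in these parameters.  They can be integrated one after the
  other for any given \<open>V\<close>.
\<close>

definition iwasawa_curve :: "real \<Rightarrow> real \<Rightarrow> (real \<Rightarrow> complex) \<Rightarrow> (real \<Rightarrow> real) \<Rightarrow> (real \<Rightarrow> complex) \<Rightarrow> bool" where
  "iwasawa_curve a b \<Lambda> X V \<longleftrightarrow> a \<le> b \<and> V absolutely_integrable_on {a..b} \<and>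
     primitive_on a b \<Lambda> (\<lambda>t. V t / 2) \<and>
     primitive_on a b X (\<lambda>t. - (exp (- 2 * Re (\<Lambda> t)) * Im (V t)))"

text \<open>
  The lower row gives \<open>\<Lambda>\<close>.  For the quotient \<open>q = w / z\<close> of the rows, \<open>det = 1\<close> turns the
  Wronskian \<open>w' z - w z'\<close> into \<open>\<i> U\<close>, whence \<open>q' = \<i> y V\<close>, and it also gives
  \<open>Im q = - y\<close>.
\<close>

lemma horizontal_curve_coords:
  assumes H: "horizontal_curve a b \<gamma> U"
  shows "\<exists>\<Lambda> X. iwasawa_curve a b \<Lambda> X (\<lambda>t. exp (- 2 * \<i> * Im (\<Lambda> t)) * U t) \<and>
      (\<forall>t\<in>{a..b}. \<gamma> t = iwasawa (\<Lambda> t) (X t))"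
proof -
  let ?w = "\<lambda>t. cplx_row 1 (\<gamma> t)" and ?z = "\<lambda>t. cplx_row 2 (\<gamma> t)"
  have SL: "\<gamma> t \<in> SL2" if "t \<in> {a..b}" for t using H that by (auto simp: horizontal_curve_def)
  have U: "U absolutely_integrable_on {a..b}" using H by (auto simp: horizontal_curve_def)
  have w: "primitive_on a b ?w (\<lambda>t. cnj (?w t) * U t / 2)" and z: "primitive_on a b ?z (\<lambda>t. cnj (?z t) * U t / 2)"
    using H by (auto simp: horizontal_curve_def)
  have nz: "?z t \<noteq> 0" if "t \<in> {a..b}" for t using cplx_row_nonzero[OF SL[OF that]] .
  obtain \<Lambda> where \<Lambda>: "primitive_on a b \<Lambda> (\<lambda>t. cnj (?z t) / ?z t * U t / 2)" 
    and ez: "\<And>t. t \<in> {a..b} \<Longrightarrow> ?z t = exp (\<Lambda> t)"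
    using exponential_lift[OF z nz U] by blast
  define V where "V = (\<lambda>t. exp (- 2 * \<i> * Im (\<Lambda> t)) * U t)"
  define y where "y = (\<lambda>t. exp (- 2 * Re (\<Lambda> t)))"
  have c\<Lambda>: "continuous_on {a..b} \<Lambda>" by (rule primitive_on_continuous[OF \<Lambda>])
  have Vi: "V absolutely_integrable_on {a..b}"
    unfolding V_def by (intro absolutely_integrable_continuous_mult U continuous_intros c\<Lambda>)
  have cnjexp: "cnj (exp l) / exp l = exp (- 2 * \<i> * Im l)" for l :: complex
  proof -
    have "cnj l - l = - 2 * \<i> * Im l" by (simp add: complex_eq_iff)
    then show ?thesis by (simp add: exp_cnj flip: exp_diff)
  qed
  have \<Lambda>': "primitive_on a b \<Lambda> (\<lambda>t. V t / 2)"
    by (rule primitive_on_cong[OF \<Lambda> negligible_empty]) (auto simp: V_def ez cnjexp)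
  have inv: "primitive_on a b (\<lambda>t. inverse (?z t)) (\<lambda>t. - inverse (?z t ^ 2) * (cnj (?z t) * U t / 2))"
    by (rule primitive_on_chain[OF z, of "- {0}"])
      (use nz in \<open>auto intro!: derivative_eq_intros continuous_intros simp: power2_eq_square\<close>)
  define q where "q = (\<lambda>t. ?w t * inverse (?z t))"
  have normz: "cmod (?z t) ^ 2 * y t = 1" if "t \<in> {a..b}" for t
    using that norm_exp_power2[of "\<Lambda> t"] by (simp only: ez y_def)
  have Imq: "Im (q t) = - y t" if t: "t \<in> {a..b}" for t
  proof -
    have "cmod (?z t) ^ 2 \<noteq> 0" using nz[OF t] by simp
    moreover have "Im (?w t * cnj (?z t)) = -1"
      using SL[OF t] by (simp add: SL2_iff_rows algebra_simps)
    moreover have "q t = ?w t * cnj (?z t) / of_real (cmod (?z t) ^ 2)"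
      using nz[OF t] by (simp add: q_def divide_simps complex_norm_square del: of_real_power) 
    ultimately have "Im (q t) * cmod (?z t)^2 = - 1" by (simp add: Im_divide_of_real del: of_real_power)
    with normz[OF t] \<open>cmod (?z t) ^ 2 \<noteq> 0\<close> show ?thesis
      by (metis (no_types, opaque_lifting) mult.commute mult_left_cancel mult_minus_left)
  qed
  have q: "primitive_on a b q (\<lambda>t. \<i> * of_real (y t) * V t)"
    unfolding q_def
  proof (rule primitive_on_cong[OF primitive_on_mult[OF w inv] negligible_empty])
    fix t assume "t \<in> {a..b} - {}"
    then have t: "t \<in> {a..b}" by simp
    have "cnj (?w t) * ?z t - ?w t * cnj (?z t) = 2 * \<i>"
      using SL[OF t] by (simp add: SL2_iff_rows complex_eq_iff algebra_simps)
    then have *: "cnj (?w t) * ?z t = ?w t * cnj (?z t) + 2 * \<i>" by (simp add: algebra_simps)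
    have "cnj (?w t) * U t / 2 * inverse (?z t) + ?w t * (- inverse ((?z t)\<^sup>2) * (cnj (?z t) * U t / 2))
       = (cnj (?w t) * ?z t - ?w t * cnj (?z t)) * U t / (2 * (?z t)\<^sup>2)"
      using nz[OF t] by (simp add: field_simps power2_eq_square)
    also have "\<dots> = \<i> * U t / (?z t)\<^sup>2" unfolding * by simp
    also have "\<dots> = \<i> * of_real (y t) * (cnj (?z t) / ?z t * U t)"
    proof -
      have "of_real (y t) * (cnj (?z t) * ?z t) = 1"
        using arg_cong[OF normz[OF t], of complex_of_real]
        by (simp add: complex_norm_square mult.commute del: of_real_power flip: of_real_power)
      then have "of_real (y t) * cnj (?z t) = 1 / ?z t"
        using nz[OF t] by (simp add: eq_divide_eq mult.assoc)
      moreover have "\<i> * of_real (y t) * (cnj (?z t) / ?z t * U t) = \<i> * (of_real (y t) * cnj (?z t)) / ?z t * U t"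
        by simp
      ultimately show ?thesis by (simp only: power2_eq_square) simp
    qed
    also have "\<dots> = \<i> * of_real (y t) * V t" using t by (simp add: V_def ez cnjexp)
    finally show "\<i> * of_real (y t) * V t = cnj (?w t) * U t / 2 * inverse (?z t) + ?w t * (- inverse ((?z t)\<^sup>2) * (cnj (?z t) * U t / 2))" ..
  qed auto
  define X where "X = (\<lambda>t. Re (q t))"
  have X: "primitive_on a b X (\<lambda>t. - (exp (- 2 * Re (\<Lambda> t)) * Im (V t)))"
    using primitive_on_linear[OF q bounded_linear_Re] by (simp add: X_def y_def)
  have "\<gamma> t = of_rows (exp (\<Lambda> t) * Complex (X t) (- exp (- 2 * Re (\<Lambda> t)))) (exp (\<Lambda> t))"
    if t: "t \<in> {a..b}" for t
  proof -
    have "Complex (X t) (- exp (- 2 * Re (\<Lambda> t))) = q t"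
      using Imq[OF t] by (simp add: complex_eq_iff X_def y_def)
    moreover have "exp (\<Lambda> t) * q t = ?w t" using nz[OF t] by (simp add: q_def flip: ez[OF t])
    ultimately show ?thesis by (simp add: cplx_row_eq_iff ez[OF t])
  qed
  moreover have "a \<le> b" using H by (simp add: horizontal_curve_def)
  ultimately show ?thesis using \<Lambda>' X Vi unfolding V_def iwasawa_curve_def iwasawa_def by blast
qed

lemma horizontal_curve_of_coords:
  assumes "iwasawa_curve a b \<Lambda> X V"
  shows "horizontal_curve a b (\<lambda>t. iwasawa (\<Lambda> t) (X t)) (\<lambda>t. exp (2 * \<i> * Im (\<Lambda> t)) * V t)"
proof -
  have ab: "a \<le> b" and Vi: "V absolutely_integrable_on {a..b}" 
    and \<Lambda>: "primitive_on a b \<Lambda> (\<lambda>t. V t / 2)"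
    and X: "primitive_on a b X (\<lambda>t. - (exp (- 2 * Re (\<Lambda> t)) * Im (V t)))"
    using assms by (auto simp: iwasawa_curve_def)
  define y where "y = (\<lambda>t. exp (- 2 * Re (\<Lambda> t)))"
  have c\<Lambda>: "continuous_on {a..b} \<Lambda>" by (rule primitive_on_continuous[OF \<Lambda>])
  have E: "primitive_on a b (\<lambda>t. exp (\<Lambda> t)) (\<lambda>t. exp (\<Lambda> t) * (V t / 2))"
    by (rule primitive_on_chain[OF \<Lambda>, of UNIV]) (auto intro!: derivative_eq_intros continuous_intros)
  have L: "primitive_on a b (\<lambda>t. Re (\<Lambda> t)) (\<lambda>t. Re (V t / 2))"
    by (rule primitive_on_linear[OF \<Lambda> bounded_linear_Re])
  have y: "primitive_on a b y (\<lambda>t. - 2 * exp (- 2 * Re (\<Lambda> t)) * (Re (V t / 2)))"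
    unfolding y_def
    by (rule primitive_on_chain[OF L, of UNIV]) (auto intro!: derivative_eq_intros continuous_intros)
  have q: "primitive_on a b (\<lambda>t. complex_of_real (X t) + - \<i> * of_real (y t))
    (\<lambda>t. complex_of_real (- (exp (- 2 * Re (\<Lambda> t)) * Im (V t))) + - \<i> * of_real (- 2 * exp (- 2 * Re (\<Lambda> t)) * (Re (V t / 2))))"
    by (intro primitive_on_add primitive_on_linear[OF X bounded_linear_of_real] 
        primitive_on_linear[OF y bounded_linear_const_mult[OF bounded_linear_of_real]])
  have q: "primitive_on a b (\<lambda>t. Complex (X t) (- y t)) (\<lambda>t. \<i> * of_real (y t) * V t)"
    by (rule primitive_on_cong[OF q negligible_empty]) (auto simp: complex_eq_iff y_def)
  have cnjexp: "cnj (exp l) * exp (2 * \<i> * Im l) = exp l" for l :: complex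
  proof -
    have "cnj l + 2 * \<i> * Im l = l" by (simp add: complex_eq_iff)
    then show ?thesis by (simp add: exp_cnj flip: exp_add)
  qed
  have w: "primitive_on a b (\<lambda>t. exp (\<Lambda> t) * Complex (X t) (- y t))
     (\<lambda>t. cnj (exp (\<Lambda> t) * Complex (X t) (- y t)) * (exp (2 * \<i> * Im (\<Lambda> t)) * V t) / 2)"
  proof (rule primitive_on_cong[OF primitive_on_mult[OF E q] negligible_empty])
    fix t
    have "cnj (exp (\<Lambda> t) * Complex (X t) (- y t)) * (exp (2 * \<i> * Im (\<Lambda> t)) * V t) / 2
      = (cnj (exp (\<Lambda> t)) * exp (2 * \<i> * Im (\<Lambda> t))) * cnj (Complex (X t) (- y t)) * V t / 2"
      by simp
    also have "\<dots> = exp (\<Lambda> t) * V t * (cnj (Complex (X t) (- y t)) / 2)"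
      unfolding cnjexp by simp
    also have "cnj (Complex (X t) (- y t)) / 2 = Complex (X t) (- y t) / 2 + \<i> * of_real (y t)"
      by (simp add: complex_eq_iff)
    finally show "cnj (exp (\<Lambda> t) * Complex (X t) (- y t)) * (exp (2 * \<i> * Im (\<Lambda> t)) * V t) / 2
       = exp (\<Lambda> t) * (V t / 2) * Complex (X t) (- y t) + exp (\<Lambda> t) * (\<i> * of_real (y t) * V t)"
      by (simp add: algebra_simps)
  qed auto
  have z: "primitive_on a b (\<lambda>t. exp (\<Lambda> t)) (\<lambda>t. cnj (exp (\<Lambda> t)) * (exp (2 * \<i> * Im (\<Lambda> t)) * V t) / 2)"
    by (rule primitive_on_cong[OF E negligible_empty]) (auto simp: cnjexp mult.assoc[symmetric] simp del: exp_cnj)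
  have Im1: "Im (cnj (e * Complex x (- v)) * e) = (cmod e)\<^sup>2 * v" for e x v
    by (simp add: cmod_power2) (simp add: algebra_simps power2_eq_square)
  have "(cmod (exp (\<Lambda> t)))\<^sup>2 * y t = 1" for t
    using norm_exp_power2[of "\<Lambda> t"] by (simp only: y_def)
  then have SL: "of_rows (exp (\<Lambda> t) * Complex (X t) (- y t)) (exp (\<Lambda> t)) \<in> SL2" for t
    by (simp only: SL2_iff_rows cplx_row_of_rows Im1)
  have U: "(\<lambda>t. exp (2 * \<i> * Im (\<Lambda> t)) * V t) absolutely_integrable_on {a..b}"
    by (intro absolutely_integrable_continuous_mult Vi continuous_intros c\<Lambda>)
  show ?thesis
    unfolding horizontal_curve_def iwasawa_def y_def[symmetric] forall_2 cplx_row_of_rows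
    using ab SL U w z by (auto simp only: y_def)
qed


section \<open>The sub-Riemannian distance\<close>

lemma horizontal_curve_left_mult:
  assumes g: "g \<in> SL2" and H: "horizontal_curve a b \<gamma> U"
  shows "horizontal_curve a b (\<lambda>t. g ** \<gamma> t) U"
  unfolding horizontal_curve_def
proof (intro conjI ballI allI)
  fix i
  have row: "primitive_on a b (\<lambda>t. cplx_row j (\<gamma> t)) (\<lambda>t. cnj (cplx_row j (\<gamma> t)) * U t / 2)" for j
    using H by (simp add: horizontal_curve_def)
  have "primitive_on a b (\<lambda>t. complex_of_real (g$i$1) * cplx_row 1 (\<gamma> t) + complex_of_real (g$i$2) * cplx_row 2 (\<gamma> t))
    (\<lambda>t. complex_of_real (g$i$1) * (cnj (cplx_row 1 (\<gamma> t)) * U t / 2) + complex_of_real (g$i$2) * (cnj (cplx_row 2 (\<gamma> t)) * U t / 2))"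
    by (intro primitive_on_add primitive_on_linear[OF row] bounded_linear_mult_right)
  then show "primitive_on a b (\<lambda>t. cplx_row i (g ** \<gamma> t)) (\<lambda>t. cnj (cplx_row i (g ** \<gamma> t)) * U t / 2)"
    by (rule primitive_on_cong[OF _ negligible_empty]) (auto simp: cplx_row_mult field_simps)
qed (use assms in \<open>auto simp: horizontal_curve_def SL2_mult\<close>)

lemma horizontal_curve_shift:
  assumes "horizontal_curve a b \<gamma> U"
  shows "horizontal_curve (a - c) (b - c) (\<lambda>t. \<gamma> (t + c)) (\<lambda>t. U (t + c))"
  using assms primitive_on_shift[of a b _ _ c] absolutely_integrable_shift(1)[where v=U and a=a and b=b and c=c]
  unfolding horizontal_curve_def by fastforce

lemma horizontal_curve_reverse:
  assumes "horizontal_curve a b \<gamma> U"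
  shows "horizontal_curve (- b) (- a) (\<lambda>t. \<gamma> (- t)) (\<lambda>t. - U (- t))"
  unfolding horizontal_curve_def
proof (intro conjI ballI allI)
  fix i
  have "primitive_on (0 - b) (0 - a) (\<lambda>t. cplx_row i (\<gamma> (0 - t))) (\<lambda>t. - (cnj (cplx_row i (\<gamma> (0 - t))) * U (0 - t) / 2))"
    by (rule primitive_on_reflect) (use assms in \<open>auto simp: horizontal_curve_def\<close>)
  then show "primitive_on (- b) (- a) (\<lambda>t. cplx_row i (\<gamma> (- t))) (\<lambda>t. cnj (cplx_row i (\<gamma> (- t))) * (- U (- t)) / 2)"
    by simp
next
  show "(\<lambda>t. - U (- t)) absolutely_integrable_on {- b..- a}"
    using absolutely_integrable_shift(2)[where v=U and a=a and b=b and c=0] assms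
    by (auto simp: horizontal_curve_def absolutely_integrable_on_def integrable_neg_iff)
qed (use assms in \<open>auto simp: horizontal_curve_def\<close>)

lemma horizontal_curve_combine:
  assumes f: "horizontal_curve a b f U" and g: "horizontal_curve b c g V" and eq: "f b = g b"
  shows "horizontal_curve a c (\<lambda>t. if t \<le> b then f t else g t) (\<lambda>t. if t \<le> b then U t else V t)"
  unfolding horizontal_curve_def
proof (intro conjI ballI allI)
  have ab: "a \<le> b" "b \<le> c" using f g by (auto simp: horizontal_curve_def)
  then show "a \<le> c" by simp
  fix i
  have "primitive_on a c (\<lambda>t. if t \<le> b then cplx_row i (f t) else cplx_row i (g t))
     (\<lambda>t. if t \<le> b then cnj (cplx_row i (f t)) * U t / 2 else cnj (cplx_row i (g t)) * V t / 2)"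
    by (rule primitive_on_combine) (use f g eq ab in \<open>auto simp: horizontal_curve_def\<close>)
  then show "primitive_on a c (\<lambda>t. cplx_row i (if t \<le> b then f t else g t))
     (\<lambda>t. cnj (cplx_row i (if t \<le> b then f t else g t)) * (if t \<le> b then U t else V t) / 2)"
    by (rule primitive_on_cong[OF _ negligible_empty]) auto
next
  have "primitive_on a b (\<lambda>t. integral {a..t} U) U" "primitive_on b c (\<lambda>t. integral {a..b} U + integral {b..t} V) V"
    using f g primitive_on_integral[where v=U and a=a and b=b and c=0] by (auto simp: horizontal_curve_def intro: primitive_on_integral)
  from primitive_on_combine[OF this] f g
  show "(\<lambda>t. if t \<le> b then U t else V t) absolutely_integrable_on {a..c}"
    by (auto simp: horizontal_curve_def primitive_on_def)
qed (use f g in \<open>auto simp: horizontal_curve_def\<close>)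

lemma horizontal_curve_norm_int:
  "horizontal_curve a b \<gamma> U \<Longrightarrow> (\<lambda>t. cmod (U t)) integrable_on {a..b}"
  by (simp add: horizontal_curve_def absolutely_integrable_on_def)

lemma joining_lengthsI:
  assumes "horizontal_curve a b \<gamma> U" "((\<lambda>t. cmod (U t)) has_integral l) {a..b}" "\<gamma> a = x" "\<gamma> b = y"
  shows "l \<in> joining_lengths x y"
  unfolding joining_lengths_def using assms horizontal_imp_has_sr_length[OF assms(1)]
  by (auto simp: integral_unique)

lemma joining_lengthsE:
  assumes "l \<in> joining_lengths x y"
  obtains a b \<gamma> U where "horizontal_curve a b \<gamma> U" "((\<lambda>t. cmod (U t)) has_integral l) {a..b}" 
    "\<gamma> a = x" "\<gamma> b = y" "a \<le> b"
proof -
  from assms obtain \<gamma> a b where *: "\<gamma> a = x" "\<gamma> b = y" and "has_sr_length \<gamma> a b l"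
    unfolding joining_lengths_def by auto
  then obtain U where U: "horizontal_curve a b \<gamma> U" "l = integral {a..b} (\<lambda>t. cmod (U t))"
    unfolding has_sr_length_iff by auto
  then show thesis using that[OF U(1) _ *] horizontal_curve_norm_int[OF U(1)]
    by (auto simp: horizontal_curve_def)
qed

lemma joining_lengths_nonneg: "l \<in> joining_lengths x y \<Longrightarrow> 0 \<le> l"
  by (elim joining_lengthsE) (auto intro: has_integral_nonneg)

lemma joining_lengths_bdd_below: "bdd_below (joining_lengths x y)"
  using joining_lengths_nonneg by (auto intro!: bdd_belowI)

lemma joining_lengths_refl:
  assumes "x \<in> SL2" shows "0 \<in> joining_lengths x x"
proof (rule joining_lengthsI)
  show "horizontal_curve 0 0 (\<lambda>_. x) (\<lambda>_. 0)"
    using assms by (simp add: horizontal_curve_def primitive_on_const)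
qed auto

lemma joining_lengths_sym:
  assumes "l \<in> joining_lengths x y" shows "l \<in> joining_lengths y x"
  using assms
proof (rule joining_lengthsE)
  fix a b \<gamma> U assume *: "horizontal_curve a b \<gamma> U" "((\<lambda>t. cmod (U t)) has_integral l) {a..b}" "\<gamma> a = x" "\<gamma> b = y"
  show ?thesis
    by (rule joining_lengthsI[OF horizontal_curve_reverse[OF *(1)]]) (use * in auto)
qed

lemma joining_lengths_add:
  assumes "l \<in> joining_lengths x y" "m \<in> joining_lengths y z" shows "l + m \<in> joining_lengths x z"
proof -
  from assms(1) obtain a b f U where f: "horizontal_curve a b f U" "((\<lambda>t. cmod (U t)) has_integral l) {a..b}" 
    "f a = x" "f b = y" "a \<le> b" by (rule joining_lengthsE)
  from assms(2) obtain c d g V where g: "horizontal_curve c d g V" "((\<lambda>t. cmod (V t)) has_integral m) {c..d}" 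
    "g c = y" "g d = z" "c \<le> d" by (rule joining_lengthsE)
  let ?s = "c - b"
  have g': "horizontal_curve b (d - ?s) (\<lambda>t. g (t + ?s)) (\<lambda>t. V (t + ?s))"
    using horizontal_curve_shift[OF g(1), of ?s] by simp
  have m: "((\<lambda>t. cmod (V (t + ?s))) has_integral m) {b..d - ?s}"
    using has_integral_shift(1)[OF g(2), of ?s] by simp
  have "f b = (\<lambda>t. g (t + ?s)) b" using f g by simp
  from horizontal_curve_combine[OF f(1) g' this]
  show ?thesis
  proof (rule joining_lengthsI)
    show "((\<lambda>t. cmod (if t \<le> b then U t else V (t + ?s))) has_integral l + m) {a..d - ?s}"
    proof (rule has_integral_combine[of a b])
      show "((\<lambda>t. cmod (if t \<le> b then U t else V (t + ?s))) has_integral l) {a..b}"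
        by (rule has_integral_eq[OF _ f(2)]) auto
      show "((\<lambda>t. cmod (if t \<le> b then U t else V (t + ?s))) has_integral m) {b..d - ?s}"
        by (rule has_integral_spike[OF negligible_sing[of b] _ m]) auto
    qed (use f g in auto)
  qed (use f g in auto)
qed

lemma joining_lengths_left_mult:
  assumes "g \<in> SL2" "l \<in> joining_lengths x y" shows "l \<in> joining_lengths (g ** x) (g ** y)"
  using assms(2)
proof (rule joining_lengthsE)
  fix a b \<gamma> U assume *: "horizontal_curve a b \<gamma> U" "((\<lambda>t. cmod (U t)) has_integral l) {a..b}" "\<gamma> a = x" "\<gamma> b = y"
  show ?thesis
    by (rule joining_lengthsI[OF horizontal_curve_left_mult[OF assms(1) *(1)] *(2)]) (use * in auto)
qed

lemma sr_dist_left_invariant: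
  assumes g: "g \<in> SL2" and x: "x \<in> SL2" "y \<in> SL2"
  shows "sr_dist (g ** x) (g ** y) = sr_dist x y"
proof -
  have "joining_lengths (g ** x) (g ** y) = joining_lengths x y"
    using joining_lengths_left_mult[OF g, of _ x y]
      joining_lengths_left_mult[OF SL2_matrix_inv(3)[OF g], of _ "g ** x" "g ** y"]
    unfolding SL2_matrix_inv_cancel[OF g] by auto
  then show ?thesis by (simp add: sr_dist_def SL2_mult g x)
qed

lemma coords_exist:
  assumes "g \<in> SL2"
  shows "\<exists>l x. g = iwasawa l x"
proof -
  have "horizontal_curve 0 0 (\<lambda>_. g) (\<lambda>_. 0)"
    using assms by (simp add: horizontal_curve_def primitive_on_const)
  from horizontal_curve_coords[OF this] show ?thesis by fastforce
qed

text \<open>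
  In the half-plane coordinates the only constraint on a horizontal curve is
  \<open>X' = - 2 y \<theta>'\<close>.  With \<open>y\<close> a quadratic polynomial that is positive on \<open>[0, 1]\<close> and
  \<open>\<theta>' = A + B (1 - 6 t + 6 t\<^sup>2)\<close>, the coefficient \<open>A\<close> fixes the end value of \<open>\<theta>\<close>, while
  \<open>B\<close> does not influence it and fixes the end value of \<open>X\<close>.
\<close>

lemma joining_lengths_nonempty:
  assumes "g \<in> SL2" "h \<in> SL2" shows "joining_lengths g h \<noteq> {}"
proof -
  obtain l0 x0 where g: "g = iwasawa l0 x0"
    using coords_exist[OF assms(1)] by blast
  obtain l1 x1 where h: "h = iwasawa l1 x1"
    using coords_exist[OF assms(2)] by blast
  define p where "p = exp (- 2 * Re l0)"
  define p' where "p' = exp (- 2 * Re l1)"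
  have pp: "p > 0" "p' > 0" by (auto simp: p_def p'_def)
  define q where "q = p' - p + 1"
  \<comment> \<open>linear interpolation between \<open>p\<close> and \<open>p'\<close> plus \<open>t (1 - t)\<close>; without the quadratic term \<open>B\<close> would have no effect\<close>
  define y where "y = (\<lambda>t::real. p + q * t - t\<^sup>2)"
  define y' where "y' = (\<lambda>t::real. q - 2 * t)"
  define A where "A = Im l1 - Im l0"
  \<comment> \<open>the integral of \<open>y (1 - 6 t + 6 t\<^sup>2)\<close> over \<open>[0, 1]\<close> is \<open>- 1 / 30\<close>, that of \<open>y\<close> is \<open>p + q / 2 - 1 / 3\<close>\<close>
  define B where "B = 30 * (A * (p + q/2 - 1/3) + (x1 - x0) / 2)"
  define \<theta> where "\<theta> = (\<lambda>t::real. Im l0 + A * t + B * (t - 3 * t\<^sup>2 + 2 * t^3))"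
  define \<theta>' where "\<theta>' = (\<lambda>t::real. A + B * (1 - 6 * t + 6 * t\<^sup>2))"
  define X where "X = (\<lambda>t::real. x0 - 2 * (p * (A + B) * t + (q * (A + B) - 6 * p * B) * t\<^sup>2 / 2
       + (6 * p * B - 6 * q * B - (A + B)) * t^3 / 3 + (6 * q * B + 6 * B) * t^4 / 4 - 6 * B * t^5 / 5))"
  have ypos: "y t > 0" if "t \<in> {0..1}" for t
  proof -
    have "y t = (1 - t) * p + t * p' + t * (1 - t)" by (simp add: y_def q_def algebra_simps power2_eq_square)
    moreover have "(1 - t) * p + t * p' > 0"
    proof (cases "t = 1")
      case False then show ?thesis using that pp by (intro add_pos_nonneg mult_pos_pos mult_nonneg_nonneg) auto
    qed (use pp in auto)
    moreover have "t * (1 - t) \<ge> 0" using that by auto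
    ultimately show ?thesis by linarith
  qed
  define V where "V = (\<lambda>t. Complex (- y' t / y t) (2 * \<theta>' t))"
  define \<Lambda> where "\<Lambda> = (\<lambda>t. Complex (- ln (y t) / 2) (\<theta> t))"
  have cy: "continuous_on {0..1} y" unfolding y_def by (intro continuous_intros)
  have cy': "continuous_on {0..1} (\<lambda>t. - y' t / (2 * y t))" 
    unfolding y'_def by (intro continuous_intros cy) (use ypos in force)
  have c\<theta>': "continuous_on {0..1} \<theta>'" unfolding \<theta>'_def by (intro continuous_intros)
  have L: "primitive_on 0 1 (\<lambda>t. - ln (y t) / 2) (\<lambda>t. - y' t / (2 * y t))"
  proof (rule primitive_on_C1[OF _ cy'])
    fix t :: real assume t: "t \<in> {0..1}"
    have "(y has_real_derivative y' t) (at t within {0..1})"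
      unfolding y_def y'_def by (auto intro!: derivative_eq_intros)
    then have "((\<lambda>t. - ln (y t) / 2) has_real_derivative - y' t / (2 * y t)) (at t within {0..1})"
      using ypos[OF t] by (auto intro!: derivative_eq_intros simp: field_simps)
    then show "((\<lambda>t. - ln (y t) / 2) has_vector_derivative - y' t / (2 * y t)) (at t within {0..1})"
      by (simp add: has_real_derivative_iff_has_vector_derivative)
  qed
  have T: "primitive_on 0 1 \<theta> \<theta>'"
  proof (rule primitive_on_C1[OF _ c\<theta>'])
    fix t :: real 
    have "(\<theta> has_real_derivative \<theta>' t) (at t within {0..1})"
      unfolding \<theta>_def \<theta>'_def by (auto intro!: derivative_eq_intros simp: algebra_simps power2_eq_square)
    then show "(\<theta> has_vector_derivative \<theta>' t) (at t within {0..1})"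
      by (simp add: has_real_derivative_iff_has_vector_derivative)
  qed
  have eL: "exp (- 2 * Re (\<Lambda> t)) = y t" if "t \<in> {0..1}" for t
    using ypos[OF that] by (simp add: \<Lambda>_def)
  have XX: "primitive_on 0 1 X (\<lambda>t. - (y t * (2 * \<theta>' t)))"
  proof (rule primitive_on_C1)
    fix t :: real 
    have "(X has_real_derivative - (y t * (2 * \<theta>' t))) (at t within {0..1})"
      unfolding X_def \<theta>'_def y_def by (auto intro!: derivative_eq_intros simp: field_simps power_numeral_reduce)
    then show "(X has_vector_derivative - (y t * (2 * \<theta>' t))) (at t within {0..1})"
      by (simp add: has_real_derivative_iff_has_vector_derivative)
    show "continuous_on {0..1} (\<lambda>t. - (y t * (2 * \<theta>' t)))" by (intro continuous_intros cy c\<theta>')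
  qed
  have "primitive_on 0 1 (\<lambda>t. complex_of_real (- ln (y t) / 2) + \<i> * of_real (\<theta> t))
     (\<lambda>t. complex_of_real (- y' t / (2 * y t)) + \<i> * of_real (\<theta>' t))"
    by (intro primitive_on_add primitive_on_linear[OF L bounded_linear_of_real]
         primitive_on_linear[OF T bounded_linear_const_mult[OF bounded_linear_of_real]])
  then have \<Lambda>: "primitive_on 0 1 \<Lambda> (\<lambda>t. V t / 2)"
    by (rule primitive_on_cong[OF _ negligible_empty]) (auto simp: complex_eq_iff \<Lambda>_def V_def)
  have X: "primitive_on 0 1 X (\<lambda>t. - (exp (- 2 * Re (\<Lambda> t)) * Im (V t)))"
    by (rule primitive_on_cong[OF XX negligible_empty]) (auto simp only: Diff_empty eL V_def complex.sel)
  have "(\<lambda>t. 2 * (V t / 2)) absolutely_integrable_on {0..1}"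
    using primitive_on_absolutely_integrable[OF \<Lambda>] by (intro set_integrable_mult_right) auto
  then have V: "V absolutely_integrable_on {0..1}" by simp
  let ?\<gamma> = "\<lambda>t. iwasawa (\<Lambda> t) (X t)"
  have H: "horizontal_curve 0 1 ?\<gamma> (\<lambda>t. exp (2 * \<i> * Im (\<Lambda> t)) * V t)"
    by (rule horizontal_curve_of_coords) (use V \<Lambda> X in \<open>simp add: iwasawa_curve_def\<close>)
  have "\<Lambda> 0 = l0" by (simp add: complex_eq_iff \<Lambda>_def y_def p_def \<theta>_def)
  moreover have "\<Lambda> 1 = l1" by (simp add: complex_eq_iff \<Lambda>_def y_def q_def p'_def \<theta>_def A_def)
  moreover have "X 0 = x0" by (simp add: X_def)
  moreover have "X 1 = x1" by (simp add: X_def B_def field_simps)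
  ultimately have "?\<gamma> 0 = g" "?\<gamma> 1 = h" by (simp_all add: g h)
  with joining_lengthsI[OF H integrable_integral[OF horizontal_curve_norm_int[OF H]]]
  show ?thesis by blast
qed

text \<open>
  The triangle inequality and symmetry come from joining and reversing curves.  Points at distance
  zero coincide because the quotient of the end values of each row is the exponential of a number
  whose modulus is at most half the length of the curve.
\<close>

lemma Metric_space_sr_dist: "Metric_space SL2 sr_dist"
proof
  fix x y z :: mat2
  show "0 \<le> sr_dist x y"
    by (auto simp: sr_dist_def intro!: cInf_greatest[OF joining_lengths_nonempty] dest: joining_lengths_nonneg)
  have "joining_lengths x y = joining_lengths y x" using joining_lengths_sym by blast
  then show "sr_dist x y = sr_dist y x" by (auto simp: sr_dist_def)
  assume x: "x \<in> SL2" and y: "y \<in> SL2"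
  show "sr_dist x y = 0 \<longleftrightarrow> x = y"
  proof
    assume "x = y"
    then have "Inf (joining_lengths x y) \<le> 0"
      using joining_lengths_refl[OF x] by (intro cInf_lower joining_lengths_bdd_below) auto
    moreover have "Inf (joining_lengths x y) \<ge> 0"
      by (rule cInf_greatest[OF joining_lengths_nonempty[OF x y] joining_lengths_nonneg])
    ultimately show "sr_dist x y = 0" using x y by (simp add: sr_dist_def)
  next
    assume "sr_dist x y = 0"
    then have Inf0: "Inf (joining_lengths x y) = 0" using x y by (simp add: sr_dist_def)
    have "cplx_row i y / cplx_row i x = 1" for i
    proof (rule ccontr)
      assume ne: "cplx_row i y / cplx_row i x \<noteq> 1"
      have "isCont exp (0::complex)" by simp
      then obtain d where d: "d > 0" "\<And>w::complex. cmod w < d \<Longrightarrow> cmod (exp w - 1) < cmod (cplx_row i y / cplx_row i x - 1)"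
        using ne unfolding continuous_at_eps_delta by (metis (no_types, lifting) dist_0_norm dist_norm exp_zero right_minus_eq zero_less_norm_iff dist_commute)
      obtain l where l: "l \<in> joining_lengths x y" "l < d"
        using d(1) Inf0 cInf_lessD[OF joining_lengths_nonempty[OF x y], of d] by auto
      from l(1) obtain a b \<gamma> U where \<gamma>: "horizontal_curve a b \<gamma> U" "((\<lambda>t. cmod (U t)) has_integral l) {a..b}" 
        "\<gamma> a = x" "\<gamma> b = y" "a \<le> b" by (rule joining_lengthsE)
      have nz: "cplx_row i (\<gamma> t) \<noteq> 0" if "t \<in> {a..b}" for t
        using \<gamma>(1) that by (auto simp: horizontal_curve_def intro!: cplx_row_nonzero)
      have row: "primitive_on a b (\<lambda>t. cplx_row i (\<gamma> t)) (\<lambda>t. cnj (cplx_row i (\<gamma> t)) * U t / 2)"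
        and Ui: "U absolutely_integrable_on {a..b}"
        using \<gamma>(1) by (auto simp: horizontal_curve_def)
      obtain \<Lambda> where \<Lambda>: "primitive_on a b \<Lambda> (\<lambda>t. cnj (cplx_row i (\<gamma> t)) / cplx_row i (\<gamma> t) * U t / 2)"
        "\<forall>t\<in>{a..b}. cplx_row i (\<gamma> t) = exp (\<Lambda> t)"
        using exponential_lift[OF row nz Ui] by blast
      have "cmod (\<Lambda> b - \<Lambda> a) \<le> integral {a..b} (\<lambda>t. cmod (cnj (cplx_row i (\<gamma> t)) / cplx_row i (\<gamma> t) * U t / 2))"
        by (rule primitive_on_norm_bound[OF \<Lambda>(1)]) (use \<gamma>(5) in auto)
      also have "\<dots> = integral {a..b} (\<lambda>t. cmod (U t) / 2)"
        by (rule integral_cong) (use nz in \<open>auto simp: norm_mult norm_divide\<close>)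
      also have "\<dots> = l / 2" using \<gamma>(2) by (simp add: integral_unique)
      also have "\<dots> < d" using l joining_lengths_nonneg[OF l(1)] by simp
      finally have "cmod (exp (\<Lambda> b - \<Lambda> a) - 1) < cmod (cplx_row i y / cplx_row i x - 1)" by (rule d(2))
      moreover have "cplx_row i y = exp (\<Lambda> b)" "cplx_row i x = exp (\<Lambda> a)" using \<Lambda>(2) \<gamma> by auto
      ultimately show False by (simp add: exp_diff)
    qed
    then have "cplx_row i y = cplx_row i x" for i
      using cplx_row_nonzero[OF x, of i] by (simp add: divide_eq_1_iff)
    then show "x = y" by (simp add: cplx_row_eq_iff)
  qed
  assume z: "z \<in> SL2"
  have "Inf (joining_lengths x z) - l \<le> Inf (joining_lengths y z)" if l: "l \<in> joining_lengths x y" for l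
  proof (rule cInf_greatest[OF joining_lengths_nonempty[OF y z]])
    fix m assume "m \<in> joining_lengths y z"
    from cInf_lower[OF joining_lengths_add[OF l this] joining_lengths_bdd_below]
    show "Inf (joining_lengths x z) - l \<le> m" by simp
  qed
  then have "Inf (joining_lengths x z) - Inf (joining_lengths y z) \<le> Inf (joining_lengths x y)"
    by (intro cInf_greatest joining_lengths_nonempty x y) (auto simp: algebra_simps)
  then show "sr_dist x z \<le> sr_dist x y + sr_dist y z" using x y z by (simp add: sr_dist_def)
qed


section \<open>Calibration of curves with a rotating control\<close>

lemma iwasawa_eqD:
  assumes "iwasawa l x = iwasawa l' x'"
  shows "exp l = exp l'" "x = x'" "Re l = Re l'"
proof -
  show e: "exp l = exp l'" using arg_cong[OF assms, of "cplx_row 2"] by (simp add: iwasawa_def)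
  then have "Complex x (- exp (- 2 * Re l)) = Complex x' (- exp (- 2 * Re l'))"
    using arg_cong[OF assms, of "cplx_row 1"] by (simp add: iwasawa_def)
  then show "x = x'" "Re l = Re l'" by auto
qed

lemma cplx_row_iwasawa: "cplx_row 2 (iwasawa l x) = exp l"
  by (simp add: iwasawa_def)

lemma cnj_exp_power2: "cnj (exp l) ^ 2 = of_real ((cmod (exp l))\<^sup>2) * exp (- 2 * \<i> * Im l)"
proof -
  have "cnj l + cnj l = of_real (2 * Re l) + - 2 * \<i> * Im l" by (simp add: complex_eq_iff)
  then have "cnj (exp l) ^ 2 = exp (of_real (2 * Re l) + - 2 * \<i> * Im l)"
    by (simp only: power2_eq_square exp_cnj flip: exp_add)
  also have "\<dots> = of_real (exp (2 * Re l)) * exp (- 2 * \<i> * Im l)"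
    by (simp only: exp_add exp_of_real)
  also have "exp (2 * Re l) = (cmod (exp l))\<^sup>2" by (simp add: exp_double)
  finally show ?thesis .
qed

lemma iwasawa_curve_norm_bound:
  assumes "iwasawa_curve a b \<Lambda> X V" "a \<le> t" "t \<le> b"
  shows "cmod (\<Lambda> t - \<Lambda> a) \<le> integral {a..b} (\<lambda>t. cmod (V t)) / 2"
proof -
  have L: "primitive_on a b \<Lambda> (\<lambda>t. V t / 2)" and V: "V absolutely_integrable_on {a..b}"
    using assms by (auto simp: iwasawa_curve_def)
  have Vi: "(\<lambda>t. cmod (V t)) integrable_on {a..b}" using V by (simp add: absolutely_integrable_on_def)
  have "cmod (\<Lambda> t - \<Lambda> a) \<le> integral {a..t} (\<lambda>t. cmod (V t / 2))"
    by (rule primitive_on_norm_bound[OF L]) (use assms in auto)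
  also have "\<dots> = integral {a..t} (\<lambda>t. cmod (V t)) / 2" by (simp add: norm_divide)
  also have "\<dots> \<le> integral {a..b} (\<lambda>t. cmod (V t)) / 2"
    using Vi assms integrable_subinterval_real[OF Vi, of a t]
    by (intro divide_right_mono integral_subset_le) auto
  finally show ?thesis .
qed

lemma exp_minus_one_bound:
  assumes "\<bar>s\<bar> \<le> (T::real)" shows "\<bar>1 - exp s\<bar> \<le> exp T - 1"
proof -
  have "exp s \<le> exp T" using assms by simp
  moreover have "1 - exp s \<le> - s" using exp_ge_add_one_self[of s] by linarith
  moreover have "1 + T \<le> exp T" by (rule exp_ge_add_one_self)
  ultimately show ?thesis using assms by linarith
qed

text \<open>
  The covector \<open>(P, sqrt (1 - P\<^sup>2))\<close> with \<open>P = \<beta> (1 - y)\<close>, applied to \<open>(Im V, Re V)\<close>, is an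
  exact differential: \<open>Im V\<close> and \<open>- y * Im V\<close> are the derivatives of \<open>2 Im \<Lambda>\<close> and \<open>X\<close>, and the
  remaining term is a function of \<open>ln y = - 2 Re \<Lambda>\<close> times the derivative of \<open>- ln y\<close>.
\<close>

lemma calibration_potential:
  fixes \<beta> T :: real
  obtains G where "\<And>a b \<Lambda> X V. iwasawa_curve a b \<Lambda> X V \<Longrightarrow> (\<And>t. t \<in> {a..b} \<Longrightarrow> \<bar>2 * Re (\<Lambda> t)\<bar> \<le> T) \<Longrightarrow>
     primitive_on a b (\<lambda>t. 2 * \<beta> * Im (\<Lambda> t) + \<beta> * X t - G (- 2 * Re (\<Lambda> t)))
       (\<lambda>t. \<beta> * (1 - exp (- 2 * Re (\<Lambda> t))) * Im (V t)
          + sqrt (1 - (\<beta> * (1 - exp (- 2 * Re (\<Lambda> t))))\<^sup>2) * Re (V t))"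
proof -
  define Q where "Q = (\<lambda>s. sqrt (1 - (\<beta> * (1 - exp s))\<^sup>2))"
  have cQ: "continuous_on A Q" for A unfolding Q_def by (intro continuous_intros)
  let ?R = "T + 1"
  define G where "G = (\<lambda>s. integral {- ?R..s} Q)"
  have G: "(G has_real_derivative Q s) (at s)" if "s \<in> {- ?R<..<?R}" for s
  proof -
    have "(G has_real_derivative Q s) (at s within {- ?R..?R})"
      unfolding G_def by (rule integral_has_real_derivative[OF cQ]) (use that in auto)
    moreover have "at s within {- ?R..?R} = at s" by (rule at_within_Icc_at) (use that in auto)
    ultimately show ?thesis by simp
  qed
  show thesis
  proof (rule that[of G])
    fix a b \<Lambda> X V
    assume c: "iwasawa_curve a b \<Lambda> X V" and R: "\<And>t. t \<in> {a..b} \<Longrightarrow> \<bar>2 * Re (\<Lambda> t)\<bar> \<le> T"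
    have L: "primitive_on a b \<Lambda> (\<lambda>t. V t / 2)"
      and X: "primitive_on a b X (\<lambda>t. - (exp (- 2 * Re (\<Lambda> t)) * Im (V t)))"
      using c by (auto simp: iwasawa_curve_def)
    have s: "primitive_on a b (\<lambda>t. - 2 * Re (\<Lambda> t)) (\<lambda>t. - 2 * Re (V t / 2))"
      by (rule primitive_on_linear[OF L bounded_linear_const_mult[OF bounded_linear_Re]])
    have Gs: "primitive_on a b (\<lambda>t. G (- 2 * Re (\<Lambda> t))) (\<lambda>t. Q (- 2 * Re (\<Lambda> t)) * (- 2 * Re (V t / 2)))"
    proof (rule primitive_on_chain[OF s _ _ G cQ])
      show "(\<lambda>t. - 2 * Re (\<Lambda> t)) ` {a..b} \<subseteq> {- ?R<..<?R}" using R by fastforce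
    qed auto
    have "primitive_on a b (\<lambda>t. 2 * \<beta> * Im (\<Lambda> t) + \<beta> * X t - G (- 2 * Re (\<Lambda> t)))
       (\<lambda>t. 2 * \<beta> * Im (V t / 2) + \<beta> * (- (exp (- 2 * Re (\<Lambda> t)) * Im (V t))) - Q (- 2 * Re (\<Lambda> t)) * (- 2 * Re (V t / 2)))"
      by (intro primitive_on_sub primitive_on_add Gs primitive_on_linear[OF X bounded_linear_mult_right]
           primitive_on_linear[OF L bounded_linear_const_mult[OF bounded_linear_Im]])
    then show "primitive_on a b (\<lambda>t. 2 * \<beta> * Im (\<Lambda> t) + \<beta> * X t - G (- 2 * Re (\<Lambda> t)))
       (\<lambda>t. \<beta> * (1 - exp (- 2 * Re (\<Lambda> t))) * Im (V t)
          + sqrt (1 - (\<beta> * (1 - exp (- 2 * Re (\<Lambda> t))))\<^sup>2) * Re (V t))"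
      by (rule primitive_on_cong[OF _ negligible_empty]) (auto simp: Q_def algebra_simps)
  qed
qed

lemma unit_covector_bound:
  fixes p :: real and v :: complex
  assumes "\<bar>p\<bar> \<le> 1" shows "p * Im v + sqrt (1 - p\<^sup>2) * Re v \<le> cmod v"
proof -
  have "p\<^sup>2 \<le> 1" using assms by (simp add: abs_square_le_1)
  then have "cmod (Complex (sqrt (1 - p\<^sup>2)) p) = 1" by (simp add: cmod_def)
  then have "Re (cnj (Complex (sqrt (1 - p\<^sup>2)) p) * v) \<le> cmod v"
    using complex_Re_le_cmod[of "cnj (Complex (sqrt (1 - p\<^sup>2)) p) * v"] by (simp add: norm_mult)
  then show ?thesis by (simp add: algebra_simps)
qed

lemma has_vector_derivative_rotation:
  "((\<lambda>t. c * exp (\<i> * of_real (\<beta> * t))) has_vector_derivative \<i> * of_real \<beta> * (c * exp (\<i> * of_real (\<beta> * t)))) (at t)"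
proof -
  have "((\<lambda>z. c * exp (\<i> * (of_real \<beta> * z))) has_field_derivative
      \<i> * of_real \<beta> * (c * exp (\<i> * (of_real \<beta> * of_real t)))) (at (of_real t))"
    by (auto intro!: derivative_eq_intros)
  from has_vector_derivative_real_field[OF this] show ?thesis by simp
qed

text \<open>
  Writing \<open>p = cnj z\<^sup>2 * U\<close>, one computes \<open>p' = \<bar>z\<bar>\<^sup>2 + \<i> \<beta> p\<close> and
  \<open>(\<bar>z\<bar>\<^sup>2)' = Re p\<close>, so the two contributions to the derivative cancel.  The conserved quantity
  expresses that the projected curve has constant geodesic curvature.
\<close>

lemma rotating_control_conservation:
  assumes z: "primitive_on a b z (\<lambda>t. cnj (z t) * U t / 2)"
    and U: "primitive_on a b U (\<lambda>t. \<i> * of_real \<beta> * U t)"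
    and U1: "\<And>t. t \<in> {a..b} \<Longrightarrow> cmod (U t) = 1" and t: "t \<in> {a..b}"
  shows "Im (cnj (z t) ^ 2 * U t) - \<beta> * (cmod (z t))\<^sup>2 = Im (cnj (z a) ^ 2 * U a) - \<beta> * (cmod (z a))\<^sup>2"
proof -
  have cz: "primitive_on a b (\<lambda>t. cnj (z t)) (\<lambda>t. cnj (cnj (z t) * U t / 2))"
    by (rule primitive_on_linear[OF z bounded_linear_cnj])
  note P = primitive_on_mult[OF primitive_on_mult[OF cz cz] U]
  note Q = primitive_on_mult[OF z cz]
  have "primitive_on a b (\<lambda>t. Im (cnj (z t) * cnj (z t) * U t) - \<beta> * Re (z t * cnj (z t))) (\<lambda>t. 0)"
  proof (rule primitive_on_cong[OF primitive_on_sub[OF primitive_on_linear[OF P bounded_linear_Im]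
          primitive_on_linear[OF Q bounded_linear_const_mult[OF bounded_linear_Re]]] negligible_empty])
    fix t assume "t \<in> {a..b} - {}"
    then have "(Re (U t))\<^sup>2 + (Im (U t))\<^sup>2 = 1" using U1[of t] by (simp add: cmod_def)
    then have 1: "Re (U t) * Re (U t) = 1 - Im (U t) * Im (U t)" by (simp add: power2_eq_square)
    let ?Z = "cnj (z t)"
    have "(cnj (?Z * U t / 2) * ?Z + ?Z * cnj (?Z * U t / 2)) * U t = z t * ?Z * (cnj (U t) * U t)"
      by simp
    also have "cnj (U t) * U t = 1" using 1 by (simp add: complex_eq_iff)
    finally have e1: "(cnj (?Z * U t / 2) * ?Z + ?Z * cnj (?Z * U t / 2)) * U t = z t * ?Z" by simp
    have e2: "Im (z t * ?Z) = 0" by simp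
    have e3: "Re (?Z * U t / 2 * ?Z + z t * cnj (?Z * U t / 2)) = Re (?Z * ?Z * U t)"
      by (simp add: field_simps)
    have e4: "Im (?Z * ?Z * (\<i> * of_real \<beta> * U t)) = \<beta> * Re (?Z * ?Z * U t)"
      by (simp add: algebra_simps)
    have "Im ((cnj (?Z * U t / 2) * ?Z + ?Z * cnj (?Z * U t / 2)) * U t + ?Z * ?Z * (\<i> * of_real \<beta> * U t)) = \<beta> * Re (?Z * ?Z * U t)"
      unfolding e1 plus_complex.sel e2 e4 by simp
    then show "0 = Im ((cnj (?Z * U t / 2) * ?Z + ?Z * cnj (?Z * U t / 2)) * U t + ?Z * ?Z * (\<i> * of_real \<beta> * U t)) -
         \<beta> * Re (?Z * U t / 2 * ?Z + z t * cnj (?Z * U t / 2))"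
      unfolding e3 by simp
  qed auto
  from primitive_on_zero_imp_const[OF this t] show ?thesis
    by (simp add: power2_eq_square cmod_power2[unfolded power2_eq_square])
qed

text \<open>
  The matrices with lower row \<open>e\<close> and upper row \<open>- \<i> e\<close>, \<open>cmod e = 1\<close>, are the rotations.  Left
  translation can therefore move the starting point to a rotation without changing the control.
\<close>

lemma normalize_start:
  assumes g: "g \<in> SL2" and e: "cmod e = 1"
  obtains h where "h \<in> SL2" "cplx_row 2 (h ** g) = e"
proof
  let ?k = "of_rows (- \<i> * e) e"
  have "(Re e)\<^sup>2 + (Im e)\<^sup>2 = 1" using e by (simp add: cmod_def)
  then have k: "?k \<in> SL2" by (simp add: SL2_iff_rows power2_eq_square)
  then show "?k ** matrix_inv g \<in> SL2" by (intro SL2_mult SL2_matrix_inv g)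
  show "cplx_row 2 (?k ** matrix_inv g ** g) = e"
    by (simp add: matrix_mul_assoc[symmetric] SL2_matrix_inv[OF g])
qed

text \<open>
  The lower row is normalized at the start to a square root of \<open>U a\<close>, so that \<open>V\<close> starts in the
  direction \<open>1\<close>.  The conservation law then gives
  \<open>Im V = \<beta> (1 - y)\<close>, and on a short arc \<open>Re V\<close> stays positive, which makes \<open>(Im V, Re V)\<close>
  equal to the calibrating covector.  A competitor of smaller length stays in the
  region \<open>\<bar>ln y\<bar> \<le> b - a\<close> where the calibration is valid; the bound \<open>2 \<pi>\<close> guarantees that the
  angles \<open>Im \<Lambda>\<close> of both curves, which are determined by the end points only up to multiples of
  \<open>2 \<pi>\<close>, change by the same amount.
\<close>

lemma rotating_control_minimal:
  assumes H: "horizontal_curve a b \<gamma> U" and ab: "a < b"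
    and U: "\<And>t. t \<in> {a..b} \<Longrightarrow> U t = c * exp (\<i> * of_real (\<beta> * t))" and c: "cmod c = 1"
    and T: "\<bar>\<beta>\<bar> * (exp (b - a) - 1) < 1" "b - a < 2 * pi"
    and l: "l \<in> joining_lengths (\<gamma> a) (\<gamma> b)"
  shows "b - a \<le> l"
proof (rule ccontr)
  assume "\<not> b - a \<le> l"
  then have lT: "l < b - a" by simp
  define T where "T = b - a"
  \<comment> \<open>with lower row \<open>e\<close> at \<open>a\<close>, \<open>V a = cnj e / e * e\<^sup>2 = 1\<close>\<close>
  define e where "e = csqrt (U a)"
  have U1: "cmod (U t) = 1" if "t \<in> {a..b}" for t using U[OF that] c by (simp add: norm_mult)
  have e2: "e\<^sup>2 = U a" by (simp add: e_def)
  then have "(cmod e)\<^sup>2 = 1" using U1[of a] ab by (simp flip: norm_power)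
  then have e1: "cmod e = 1" by (metis norm_ge_zero power2_eq_1_iff one_neq_neg_one abs_norm_cancel abs_1 real_sqrt_abs real_sqrt_one)
  have ga: "\<gamma> a \<in> SL2" using H by (auto simp: horizontal_curve_def)
  obtain h where h: "h \<in> SL2" "cplx_row 2 (h ** \<gamma> a) = e" using normalize_start[OF ga e1] .
  define \<delta> where "\<delta> = (\<lambda>t. h ** \<gamma> t)"
  have \<delta>: "horizontal_curve a b \<delta> U" unfolding \<delta>_def by (rule horizontal_curve_left_mult[OF h(1) H])
  obtain \<Lambda> X where c1: "iwasawa_curve a b \<Lambda> X (\<lambda>t. exp (- 2 * \<i> * Im (\<Lambda> t)) * U t)" (is "iwasawa_curve _ _ _ _ ?V")
    and d1: "\<And>t. t \<in> {a..b} \<Longrightarrow> \<delta> t = iwasawa (\<Lambda> t) (X t)"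
    using horizontal_curve_coords[OF \<delta>] by blast
  define V where "V = ?V"
  have c1: "iwasawa_curve a b \<Lambda> X V" using c1 by (simp add: V_def)
  have V1: "cmod (V t) = 1" if "t \<in> {a..b}" for t using U1[OF that] by (simp add: V_def norm_mult)
  have row: "cplx_row 2 (\<delta> t) = exp (\<Lambda> t)" if "t \<in> {a..b}" for t using d1[OF that] by (simp add: cplx_row_iwasawa)
  have ea: "exp (\<Lambda> a) = e" using row[of a] h(2) ab by (simp add: \<delta>_def)
  then have ReL: "Re (\<Lambda> a) = 0" using e1 by (metis norm_exp_eq_Re exp_eq_one_iff)
  have intV: "integral {a..b} (\<lambda>t. cmod (V t)) = T"
  proof -
    have "integral {a..b} (\<lambda>t. cmod (V t)) = integral {a..b} (\<lambda>t. 1)" by (rule integral_cong) (simp add: V1)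
    then show ?thesis using ab by (simp add: T_def)
  qed
  have L: "primitive_on a b \<Lambda> (\<lambda>t. V t / 2)" using c1 by (auto simp: iwasawa_curve_def)
  have bound: "\<bar>2 * Re (\<Lambda> t)\<bar> \<le> T" if "t \<in> {a..b}" for t
    using iwasawa_curve_norm_bound[OF c1, of t] abs_Re_le_cmod[of "\<Lambda> t - \<Lambda> a"] that ReL unfolding intV by auto
  define y where "y = (\<lambda>t. exp (- 2 * Re (\<Lambda> t)))"
  have small: "\<bar>\<beta> * (1 - exp s)\<bar> < 1" if "\<bar>s\<bar> \<le> T" for s
  proof -
    have "\<bar>\<beta>\<bar> * \<bar>1 - exp s\<bar> \<le> \<bar>\<beta>\<bar> * (exp T - 1)"
      by (intro mult_left_mono exp_minus_one_bound that) auto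
    then show ?thesis using T(1) by (simp add: abs_mult T_def)
  qed
  have z: "primitive_on a b (\<lambda>t. cplx_row 2 (\<delta> t)) (\<lambda>t. cnj (cplx_row 2 (\<delta> t)) * U t / 2)"
    using \<delta> by (auto simp: horizontal_curve_def)
  have Up: "primitive_on a b U (\<lambda>t. \<i> * of_real \<beta> * U t)"
  proof -
    have "primitive_on a b (\<lambda>t. c * exp (\<i> * of_real (\<beta> * t))) (\<lambda>t. \<i> * of_real \<beta> * (c * exp (\<i> * of_real (\<beta> * t))))"
    proof (rule primitive_on_C1)
      fix t
      show "((\<lambda>t. c * exp (\<i> * of_real (\<beta> * t))) has_vector_derivative \<i> * of_real \<beta> * (c * exp (\<i> * of_real (\<beta> * t)))) (at t within {a..b})"
        by (rule has_vector_derivative_at_within[OF has_vector_derivative_rotation])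
    qed (intro continuous_intros)
    then show ?thesis by (rule primitive_on_cong[OF _ negligible_empty]) (simp_all add: U)
  qed
  have ImV: "Im (V t) = \<beta> * (1 - y t)" if t: "t \<in> {a..b}" for t
  proof -
    have n: "(cmod (exp (\<Lambda> t)))\<^sup>2 * y t = 1" using norm_exp_power2[of "\<Lambda> t"] by (simp add: y_def)
    have "Im (cnj (exp (\<Lambda> t)) ^ 2 * U t) - \<beta> * (cmod (exp (\<Lambda> t)))\<^sup>2 = Im (cnj e ^ 2 * U a) - \<beta> * (cmod e)\<^sup>2"
      using rotating_control_conservation[OF z Up U1 t] t by (simp add: row ea)
    also have "cnj e ^ 2 * U a = 1"
      using e1 unfolding e2[symmetric] by (simp add: power_mult_distrib[symmetric] mult.commute[of "cnj e"] complex_norm_square[symmetric])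
    finally have m: "Im (cnj (exp (\<Lambda> t)) ^ 2 * U t) = \<beta> * ((cmod (exp (\<Lambda> t)))\<^sup>2 - 1)" using e1 by (simp add: algebra_simps)
    have "cnj (exp (\<Lambda> t)) ^ 2 * U t = of_real ((cmod (exp (\<Lambda> t)))\<^sup>2) * V t"
      by (simp only: V_def cnj_exp_power2 mult.assoc)
    moreover have imr: "Im (of_real r * v) = r * Im v" for r v by simp
    ultimately have m2: "(cmod (exp (\<Lambda> t)))\<^sup>2 * Im (V t) = \<beta> * ((cmod (exp (\<Lambda> t)))\<^sup>2 - 1)"
      using m by (simp only: imr)
    have "Im (V t) = (cmod (exp (\<Lambda> t)))\<^sup>2 * y t * Im (V t)" by (simp only: n mult_1)
    also have "\<dots> = y t * (\<beta> * ((cmod (exp (\<Lambda> t)))\<^sup>2 - 1))" unfolding m2[symmetric] by (simp only: ac_simps)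
    also have "\<dots> = \<beta> * ((cmod (exp (\<Lambda> t)))\<^sup>2 * y t - y t)" by (simp add: algebra_simps)
    finally show ?thesis unfolding n .
  qed
  have smallV: "\<bar>Im (V t)\<bar> < 1" if "t \<in> {a..b}" for t
    using small[of "- 2 * Re (\<Lambda> t)"] bound[OF that] ImV[OF that] by (simp add: y_def)
  have VV: "(Re (V t))\<^sup>2 + (Im (V t))\<^sup>2 = 1" if "t \<in> {a..b}" for t
    using V1[OF that] by (simp add: cmod_def)
  have cV: "continuous_on {a..b} V"
  proof -
    have "continuous_on {a..b} U" by (rule primitive_on_continuous[OF Up])
    then show ?thesis unfolding V_def by (intro continuous_intros primitive_on_continuous[OF L])
  qed
  have RenZ: "Re (V t) \<noteq> 0" if "t \<in> {a..b}" for t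
    using VV[OF that] smallV[OF that] by (auto simp: power2_eq_1_iff)
  have Va: "V a = 1"
  proof -
    have "exp (- 2 * \<i> * Im (\<Lambda> a)) = cnj e ^ 2"
    proof -
      have "- 2 * \<i> * Im (\<Lambda> a) = cnj (\<Lambda> a) + cnj (\<Lambda> a)" using ReL by (simp add: complex_eq_iff)
      then have "exp (- 2 * \<i> * Im (\<Lambda> a)) = exp (cnj (\<Lambda> a) + cnj (\<Lambda> a))" by (simp only:)
      also have "\<dots> = cnj e ^ 2" by (simp only: ea[symmetric] power2_eq_square exp_cnj exp_add)
      finally show ?thesis .
    qed
    then have "V a = cnj e ^ 2 * e\<^sup>2" by (simp add: V_def e2)
    then show ?thesis using e1 by (simp add: power_mult_distrib[symmetric] mult.commute[of "cnj e"] complex_norm_square[symmetric])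
  qed
  have RePos: "Re (V t) > 0" if t: "t \<in> {a..b}" for t
  proof (rule ccontr)
    assume "\<not> Re (V t) > 0"
    then have "\<exists>s\<ge>a. s \<le> t \<and> Re (V s) = 0"
      by (intro IVT2') (use t Va in \<open>auto intro!: continuous_intros continuous_on_subset[OF cV]\<close>)
    then show False using RenZ t by force
  qed
  have ReV: "Re (V t) = sqrt (1 - (Im (V t))\<^sup>2)" if "t \<in> {a..b}" for t
  proof -
    have "1 - (Im (V t))\<^sup>2 = (Re (V t))\<^sup>2" using VV[OF that] by linarith
    then show ?thesis using RePos[OF that] by simp
  qed
  obtain G where G: "\<And>a b \<Lambda> X V. iwasawa_curve a b \<Lambda> X V \<Longrightarrow> (\<And>t. t \<in> {a..b} \<Longrightarrow> \<bar>2 * Re (\<Lambda> t)\<bar> \<le> T) \<Longrightarrow>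
     primitive_on a b (\<lambda>t. 2 * \<beta> * Im (\<Lambda> t) + \<beta> * X t - G (- 2 * Re (\<Lambda> t)))
       (\<lambda>t. \<beta> * (1 - exp (- 2 * Re (\<Lambda> t))) * Im (V t)
          + sqrt (1 - (\<beta> * (1 - exp (- 2 * Re (\<Lambda> t))))\<^sup>2) * Re (V t))"
    using calibration_potential[of T \<beta>] by blast
  have "primitive_on a b (\<lambda>t. 2 * \<beta> * Im (\<Lambda> t) + \<beta> * X t - G (- 2 * Re (\<Lambda> t))) (\<lambda>t. 1)"
  proof (rule primitive_on_cong[OF G[OF c1 bound] negligible_empty])
    fix t assume "t \<in> {a..b} - {}"
    then have t: "t \<in> {a..b}" by simp
    have p: "\<beta> * (1 - exp (- 2 * Re (\<Lambda> t))) = Im (V t)" using ImV[OF t] by (simp add: y_def)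
    show "1 = \<beta> * (1 - exp (- 2 * Re (\<Lambda> t))) * Im (V t) + sqrt (1 - (\<beta> * (1 - exp (- 2 * Re (\<Lambda> t))))\<^sup>2) * Re (V t)"
      unfolding p ReV[OF t, symmetric] using VV[OF t] by (simp add: power2_eq_square)
  qed auto
  from primitive_on_diff[OF this, of a b] ab
  have F1: "(2 * \<beta> * Im (\<Lambda> b) + \<beta> * X b - G (- 2 * Re (\<Lambda> b))) - (2 * \<beta> * Im (\<Lambda> a) + \<beta> * X a - G (- 2 * Re (\<Lambda> a))) = T"
    using has_integral_unique[OF _ has_integral_const_real[of "1::real" a b]] by (fastforce simp: T_def)
  have "l \<in> joining_lengths (\<delta> a) (\<delta> b)" unfolding \<delta>_def by (rule joining_lengths_left_mult[OF h(1) l])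
  then obtain p q \<eta> W where \<eta>: "horizontal_curve p q \<eta> W" "((\<lambda>t. cmod (W t)) has_integral l) {p..q}"
    "\<eta> p = \<delta> a" "\<eta> q = \<delta> b" and pq: "p \<le> q" by (rule joining_lengthsE)
  obtain M Y where c2: "iwasawa_curve p q M Y (\<lambda>t. exp (- 2 * \<i> * Im (M t)) * W t)" (is "iwasawa_curve _ _ _ _ ?S")
    and d2: "\<And>t. t \<in> {p..q} \<Longrightarrow> \<eta> t = iwasawa (M t) (Y t)"
    using horizontal_curve_coords[OF \<eta>(1)] by blast
  have nS: "cmod (?S t) = cmod (W t)" for t by (simp add: norm_mult)
  have intS: "((\<lambda>t. cmod (?S t)) has_integral l) {p..q}" using \<eta>(2) unfolding nS .
  have start: "iwasawa (M p) (Y p) = iwasawa (\<Lambda> a) (X a)" using d1[of a] d2[of p] \<eta> ab pq by simp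
  have stop: "iwasawa (M q) (Y q) = iwasawa (\<Lambda> b) (X b)" using d1[of b] d2[of q] \<eta> ab pq by simp
  have bound2: "\<bar>2 * Re (M t)\<bar> \<le> T" if "t \<in> {p..q}" for t
    using iwasawa_curve_norm_bound[OF c2, of t] abs_Re_le_cmod[of "M t - M p"] that ReL iwasawa_eqD(3)[OF start] lT
    unfolding integral_unique[OF intS] T_def by auto
  have F2: "(2 * \<beta> * Im (M q) + \<beta> * Y q - G (- 2 * Re (M q))) - (2 * \<beta> * Im (M p) + \<beta> * Y p - G (- 2 * Re (M p))) \<le> l"
  proof (rule has_integral_le[OF primitive_on_diff[OF G[OF c2 bound2]] intS])
    fix t assume t: "t \<in> {p..q}"
    show "\<beta> * (1 - exp (- 2 * Re (M t))) * Im (?S t) + sqrt (1 - (\<beta> * (1 - exp (- 2 * Re (M t))))\<^sup>2) * Re (?S t) \<le> cmod (?S t)"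
      by (rule unit_covector_bound) (use small[of "- 2 * Re (M t)"] bound2[OF t] in auto)
  qed (use pq in auto)
  have ImEq: "Im (M q) - Im (M p) = Im (\<Lambda> b) - Im (\<Lambda> a)"
  proof -
    \<comment> \<open>\<open>?D\<close> is an integral multiple of \<open>2 \<pi> \<i>\<close>, and both increments are at most half the respective length\<close>
    let ?D = "(M q - M p) - (\<Lambda> b - \<Lambda> a)"
    have "exp ?D = 1" using iwasawa_eqD(1)[OF start] iwasawa_eqD(1)[OF stop] by (simp add: exp_diff)
    then obtain n :: int where n: "Im ?D = of_int (2 * n) * pi" unfolding exp_eq_1 by blast
    have "cmod (M q - M p) \<le> l / 2" using iwasawa_curve_norm_bound[OF c2, of q] pq integral_unique[OF intS] by simp
    moreover have "cmod (\<Lambda> b - \<Lambda> a) \<le> T / 2" using iwasawa_curve_norm_bound[OF c1, of b] ab intV by simp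
    moreover have "\<bar>Im ?D\<bar> \<le> cmod (M q - M p) + cmod (\<Lambda> b - \<Lambda> a)"
      by (meson abs_Im_le_cmod norm_triangle_ineq4 order_trans)
    ultimately have "\<bar>Im ?D\<bar> < 2 * pi" using lT T(2) by (simp add: T_def)
    then have "\<bar>of_int n * (2 * pi)\<bar> < 1 * (2 * pi)" using n by (simp add: algebra_simps)
    then have "\<bar>of_int n\<bar> < (1::real)" using pi_gt_zero by (simp only: abs_mult mult_less_cancel_right) auto
    then have "n = 0" by linarith
    then show ?thesis using n by simp
  qed
  have "\<beta> * Im (M q) - \<beta> * Im (M p) = \<beta> * Im (\<Lambda> b) - \<beta> * Im (\<Lambda> a)"
    using ImEq by (metis right_diff_distrib)
  with F1 F2 have "T \<le> l"
    unfolding iwasawa_eqD(2)[OF start] iwasawa_eqD(2)[OF stop] iwasawa_eqD(3)[OF start] iwasawa_eqD(3)[OF stop]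
    by (simp add: mult.assoc) 
  with lT show False by (simp add: T_def)
qed


section \<open>Shortest arcs as solutions of an isoperimetric problem\<close>

text \<open>
  These are the normal equations of the orthogonal projection of \<open>f\<close> to the span of \<open>1\<close> and \<open>y\<close>.
  Their determinant is the variance of \<open>y\<close> up to a factor; it vanishes only if \<open>y\<close> is constant, and
  then the mean value of \<open>f\<close> is the projection.
\<close>

lemma L2_projection_affine:
  fixes f y :: "real \<Rightarrow> real"
  assumes ab: "a < b" and f: "f absolutely_integrable_on {a..b}" and y: "continuous_on {a..b} y"
  obtains c0 c1 where "((\<lambda>t. f t - (c0 + c1 * y t)) has_integral 0) {a..b}"
    "((\<lambda>t. y t * (f t - (c0 + c1 * y t))) has_integral 0) {a..b}"
proof -
  define I0 I1 I2 where "I0 = b - a" and "I1 = integral {a..b} y" and "I2 = integral {a..b} (\<lambda>t. y t * y t)"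
  define F0 F1 where "F0 = integral {a..b} f" and "F1 = integral {a..b} (\<lambda>t. y t * f t)"
  have i: "(y has_integral I1) {a..b}" "((\<lambda>t. y t * y t) has_integral I2) {a..b}" "(f has_integral F0) {a..b}"
     "((\<lambda>t. y t * f t) has_integral F1) {a..b}" "((\<lambda>t. 1) has_integral I0) {a..b}"
  proof -
    show "(f has_integral F0) {a..b}" "((\<lambda>t. y t * f t) has_integral F1) {a..b}"
      using f absolutely_integrable_continuous_mult[OF y f] by (auto simp: F0_def F1_def absolutely_integrable_on_def)
    show "(y has_integral I1) {a..b}" "((\<lambda>t. y t * y t) has_integral I2) {a..b}"
      unfolding I1_def I2_def by (intro integrable_integral integrable_continuous_real continuous_intros y)+
    show "((\<lambda>t. 1) has_integral I0) {a..b}"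
      using has_integral_const_real[of "1::real" a b] ab by (simp add: I0_def)
  qed
  have hi: "((\<lambda>t. f t - (c0 + c1 * y t)) has_integral F0 - (c0 * I0 + c1 * I1)) {a..b}" for c0 c1
    using has_integral_diff[OF i(3) has_integral_add[OF has_integral_mult_right[OF i(5), of c0] has_integral_mult_right[OF i(1), of c1]]]
    by simp
  have hy: "((\<lambda>t. y t * (f t - (c0 + c1 * y t))) has_integral F1 - (c0 * I1 + c1 * I2)) {a..b}" for c0 c1
    using has_integral_diff[OF i(4) has_integral_add[OF has_integral_mult_right[OF i(1), of c0] has_integral_mult_right[OF i(2), of c1]]]
    by (simp add: algebra_simps)
  have I0: "I0 > 0" using ab by (simp add: I0_def)
  show thesis
  proof (cases "I0 * I2 - I1 * I1 = 0")
    case False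
    define d where "d = I0 * I2 - I1 * I1"
    have d: "d \<noteq> 0" using False by (simp add: d_def)
    define c0 where "c0 = (F0 * I2 - F1 * I1) / d"
    define c1 where "c1 = (F1 * I0 - F0 * I1) / d"
    have "d * (c0 * I0 + c1 * I1) = d * F0" "d * (c0 * I1 + c1 * I2) = d * F1"
      using d by (simp_all add: c0_def c1_def field_simps) (simp_all add: d_def algebra_simps)
    then have "c0 * I0 + c1 * I1 = F0" "c0 * I1 + c1 * I2 = F1" using d by auto
    then show thesis using that[of c0 c1] hi[of c0 c1] hy[of c0 c1] by simp
  next
    case True
    define m where "m = I1 / I0"
    have "((\<lambda>t. y t * y t + (- 2 * m) * y t + m * m * 1) has_integral I2 + (- 2 * m) * I1 + m * m * I0) {a..b}"
      by (intro has_integral_add has_integral_mult_right i)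
    moreover have "I2 + (- 2 * m) * I1 + m * m * I0 = 0" using True I0 by (simp add: m_def field_simps)
    ultimately have z: "((\<lambda>t. (y t - m)\<^sup>2) has_integral 0) (cbox a b)"
      by (simp add: power2_eq_square algebra_simps)
    have "(y t - m)\<^sup>2 = 0" if "t \<in> {a..b}" for t
      by (rule has_integral_0_cbox_imp_0[OF _ _ z])
        (use ab that in \<open>auto intro!: continuous_intros y\<close>)
    then have ym: "y t = m" if "t \<in> {a..b}" for t using that by auto
    have 0: "((\<lambda>t. f t - (F0 / I0 + 0 * y t)) has_integral 0) {a..b}" using hi[of "F0 / I0" 0] I0 by simp
    have "((\<lambda>t. y t * (f t - (F0 / I0 + 0 * y t))) has_integral 0) {a..b}"
      by (rule has_integral_eq[OF _ has_integral_mult_right[OF 0, of m, simplified]]) (simp add: ym)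
    with 0 show thesis using that by blast
  qed
qed

lemma horizontal_curve_cong:
  assumes "horizontal_curve a b \<gamma> U" "negligible N" "\<And>t. t \<in> {a..b} - N \<Longrightarrow> U' t = U t"
  shows "horizontal_curve a b \<gamma> U'"
  unfolding horizontal_curve_def
proof (intro conjI allI)
  fix i
  have "primitive_on a b (\<lambda>t. cplx_row i (\<gamma> t)) (\<lambda>t. cnj (cplx_row i (\<gamma> t)) * U t / 2)"
    using assms(1) by (simp add: horizontal_curve_def)
  then show "primitive_on a b (\<lambda>t. cplx_row i (\<gamma> t)) (\<lambda>t. cnj (cplx_row i (\<gamma> t)) * U' t / 2)"
    by (rule primitive_on_cong[OF _ assms(2)]) (use assms(3) in auto)
  show "U' absolutely_integrable_on {a..b}"
    by (rule absolutely_integrable_spike[OF _ assms(2,3)]) (use assms(1) in \<open>auto simp: horizontal_curve_def\<close>)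
qed (use assms(1) in \<open>auto simp: horizontal_curve_def\<close>)

text \<open>
  Let \<open>h\<close> be the component of \<open>Im V\<close> orthogonal to \<open>1\<close> and \<open>y\<close>.  Subtracting it from \<open>Im V\<close> keeps
  \<open>Re \<Lambda>\<close>, hence \<open>y\<close>, and does not change the end points, since these see \<open>Im V\<close> only through its
  integrals against \<open>1\<close> and \<open>y\<close>.  The inequality \<open>2 r \<le> 1 + r\<^sup>2\<close> bounds the new length by
  \<open>b - a\<close> minus half the integral of \<open>h\<^sup>2\<close>, so \<open>h\<close> vanishes almost everywhere.  The conclusion is
  \<open>Im V = c\<^sub>0 + c\<^sub>1 y\<close> multiplied by \<open>\<bar>z\<bar>\<^sup>2 = 1 / y\<close>.
\<close>

lemma minimizer_control:
  assumes H: "horizontal_curve a b \<gamma> U" and ab: "a < b" and U1: "\<And>t. cmod (U t) = 1"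
    and min: "\<And>l. l \<in> joining_lengths (\<gamma> a) (\<gamma> b) \<Longrightarrow> b - a \<le> l"
  shows "\<exists>c0 c1 N. negligible N \<and> (\<forall>t\<in>{a..b} - N. Im (cnj (cplx_row 2 (\<gamma> t)) ^ 2 * U t) = c0 * (cmod (cplx_row 2 (\<gamma> t)))\<^sup>2 + c1)"
proof -
  obtain \<Lambda> X where c: "iwasawa_curve a b \<Lambda> X (\<lambda>t. exp (- 2 * \<i> * Im (\<Lambda> t)) * U t)" (is "iwasawa_curve _ _ _ _ ?V")
    and d: "\<And>t. t \<in> {a..b} \<Longrightarrow> \<gamma> t = iwasawa (\<Lambda> t) (X t)"
    using horizontal_curve_coords[OF H] by blast
  define V where "V = ?V"
  have V1: "cmod (V t) = 1" for t using U1 by (simp add: V_def norm_mult)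
  have Vi: "V absolutely_integrable_on {a..b}" and L: "primitive_on a b \<Lambda> (\<lambda>t. V t / 2)"
    and X: "primitive_on a b X (\<lambda>t. - (exp (- 2 * Re (\<Lambda> t)) * Im (V t)))"
    using c by (auto simp: iwasawa_curve_def V_def)
  define y where "y = (\<lambda>t. exp (- 2 * Re (\<Lambda> t)))"
  have cy: "continuous_on {a..b} y" unfolding y_def by (intro continuous_intros primitive_on_continuous[OF L])
  have V2i: "(\<lambda>t. Im (V t)) absolutely_integrable_on {a..b}"
    using absolutely_integrable_linear[OF Vi bounded_linear_Im] by (simp add: o_def)
  obtain c0 c1 where h0: "((\<lambda>t. Im (V t) - (c0 + c1 * y t)) has_integral 0) {a..b}"
    and hy: "((\<lambda>t. y t * (Im (V t) - (c0 + c1 * y t))) has_integral 0) {a..b}"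
    using L2_projection_affine[OF ab V2i cy] .
  define h where "h = (\<lambda>t. Im (V t) - (c0 + c1 * y t))"
  have hi: "h absolutely_integrable_on {a..b}"
    unfolding h_def by (intro set_integral_diff V2i absolutely_integrable_continuous_real continuous_intros cy)
  have yhi: "(\<lambda>t. y t * h t) absolutely_integrable_on {a..b}" by (rule absolutely_integrable_continuous_mult[OF cy hi])
  define Hh where "Hh = (\<lambda>t. 0 + integral {a..t} h)"
  have Hh: "primitive_on a b Hh h" unfolding Hh_def by (rule primitive_on_integral[OF hi])
  define Hy where "Hy = (\<lambda>t. 0 + integral {a..t} (\<lambda>t. y t * h t))"
  have Hy: "primitive_on a b Hy (\<lambda>t. y t * h t)" unfolding Hy_def by (rule primitive_on_integral[OF yhi])
  have H0: "Hh a = 0" "Hh b = 0" "Hy a = 0" "Hy b = 0"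
    using integral_unique[OF h0] integral_unique[OF hy] by (auto simp: Hh_def Hy_def h_def)
  define S where "S = (\<lambda>t. V t - \<i> * of_real (h t))"
  have Si: "S absolutely_integrable_on {a..b}"
  proof -
    have "(\<lambda>t. \<i> * of_real (h t)) absolutely_integrable_on {a..b}"
      using absolutely_integrable_linear[OF hi bounded_linear_const_mult[OF bounded_linear_of_real], of \<i>] by (simp add: o_def)
    then show ?thesis unfolding S_def by (intro set_integral_diff Vi)
  qed
  \<comment> \<open>the competitor: only the angle and \<open>X\<close> are modified, by integrals that vanish at both ends\<close>
  define M where "M = (\<lambda>t. \<Lambda> t - \<i> * of_real (Hh t) / 2)"
  have "primitive_on a b M (\<lambda>t. V t / 2 - \<i> * of_real (h t) / 2)"
    unfolding M_def
    by (intro primitive_on_sub L primitive_on_linear[OF Hh bounded_linear_divide[THEN bounded_linear_compose, OF bounded_linear_const_mult[OF bounded_linear_of_real]]])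
  then have M: "primitive_on a b M (\<lambda>t. S t / 2)"
    by (rule primitive_on_cong[OF _ negligible_empty]) (auto simp: S_def diff_divide_distrib)
  have ReM: "Re (M t) = Re (\<Lambda> t)" for t by (simp add: M_def)
  define Y where "Y = (\<lambda>t. X t + Hy t)"
  have Y: "primitive_on a b Y (\<lambda>t. - (exp (- 2 * Re (M t)) * Im (S t)))"
    unfolding Y_def
    by (rule primitive_on_cong[OF primitive_on_add[OF X Hy] negligible_empty]) (auto simp: ReM S_def y_def algebra_simps)
  have "iwasawa_curve a b M Y S" using ab Si M Y by (simp add: iwasawa_curve_def)
  note comp = horizontal_curve_of_coords[OF this]
  have ends: "iwasawa (M a) (Y a) = \<gamma> a" "iwasawa (M b) (Y b) = \<gamma> b"
    using d[of a] d[of b] ab by (simp_all add: M_def Y_def H0)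
  have nS: "cmod (exp (2 * \<i> * Im (M t)) * S t) = cmod (S t)" for t by (simp add: norm_mult)
  have Sn: "(\<lambda>t. cmod (S t)) integrable_on {a..b}" using Si by (simp add: absolutely_integrable_on_def)
  have "b - a \<le> integral {a..b} (\<lambda>t. cmod (S t))"
    by (rule min, rule joining_lengthsI[OF comp _ ends]) (use Sn in \<open>simp add: nS integrable_integral\<close>)
  have bh: "bounded (h ` {a..b})"
  proof -
    have "bounded (y ` {a..b})" using compact_continuous_image[OF cy] compact_imp_bounded by blast
    then obtain B where B: "\<forall>t\<in>{a..b}. \<bar>y t\<bar> \<le> B" by (auto simp: bounded_iff)
    have "\<bar>h t\<bar> \<le> 1 + (\<bar>c0\<bar> + \<bar>c1\<bar> * B)" if "t \<in> {a..b}" for t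
    proof -
      have "\<bar>Im (V t)\<bar> \<le> 1" using abs_Im_le_cmod[of "V t"] V1 by simp
      moreover have "\<bar>c1 * y t\<bar> \<le> \<bar>c1\<bar> * B" using B that by (simp add: abs_mult mult_left_mono)
      ultimately show ?thesis unfolding h_def by linarith
    qed
    then show ?thesis
      unfolding bounded_iff by (intro exI[of _ "1 + (\<bar>c0\<bar> + \<bar>c1\<bar> * B)"]) auto
  qed
  have hhi: "(\<lambda>t. h t * h t) absolutely_integrable_on {a..b}"
    by (rule absolutely_integrable_bounded_measurable_product_real)
      (use bh hi in \<open>auto intro: absolutely_integrable_imp_borel_measurable\<close>)
  define K where "K = integral {a..b} (\<lambda>t. h t * h t)"
  have hh: "((\<lambda>t. h t * h t) has_integral K) {a..b}" 
    using hhi by (auto simp: K_def absolutely_integrable_on_def)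
  have "((\<lambda>t. 1 - 1/2 * (h t * h t) - (c0 * h t + c1 * (y t * h t))) has_integral (b - a) - 1/2 * K - (c0 * 0 + c1 * 0)) {a..b}"
    using h0 hy has_integral_const_real[of "1::real" a b] ab
    by (intro has_integral_diff has_integral_add has_integral_mult_right hh) (simp_all add: h_def)
  then have up: "((\<lambda>t. 1 - 1/2 * (h t * h t) - (c0 * h t + c1 * (y t * h t))) has_integral (b - a) - K / 2) {a..b}" by simp
  have "integral {a..b} (\<lambda>t. cmod (S t)) \<le> (b - a) - K / 2"
  proof (rule has_integral_le[OF integrable_integral[OF Sn] up])
    fix t
    have v: "(Re (V t))\<^sup>2 + (Im (V t))\<^sup>2 = 1" using V1[of t] by (simp add: cmod_def)
    have S2: "(cmod (S t))\<^sup>2 = (Re (V t))\<^sup>2 + (Im (V t) - h t)\<^sup>2" by (simp add: S_def cmod_power2)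
    have "2 * cmod (S t) \<le> 1 + (cmod (S t))\<^sup>2" using zero_le_power2[of "cmod (S t) - 1"] by (simp add: power2_eq_square algebra_simps)
    also have "\<dots> = 2 - 2 * Im (V t) * h t + h t * h t" unfolding S2 using v by (simp add: power2_eq_square algebra_simps)
    also have "Im (V t) = h t + (c0 + c1 * y t)" by (simp add: h_def)
    finally show "cmod (S t) \<le> 1 - 1/2 * (h t * h t) - (c0 * h t + c1 * (y t * h t))" by (simp add: algebra_simps)
  qed
  with \<open>b - a \<le> integral {a..b} (\<lambda>t. cmod (S t))\<close> have K: "K \<le> 0" by simp
  have "primitive_on a b (\<lambda>t. 0) (\<lambda>t. h t * h t)"
    unfolding primitive_on_def
  proof (intro conjI ballI hhi)
    fix t assume t: "t \<in> {a..b}"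
    have hit: "(\<lambda>t. h t * h t) integrable_on {a..t}"
      by (rule integrable_subinterval_real[of _ a b]) (use hh t in auto)
    have "integral {a..t} (\<lambda>t. h t * h t) \<le> K"
      unfolding K_def by (rule integral_subset_le) (use hit hh t in auto)
    moreover have "integral {a..t} (\<lambda>t. h t * h t) \<ge> 0" by (rule integral_nonneg[OF hit]) simp
    ultimately have "integral {a..t} (\<lambda>t. h t * h t) = 0" using K by linarith
    then show "((\<lambda>t. h t * h t) has_integral 0 - 0) {a..t}" using integrable_integral[OF hit] by simp
  qed
  from primitive_on_zero_ae[OF this] obtain N where N: "negligible N" "\<And>t. t \<in> {a..b} - N \<Longrightarrow> h t = 0" by auto
  have "Im (cnj (cplx_row 2 (\<gamma> t)) ^ 2 * U t) = c0 * (cmod (cplx_row 2 (\<gamma> t)))\<^sup>2 + c1" if t: "t \<in> {a..b} - N" for t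
  proof -
    have row: "cplx_row 2 (\<gamma> t) = exp (\<Lambda> t)" using d[of t] t by (simp add: cplx_row_iwasawa)
    have n: "(cmod (exp (\<Lambda> t)))\<^sup>2 * y t = 1" using norm_exp_power2[of "\<Lambda> t"] by (simp add: y_def)
    have "cnj (exp (\<Lambda> t)) ^ 2 * U t = of_real ((cmod (exp (\<Lambda> t)))\<^sup>2) * V t"
      by (simp only: V_def cnj_exp_power2 mult.assoc)
    moreover have imr: "Im (of_real r * v) = r * Im v" for r v by simp
    ultimately have "Im (cnj (exp (\<Lambda> t)) ^ 2 * U t) = (cmod (exp (\<Lambda> t)))\<^sup>2 * Im (V t)" by (simp only: imr)
    also have "Im (V t) = c0 + c1 * y t" using N(2)[OF t] by (simp add: h_def)
    also have "(cmod (exp (\<Lambda> t)))\<^sup>2 * (c0 + c1 * y t) = c0 * (cmod (exp (\<Lambda> t)))\<^sup>2 + c1 * ((cmod (exp (\<Lambda> t)))\<^sup>2 * y t)"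
      by (simp only: distrib_left distrib_right ac_simps)
    finally show ?thesis unfolding n row by simp
  qed
  with N(1) show ?thesis by blast
qed


section \<open>The control of a shortest arc rotates uniformly\<close>

text \<open>
  The quadratic forms \<open>Im (cnj v\<^sup>2 * u)\<close> at \<open>v = z, w, w + z\<close> determine the bilinear form
  \<open>Im (cnj v * cnj v' * u)\<close> on the plane, and hence \<open>u\<close>; the formula holds with the factor
  \<open>(Im (cnj w * z))\<^sup>2\<close> on the left for arbitrary \<open>w\<close> and \<open>z\<close>.
\<close>

lemma control_from_moments:
  fixes w z u :: complex
  assumes "Im (cnj w * z) = 1"
  shows "u = (of_real (Im (cnj w ^ 2 * u)) * z\<^sup>2
     - of_real (Im (cnj (w + z) ^ 2 * u) - Im (cnj z ^ 2 * u) - Im (cnj w ^ 2 * u)) * w * z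
     + of_real (Im (cnj z ^ 2 * u)) * w\<^sup>2) * (- \<i> / 2)"
proof -
  have "of_real ((Im (cnj w * z))\<^sup>2) * u = (of_real (Im (cnj w ^ 2 * u)) * z\<^sup>2
     - of_real (Im (cnj (w + z) ^ 2 * u) - Im (cnj z ^ 2 * u) - Im (cnj w ^ 2 * u)) * w * z
     + of_real (Im (cnj z ^ 2 * u)) * w\<^sup>2) * (- \<i> / 2)"
    by (simp add: complex_eq_iff power2_eq_square field_simps)
  then show ?thesis unfolding assms by simp
qed

lemma continuous_ae_eq_imp_eq:
  fixes f g :: "real \<Rightarrow> 'a::euclidean_space"
  assumes ab: "a < b" and f: "continuous_on {a..b} f" and g: "continuous_on {a..b} g" and N: "negligible N"
    and eq: "\<And>t. t \<in> {a..b} - N \<Longrightarrow> f t = g t" and t: "t \<in> {a..b}"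
  shows "f t = g t"
proof -
  have "primitive_on a b (\<lambda>_. 0) (\<lambda>t. f t - g t)"
    by (rule primitive_on_cong[OF primitive_on_const N]) (auto simp: eq)
  then have "((\<lambda>_. 0) has_vector_derivative f t - g t) (at t within {a..b})"
    by (rule primitive_on_deriv) (intro continuous_intros f g t)+
  moreover have "((\<lambda>_. 0::'a) has_vector_derivative 0) (at t within {a..b})" by simp
  ultimately have "f t - g t = 0"
    using vector_derivative_unique_within_closed_interval[OF ab] t by (metis box_real(2))
  then show ?thesis by simp
qed

text \<open>
  With \<open>p = cnj z\<^sup>2 * U\<close>, the equation \<open>Im p = k\<^sub>0 \<bar>z\<bar>\<^sup>2 + k\<^sub>1\<close> is differentiated using
  \<open>p' = \<bar>z\<bar>\<^sup>2 + \<i> \<eta> p\<close> and \<open>(\<bar>z\<bar>\<^sup>2)' = Re p\<close>.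
\<close>

lemma frame_rate:
  fixes z U :: "real \<Rightarrow> complex"
  assumes I: "open I" "t \<in> I"
    and z: "(z has_vector_derivative cnj (z t) * U t / 2) (at t)"
    and U: "(U has_vector_derivative \<i> * of_real \<eta> * U t) (at t)" and U1: "cmod (U t) = 1"
    and eq: "\<And>x. x \<in> I \<Longrightarrow> Im (cnj (z x) ^ 2 * U x) = k0 * (cmod (z x))\<^sup>2 + k1"
  shows "(\<eta> - k0) * Re (cnj (z t) ^ 2 * U t) = 0"
proof -
  let ?Z = "cnj (z t)"
  have cz: "((\<lambda>t. cnj (z t)) has_vector_derivative cnj (?Z * U t / 2)) (at t)"
    by (rule has_vector_derivative_cnj[OF z])
  note P = has_vector_derivative_mult[OF has_vector_derivative_mult[OF cz cz] U]
  note Q = has_vector_derivative_mult[OF z cz]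
  have "((\<lambda>t. Im (cnj (z t) * cnj (z t) * U t) - k0 * Re (z t * cnj (z t))) has_vector_derivative
      (\<eta> - k0) * Re (?Z ^ 2 * U t)) (at t)"
  proof (rule has_vector_derivative_eq_rhs[OF has_vector_derivative_diff[OF 
      bounded_linear.has_vector_derivative[OF bounded_linear_Im P]
      bounded_linear.has_vector_derivative[OF bounded_linear_const_mult[OF bounded_linear_Re] Q]]])
    have "(Re (U t))\<^sup>2 + (Im (U t))\<^sup>2 = 1" using U1 by (simp add: cmod_def)
    then have 1: "Re (U t) * Re (U t) = 1 - Im (U t) * Im (U t)" by (simp add: power2_eq_square)
    have "(?Z * cnj (?Z * U t / 2) + cnj (?Z * U t / 2) * ?Z) * U t = z t * ?Z * (cnj (U t) * U t)"
      by simp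
    also have "cnj (U t) * U t = 1" using 1 by (simp add: complex_eq_iff)
    finally have e1: "(?Z * cnj (?Z * U t / 2) + cnj (?Z * U t / 2) * ?Z) * U t = z t * ?Z" by simp
    have e2: "Im (z t * ?Z) = 0" by simp
    have e3: "Re (z t * cnj (?Z * U t / 2) + ?Z * U t / 2 * ?Z) = Re (?Z ^ 2 * U t)"
      by (simp add: field_simps power2_eq_square)
    have e4: "Im (?Z * ?Z * (\<i> * of_real \<eta> * U t)) = \<eta> * Re (?Z ^ 2 * U t)"
      by (simp add: algebra_simps power2_eq_square)
    show "Im (?Z * ?Z * (\<i> * of_real \<eta> * U t) + (?Z * cnj (?Z * U t / 2) + cnj (?Z * U t / 2) * ?Z) * U t) -
        k0 * Re (z t * cnj (?Z * U t / 2) + ?Z * U t / 2 * ?Z) = (\<eta> - k0) * Re (?Z ^ 2 * U t)"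
      unfolding e3 unfolding e1 plus_complex.sel e2 e4 by (simp add: algebra_simps)
  qed
  moreover have "((\<lambda>t. Im (cnj (z t) * cnj (z t) * U t) - k0 * Re (z t * cnj (z t))) has_vector_derivative 0) (at t)"
  proof (rule has_vector_derivative_transform_within_open[OF has_vector_derivative_const I])
    show "k1 = Im (cnj (z x) * cnj (z x) * U x) - k0 * Re (z x * cnj (z x))" if "x \<in> I" for x
      using eq[OF that] by (simp add: power2_eq_square cmod_power2[unfolded power2_eq_square])
  qed
  ultimately show ?thesis by (rule vector_derivative_unique_at)
qed

lemma unit_control_derivative:
  fixes U :: "real \<Rightarrow> complex" and D :: complex
  assumes I: "open I" "t \<in> I" and U: "(U has_vector_derivative D) (at t)" and U1: "\<And>x. x \<in> I \<Longrightarrow> cmod (U x) = 1"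
  shows "D = \<i> * of_real (Im (cnj (U t) * D)) * U t"
proof -
  have UU: "cnj (U x) * U x = 1" if "x \<in> I" for x
    using U1[OF that] by (simp add: complex_norm_square[symmetric] mult.commute[of "cnj _"])
  have "((\<lambda>x. cnj (U x) * U x) has_vector_derivative cnj (U t) * D + cnj D * U t) (at t)"
    by (rule has_vector_derivative_mult[OF has_vector_derivative_cnj[OF U] U])
  moreover have "((\<lambda>x. cnj (U x) * U x) has_vector_derivative 0) (at t)"
    by (rule has_vector_derivative_transform_within_open[OF has_vector_derivative_const I]) (simp add: UU)
  ultimately have "cnj (U t) * D + cnj D * U t = 0" by (rule vector_derivative_unique_at)
  then have "Re (cnj (U t) * D) = 0" by (simp add: complex_eq_iff algebra_simps)
  then have "cnj (U t) * D = \<i> * of_real (Im (cnj (U t) * D))" by (simp add: complex_eq_iff)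
  then have "cnj (U t) * U t * D = \<i> * of_real (Im (cnj (U t) * D)) * U t" by (metis mult.assoc mult.commute)
  then show ?thesis using UU[OF I(2)] by simp
qed

text \<open>
  Left translations preserve both the control and minimality, so the previous description of the
  control holds for every row vector that is the lower row of a matrix \<open>h ** \<gamma> t\<close>.
\<close>

lemma minimizer_frame:
  assumes H: "horizontal_curve a b \<gamma> U" and ab: "a < b" and U1: "\<And>t. cmod (U t) = 1"
    and min: "\<And>l. l \<in> joining_lengths (\<gamma> a) (\<gamma> b) \<Longrightarrow> b - a \<le> l" and h: "h \<in> SL2"
  shows "\<exists>c0 c1 N. negligible N \<and> (\<forall>t\<in>{a..b} - N. 
     Im (cnj (cplx_row 2 (h ** \<gamma> t)) ^ 2 * U t) = c0 * (cmod (cplx_row 2 (h ** \<gamma> t)))\<^sup>2 + c1)"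
proof (rule minimizer_control[OF horizontal_curve_left_mult[OF h H] ab U1])
  fix l assume l: "l \<in> joining_lengths (h ** \<gamma> a) (h ** \<gamma> b)"
  from joining_lengths_left_mult[OF SL2_matrix_inv(3)[OF h] l] show "b - a \<le> l"
    unfolding SL2_matrix_inv_cancel[OF h] by (rule min)
qed

text \<open>
  Three frames give three equations of the form \<open>Im (cnj v\<^sup>2 * U) = k\<^sub>0 \<bar>v\<bar>\<^sup>2 + k\<^sub>1\<close>.  They
  express \<open>U\<close> as a polynomial in the rows and their conjugates, which gains regularity: continuity
  of the rows makes \<open>U\<close> continuous, hence the rows are \<open>C\<^sup>1\<close>, hence \<open>U\<close> is \<open>C\<^sup>1\<close>.  Its angular
  velocity equals \<open>k\<^sub>0\<close> for each frame with \<open>Re (cnj v\<^sup>2 * U) \<noteq> 0\<close>, and the three real parts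
  cannot vanish together.  So the angular velocity is a continuous function with at most three values.
\<close>

lemma minimizer_rotating_control:
  assumes H: "horizontal_curve a b \<gamma> U" and ab: "a < b" and U1: "\<And>t. cmod (U t) = 1"
    and min: "\<And>l. l \<in> joining_lengths (\<gamma> a) (\<gamma> b) \<Longrightarrow> b - a \<le> l"
  shows "\<exists>c \<beta>. cmod c = 1 \<and> (\<forall>t\<in>{a<..<b}. \<forall>i.
     ((\<lambda>t. cplx_row i (\<gamma> t)) has_vector_derivative cnj (cplx_row i (\<gamma> t)) * (c * exp (\<i> * of_real (\<beta> * t))) / 2) (at t))"
proof -
  define w z where "w = (\<lambda>t. cplx_row 1 (\<gamma> t))" and "z = (\<lambda>t. cplx_row 2 (\<gamma> t))"
  let ?I = "{a<..<b}"
  have frame: "\<exists>c0 c1 N. negligible N \<and> (\<forall>t\<in>{a..b} - N. 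
     Im (cnj (of_real p * w t + of_real q * z t) ^ 2 * U t) = c0 * (cmod (of_real p * w t + of_real q * z t))\<^sup>2 + c1)"
    if "Im (cnj e * Complex p q) = 1" for e p q
  proof -
    have "of_rows e (Complex p q) \<in> SL2" using that by (simp add: SL2_iff_rows)
    from minimizer_frame[OF H ab U1 min this] show ?thesis
      by (simp add: cplx_row_mult of_rows_def w_def z_def)
  qed
  obtain c0 c1 N0 where N0: "negligible N0" and f0: "\<And>t. t \<in> {a..b} - N0 \<Longrightarrow> Im (cnj (z t) ^ 2 * U t) = c0 * (cmod (z t))\<^sup>2 + c1"
    using frame[of 1 0 1] by auto
  \<comment> \<open>the vectors \<open>1\<close>, \<open>- \<i>\<close>, \<open>1\<close> are upper rows completing \<open>(0, 1)\<close>, \<open>(1, 0)\<close>, \<open>(1, 1)\<close> to matrices in SL(2)\<close>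
  obtain d0 d1 N1 where N1: "negligible N1" and f1: "\<And>t. t \<in> {a..b} - N1 \<Longrightarrow> Im (cnj (w t) ^ 2 * U t) = d0 * (cmod (w t))\<^sup>2 + d1"
    using frame[of "- \<i>" 1 0] by auto
  obtain e0 e1 N2 where N2: "negligible N2" and f2: "\<And>t. t \<in> {a..b} - N2 \<Longrightarrow> Im (cnj (w t + z t) ^ 2 * U t) = e0 * (cmod (w t + z t))\<^sup>2 + e1"
    using frame[of 1 1 1] by auto
  define N where "N = N0 \<union> N1 \<union> N2"
  have N: "negligible N" using N0 N1 N2 by (simp add: N_def)
  define R S Q where "R = (\<lambda>t. of_real c0 * (z t * cnj (z t)) + of_real c1 :: complex)"
    and "S = (\<lambda>t. of_real d0 * (w t * cnj (w t)) + of_real d1 :: complex)"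
    and "Q = (\<lambda>t. of_real e0 * ((w t + z t) * (cnj (w t) + cnj (z t))) + of_real e1 :: complex)"
  define u where "u = (\<lambda>t. (S t * (z t * z t) - (Q t - R t - S t) * w t * z t + R t * (w t * w t)) * (- \<i> / 2))"
  have SL: "Im (cnj (w t) * z t) = 1" if "t \<in> {a..b}" for t
    using H that by (auto simp: horizontal_curve_def SL2_iff_rows w_def z_def)
  have uU: "u t = U t" if t: "t \<in> {a..b} - N" for t
  proof -
    have "t \<in> {a..b} - N0" "t \<in> {a..b} - N1" "t \<in> {a..b} - N2" using t by (auto simp: N_def)
    note f = f0[OF this(1)] f1[OF this(2)] f2[OF this(3)]
    have "R t = of_real (Im (cnj (z t) ^ 2 * U t))" "S t = of_real (Im (cnj (w t) ^ 2 * U t))"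
      "Q t = of_real (Im (cnj (w t + z t) ^ 2 * U t))"
      unfolding f
      by (simp_all only: R_def S_def Q_def of_real_add of_real_mult complex_norm_square complex_cnj_add)
    then show ?thesis
      using control_from_moments[OF SL, of t "U t"] t by (simp add: u_def power2_eq_square)
  qed
  have Hu: "horizontal_curve a b \<gamma> u" by (rule horizontal_curve_cong[OF H N uU])
  have prim: "primitive_on a b w (\<lambda>t. cnj (w t) * u t / 2)" "primitive_on a b z (\<lambda>t. cnj (z t) * u t / 2)"
    using Hu by (auto simp: horizontal_curve_def w_def z_def)
  note cwz = prim[THEN primitive_on_continuous]
  have cu: "continuous_on {a..b} u"
    unfolding u_def R_def S_def Q_def by (intro continuous_intros cwz)
  have sub: "?I \<subseteq> {a..b}" by auto
  have dw: "(w has_vector_derivative cnj (w t) * u t / 2) (at t)" if t: "t \<in> ?I" for t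
  proof -
    have "(w has_vector_derivative cnj (w t) * u t / 2) (at t within {a..b})"
      by (rule primitive_on_deriv[OF prim(1)]) (use t in \<open>auto intro!: continuous_intros cwz cu\<close>)
    then show ?thesis using t by (simp add: at_within_Icc_at)
  qed
  have dz: "(z has_vector_derivative cnj (z t) * u t / 2) (at t)" if t: "t \<in> ?I" for t
  proof -
    have "(z has_vector_derivative cnj (z t) * u t / 2) (at t within {a..b})"
      by (rule primitive_on_deriv[OF prim(2)]) (use t in \<open>auto intro!: continuous_intros cwz cu\<close>)
    then show ?thesis using t by (simp add: at_within_Icc_at)
  qed
  have C1: "f C1_differentiable_on ?I"
    if "\<And>t. t \<in> ?I \<Longrightarrow> (f has_vector_derivative E t) (at t)" "continuous_on {a..b} E" for f E :: "real \<Rightarrow> complex"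
    unfolding C1_differentiable_on_def using that continuous_on_subset[OF _ sub] by blast
  have C1w: "w C1_differentiable_on ?I" by (rule C1[OF dw]) (auto intro!: continuous_intros cwz cu simp del: complex_cnj_mult complex_cnj_divide)
  have C1cw: "(\<lambda>t. cnj (w t)) C1_differentiable_on ?I"
    by (rule C1[OF has_vector_derivative_cnj[OF dw]]) (auto intro!: continuous_intros cwz cu simp del: complex_cnj_mult complex_cnj_divide)
  have C1z: "z C1_differentiable_on ?I" by (rule C1[OF dz]) (auto intro!: continuous_intros cwz cu simp del: complex_cnj_mult complex_cnj_divide)
  have C1cz: "(\<lambda>t. cnj (z t)) C1_differentiable_on ?I"
    by (rule C1[OF has_vector_derivative_cnj[OF dz]]) (auto intro!: continuous_intros cwz cu simp del: complex_cnj_mult complex_cnj_divide)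
  have "u C1_differentiable_on ?I"
    unfolding u_def R_def S_def Q_def
    by (intro C1_differentiable_on_mult C1_differentiable_on_add C1_differentiable_on_diff C1_differentiable_on_const C1w C1cw C1z C1cz)
  then obtain D where D: "\<And>t. t \<in> ?I \<Longrightarrow> (u has_vector_derivative D t) (at t)" and cD: "continuous_on ?I D"
    unfolding C1_differentiable_on_def by blast
  have u1: "cmod (u t) = 1" if "t \<in> {a..b}" for t
    by (rule continuous_ae_eq_imp_eq[OF ab _ _ N _ that]) (use uU U1 in \<open>auto intro!: continuous_intros cu\<close>)
  have g0: "Im (cnj (z t) ^ 2 * u t) = c0 * (cmod (z t))\<^sup>2 + c1" if "t \<in> {a..b}" for t
    by (rule continuous_ae_eq_imp_eq[OF ab _ _ N _ that]) (use uU f0 in \<open>auto simp: N_def intro!: continuous_intros cu cwz\<close>)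
  have g1: "Im (cnj (w t) ^ 2 * u t) = d0 * (cmod (w t))\<^sup>2 + d1" if "t \<in> {a..b}" for t
    by (rule continuous_ae_eq_imp_eq[OF ab _ _ N _ that]) (use uU f1 in \<open>auto simp: N_def intro!: continuous_intros cu cwz\<close>)
  have g2: "Im (cnj (w t + z t) ^ 2 * u t) = e0 * (cmod (w t + z t))\<^sup>2 + e1" if "t \<in> {a..b}" for t
    by (rule continuous_ae_eq_imp_eq[OF ab _ _ N _ that]) (use uU f2 in \<open>auto simp: N_def intro!: continuous_intros cu cwz\<close>)
  define \<eta> where "\<eta> = (\<lambda>t. Im (cnj (u t) * D t))"
  have du: "(u has_vector_derivative \<i> * of_real (\<eta> t) * u t) (at t)" if t: "t \<in> ?I" for t
    using D[OF t] unit_control_derivative[OF _ t D[OF t], of] u1 sub unfolding \<eta>_def by fastforce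
  have c\<eta>: "continuous_on ?I \<eta>"
    unfolding \<eta>_def by (intro continuous_intros cD continuous_on_subset[OF cu sub])
  have "\<eta> t \<in> {c0, d0, e0}" if t: "t \<in> ?I" for t
  proof (rule ccontr)
    assume no: "\<eta> t \<notin> {c0, d0, e0}"
    have t': "t \<in> {a..b}" using t by auto
    have dwz: "((\<lambda>t. w t + z t) has_vector_derivative cnj (w t + z t) * u t / 2) (at t)"
      by (rule has_vector_derivative_eq_rhs[OF has_vector_derivative_add[OF dw[OF t] dz[OF t]]]) (simp add: field_simps)
    have "Re (cnj (z t) ^ 2 * u t) = 0"
      using frame_rate[OF open_greaterThanLessThan t dz[OF t] du[OF t] u1[OF t'], of c0 c1] g0 sub no by auto
    moreover have "Re (cnj (w t) ^ 2 * u t) = 0"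
      using frame_rate[OF open_greaterThanLessThan t dw[OF t] du[OF t] u1[OF t'], of d0 d1] g1 sub no by auto
    moreover have "Re (cnj (w t + z t) ^ 2 * u t) = 0"
      using frame_rate[OF open_greaterThanLessThan t dwz du[OF t] u1[OF t'], of e0 e1] g2 sub no by auto
    \<comment> \<open>the real parts are the moments of \<open>\<i> * u t\<close>, which therefore would be zero\<close>
    moreover have imi: "Im (v * (\<i> * u t)) = Re (v * u t)" for v by simp
    ultimately have "\<i> * u t = 0"
      using control_from_moments[OF SL[OF t'], of "\<i> * u t"] unfolding imi by simp
    then show False using u1[OF t'] by simp
  qed
  then have "\<eta> ` ?I \<subseteq> {c0, d0, e0}" by (rule image_subsetI)
  then have "finite (\<eta> ` ?I)" by (rule finite_subset) simp
  from continuous_finite_range_constant[OF _ c\<eta> this] obtain \<beta> where \<beta>: "\<And>t. t \<in> ?I \<Longrightarrow> \<eta> t = \<beta>"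
    unfolding constant_on_def by auto
  have "\<exists>c. \<forall>t\<in>?I. u t * exp (- \<i> * of_real (\<beta> * t)) = c"
  proof (rule has_vector_derivative_zero_constant)
    fix t assume t: "t \<in> ?I"
    have "((\<lambda>z. exp (- \<i> * (of_real \<beta> * z))) has_field_derivative - \<i> * of_real \<beta> * exp (- \<i> * (of_real \<beta> * of_real t))) (at (of_real t))"
      by (auto intro!: derivative_eq_intros)
    from has_vector_derivative_real_field[OF this]
    have e: "((\<lambda>t. exp (- \<i> * of_real (\<beta> * t))) has_vector_derivative - \<i> * of_real \<beta> * exp (- \<i> * of_real (\<beta> * t))) (at t)"
      by simp
    have "((\<lambda>t. u t * exp (- \<i> * of_real (\<beta> * t))) has_vector_derivative 0) (at t)"
      by (rule has_vector_derivative_eq_rhs[OF has_vector_derivative_mult[OF du[OF t] e]]) (simp add: \<beta>[OF t])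
    then show "((\<lambda>t. u t * exp (- \<i> * of_real (\<beta> * t))) has_vector_derivative 0) (at t within ?I)"
      by (rule has_vector_derivative_at_within)
  qed auto
  then obtain c where c: "\<And>t. t \<in> ?I \<Longrightarrow> u t * exp (- \<i> * of_real (\<beta> * t)) = c" by blast
  have uc: "u t = c * exp (\<i> * of_real (\<beta> * t))" if t: "t \<in> ?I" for t
    using c[OF t] by (auto simp: exp_minus field_simps)
  have "cmod c = 1"
  proof -
    have m: "(a + b) / 2 \<in> ?I" using ab by auto
    then have "cmod (u ((a + b) / 2)) = 1" using u1 sub by blast
    then show ?thesis unfolding uc[OF m] by (simp add: norm_mult)
  qed
  moreover have "((\<lambda>t. cplx_row i (\<gamma> t)) has_vector_derivative cnj (cplx_row i (\<gamma> t)) * (c * exp (\<i> * of_real (\<beta> * t))) / 2) (at t)"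
    if t: "t \<in> ?I" for t i
    using dw[OF t] dz[OF t] exhaust_2[of i] unfolding uc[OF t] w_def z_def by auto
  ultimately show ?thesis by blast
qed

lemma horizontal_curve_subinterval:
  assumes "horizontal_curve a b \<gamma> U" "a \<le> c" "c \<le> d" "d \<le> b"
  shows "horizontal_curve c d \<gamma> U"
  unfolding horizontal_curve_def
proof (intro conjI allI)
  show "U absolutely_integrable_on {c..d}"
    by (rule absolutely_integrable_on_subinterval[where S="{a..b}"]) (use assms in \<open>auto simp: horizontal_curve_def\<close>)
qed (use assms in \<open>auto simp: horizontal_curve_def intro: primitive_on_subinterval[where a=a and b=b]\<close>)

lemma horizontal_curve_control_unique:
  assumes U: "horizontal_curve a b \<gamma> U" and W: "horizontal_curve a b \<gamma> W"
  shows "\<exists>N. negligible N \<and> (\<forall>t\<in>{a..b} - N. U t = W t)"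
proof -
  have "primitive_on a b (\<lambda>t. cplx_row 1 (\<gamma> t)) (\<lambda>t. cnj (cplx_row 1 (\<gamma> t)) * U t / 2)"
    "primitive_on a b (\<lambda>t. cplx_row 1 (\<gamma> t)) (\<lambda>t. cnj (cplx_row 1 (\<gamma> t)) * W t / 2)"
    using U W by (simp_all add: horizontal_curve_def)
  from primitive_on_unique_ae[OF this] obtain N where N: "negligible N"
    "\<forall>t\<in>{a..b} - N. cnj (cplx_row 1 (\<gamma> t)) * U t / 2 = cnj (cplx_row 1 (\<gamma> t)) * W t / 2"
    by blast
  have "U t = W t" if t: "t \<in> {a..b} - N" for t
  proof -
    have "cplx_row 1 (\<gamma> t) \<noteq> 0"
      using U t by (intro cplx_row_nonzero) (auto simp: horizontal_curve_def)
    then show ?thesis using bspec[OF N(2) t] by simp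
  qed
  with N(1) show ?thesis by blast
qed

lemma has_sr_length_unique:
  assumes "has_sr_length \<gamma> a b l" "has_sr_length \<gamma> a b l'" shows "l = l'"
proof -
  obtain U W where U: "horizontal_curve a b \<gamma> U" "l = integral {a..b} (\<lambda>t. cmod (U t))"
    and W: "horizontal_curve a b \<gamma> W" "l' = integral {a..b} (\<lambda>t. cmod (W t))"
    using assms unfolding has_sr_length_iff by blast
  obtain N where "negligible N" "\<And>t. t \<in> {a..b} - N \<Longrightarrow> U t = W t"
    using horizontal_curve_control_unique[OF U(1) W(1)] by blast
  then show ?thesis unfolding U(2) W(2) by (intro integral_spike) auto
qed

text \<open>
  The length of every initial piece \<open>[a, s]\<close> is \<open>s - a\<close>, so the integral of \<open>cmod U - 1\<close> over all
  these intervals vanishes.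
\<close>

lemma has_sr_length_unit_speed:
  assumes arc: "arclength_parametrized \<gamma>" and ab: "a < b"
  shows "\<exists>U. horizontal_curve a b \<gamma> U \<and> (\<forall>t. cmod (U t) = 1)"
proof -
  obtain U where U: "horizontal_curve a b \<gamma> U"
    using arc ab unfolding arclength_parametrized_def has_sr_length_iff by (meson less_imp_le)
  have Ui: "U absolutely_integrable_on {a..b}" using U by (simp add: horizontal_curve_def)
  have "primitive_on a b (\<lambda>t. t) (\<lambda>t. cmod (U t))"
    unfolding primitive_on_def
  proof (intro conjI ballI)
    show "(\<lambda>t. cmod (U t)) absolutely_integrable_on {a..b}" using Ui by (rule absolutely_integrable_norm[unfolded o_def])
    fix s assume s: "s \<in> {a..b}"
    then have "has_sr_length \<gamma> a s (s - a)" using arc by (auto simp: arclength_parametrized_def)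
    then obtain W where W: "horizontal_curve a s \<gamma> W" "s - a = integral {a..s} (\<lambda>t. cmod (W t))"
      unfolding has_sr_length_iff by blast
    obtain N where N: "negligible N" "\<And>t. t \<in> {a..s} - N \<Longrightarrow> W t = U t"
      using horizontal_curve_control_unique[OF W(1), of U] horizontal_curve_subinterval[OF U, of a s] s by auto
    show "((\<lambda>t. cmod (U t)) has_integral s - a) {a..s}"
      unfolding W(2) by (rule has_integral_spike[OF N(1) _ integrable_integral[OF horizontal_curve_norm_int[OF W(1)]]])
        (simp add: N(2))
  qed
  moreover have "primitive_on a b (\<lambda>t. t) (\<lambda>t. 1)"
    by (rule primitive_on_C1) (auto intro!: derivative_eq_intros)
  ultimately have "\<exists>N. negligible N \<and> (\<forall>t\<in>{a..b} - N. cmod (U t) = 1)"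
    by (rule primitive_on_unique_ae)
  then obtain N where N: "negligible N" "\<And>t. t \<in> {a..b} - N \<Longrightarrow> cmod (U t) = 1" by blast
  have "horizontal_curve a b \<gamma> (\<lambda>t. if t \<in> {a..b} - N then U t else 1)"
    by (rule horizontal_curve_cong[OF U N(1)]) auto
  then show ?thesis using N(2) by (intro exI[of _ "\<lambda>t. if t \<in> {a..b} - N then U t else 1"]) auto
qed

lemma geodesic_locally_rotating:
  assumes geo: "geodesic \<gamma>" and arc: "arclength_parametrized \<gamma>"
  shows "\<exists>\<epsilon>>0. \<exists>c \<beta>. cmod c = 1 \<and> (\<forall>t\<in>{s - \<epsilon><..<s + \<epsilon>}. \<forall>i.
     ((\<lambda>t. cplx_row i (\<gamma> t)) has_vector_derivative cnj (cplx_row i (\<gamma> t)) * (c * exp (\<i> * of_real (\<beta> * t))) / 2) (at t))"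
proof -
  obtain \<epsilon> where e: "\<epsilon> > 0" and short: "shortest_arc \<gamma> (s - \<epsilon>) (s + \<epsilon>)" using geo unfolding geodesic_def by blast
  let ?a = "s - \<epsilon>" and ?b = "s + \<epsilon>"
  have ab: "?a < ?b" using e by simp
  obtain U where U: "horizontal_curve ?a ?b \<gamma> U" "\<And>t. cmod (U t) = 1"
    using has_sr_length_unit_speed[OF arc ab] by blast
  have "has_sr_length \<gamma> ?a ?b (?b - ?a)" using arc ab unfolding arclength_parametrized_def by (meson less_imp_le)
  then have d: "sr_dist (\<gamma> ?a) (\<gamma> ?b) = ?b - ?a"
    using short has_sr_length_unique unfolding shortest_arc_def by blast
  have SL: "\<gamma> ?a \<in> SL2" "\<gamma> ?b \<in> SL2" using U(1) e by (auto simp: horizontal_curve_def)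
  have min: "?b - ?a \<le> l" if "l \<in> joining_lengths (\<gamma> ?a) (\<gamma> ?b)" for l
    using cInf_lower[OF that joining_lengths_bdd_below] d SL by (simp add: sr_dist_def)
  from minimizer_rotating_control[OF U(1) ab U(2) min] e show ?thesis by blast
qed


section \<open>Matrix exponentials and the geodesics\<close>

text \<open>
  Entrywise differentiation suffices here and avoids bounded bilinear maps for the matrix product.
\<close>

definition matrix_deriv :: "(real \<Rightarrow> real ^ 'n ^ 'm) \<Rightarrow> real ^ 'n ^ 'm \<Rightarrow> real \<Rightarrow> bool" where
  "matrix_deriv F F' t \<longleftrightarrow> (\<forall>i j. ((\<lambda>s. F s $ i $ j) has_real_derivative F' $ i $ j) (at t))"

lemma matrix_deriv_mult:
  assumes "matrix_deriv F F' t" "matrix_deriv G G' t"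
  shows "matrix_deriv (\<lambda>s. F s ** G s) (F' ** G t + F t ** G') t"
  unfolding matrix_deriv_def matrix_matrix_mult_def
proof (intro allI)
  fix i j
  have "((\<lambda>s. \<Sum>k\<in>UNIV. F s $ i $ k * G s $ k $ j) has_real_derivative
     (\<Sum>k\<in>UNIV. F' $ i $ k * G t $ k $ j + F t $ i $ k * G' $ k $ j)) (at t)"
    using assms unfolding matrix_deriv_def
    by (intro DERIV_sum) (auto intro!: derivative_eq_intros)
  then show "((\<lambda>s. (\<chi> i j. \<Sum>k\<in>UNIV. F s $ i $ k * G s $ k $ j) $ i $ j) has_real_derivative
       ((\<chi> i j. \<Sum>k\<in>UNIV. F' $ i $ k * G t $ k $ j) + (\<chi> i j. \<Sum>k\<in>UNIV. F t $ i $ k * G' $ k $ j)) $ i $ j) (at t)"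
    by (simp add: sum.distrib)
qed

lemma matrix_deriv_zero_imp_const:
  assumes "\<And>t. matrix_deriv F 0 t" shows "F t = F 0"
proof -
  have "F t $ i $ j = F 0 $ i $ j" for i j
    by (rule DERIV_isconst_all) (use assms in \<open>auto simp: matrix_deriv_def\<close>)
  then show ?thesis by (simp add: vec_eq_iff)
qed

lemma mat_power_entry_bound:
  fixes A :: "real ^ 'n ^ 'n"
  shows "\<bar>((**) A ^^ k) (mat 1) $ i $ j\<bar> \<le> (\<Sum>i\<in>UNIV. \<Sum>j\<in>UNIV. \<bar>A $ i $ j\<bar>) ^ k"
proof (induction k arbitrary: i j)
  case 0 then show ?case by (simp add: mat_def)
next
  case (Suc k)
  let ?m = "\<Sum>i\<in>UNIV. \<Sum>j\<in>UNIV. \<bar>A $ i $ j\<bar>"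
  have "\<bar>((**) A ^^ Suc k) (mat 1) $ i $ j\<bar> = \<bar>\<Sum>l\<in>UNIV. A $ i $ l * ((**) A ^^ k) (mat 1) $ l $ j\<bar>"
    by (simp add: matrix_matrix_mult_def)
  also have "\<dots> \<le> (\<Sum>l\<in>UNIV. \<bar>A $ i $ l * ((**) A ^^ k) (mat 1) $ l $ j\<bar>)" by (rule sum_abs)
  also have "\<dots> \<le> (\<Sum>l\<in>UNIV. \<bar>A $ i $ l\<bar> * ?m ^ k)"
    unfolding abs_mult by (intro sum_mono mult_left_mono Suc.IH) auto
  also have "\<dots> = (\<Sum>l\<in>UNIV. \<bar>A $ i $ l\<bar>) * ?m ^ k" by (simp add: sum_distrib_right)
  also have "\<dots> \<le> ?m * ?m ^ k"
    by (intro mult_right_mono member_le_sum[of i UNIV "\<lambda>i. \<Sum>l\<in>UNIV. \<bar>A $ i $ l\<bar>"]) 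
      (auto intro!: sum_nonneg zero_le_power)
  finally show ?case by simp
qed

lemma matrix_scaleR_mult: "(s *\<^sub>R A) ** (t *\<^sub>R B) = (s * t) *\<^sub>R (A ** B)" for A :: "real ^ 'n ^ 'm" and B :: "real ^ 'p ^ 'n"
  by (simp add: vec_eq_iff matrix_matrix_mult_def sum_distrib_left mult_ac)

lemma matrix_add_mult_right: "(A + B) ** C = A ** C + B ** C" for A :: "real ^ 'n ^ 'm" and C :: "real ^ 'p ^ 'n"
  by (simp add: vec_eq_iff matrix_matrix_mult_def distrib_right sum.distrib)

text \<open>
  Each entry of \<open>mat_exp (t A)\<close> is an everywhere convergent power series in \<open>t\<close>, so that termwise
  differentiation of real power series applies.
\<close>

lemma mat_exp_scaled_sums:
  fixes A :: "real ^ 'n ^ 'n"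
  shows "(\<lambda>k. ((**) A ^^ k) (mat 1) $ i $ j / fact k * t ^ k) sums (mat_exp (t *\<^sub>R A) $ i $ j)"
proof -
  let ?P = "\<lambda>k. ((**) A ^^ k) (mat 1)"
  let ?m = "\<Sum>i\<in>UNIV. \<Sum>j\<in>UNIV. \<bar>A $ i $ j\<bar>"
  have pow: "((**) (t *\<^sub>R A) ^^ k) (mat 1) = t ^ k *\<^sub>R ?P k" for k
    by (induction k) (simp_all add: matrix_scaleR_mult)
  have summ: "summable (\<lambda>k. ?P k $ i $ j / fact k * t ^ k)" for i j
  proof (rule summable_comparison_test'[of "\<lambda>k. inverse (fact k) * (?m * \<bar>t\<bar>) ^ k" 0])
    show "summable (\<lambda>k. inverse (fact k) * (?m * \<bar>t\<bar>) ^ k)" by (rule summable_exp)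
    show "norm (?P k $ i $ j / fact k * t ^ k) \<le> inverse (fact k) * (?m * \<bar>t\<bar>) ^ k" for k
      using mult_right_mono[OF mat_power_entry_bound[where A=A and k=k and i=i and j=j], of "\<bar>t\<bar> ^ k / fact k"]
      by (simp add: abs_mult power_mult_distrib power_abs field_simps)
  qed
  define S where "S = (\<chi> i j. \<Sum>k. ?P k $ i $ j / fact k * t ^ k)"
  have "(\<lambda>k. (1 / fact k) *\<^sub>R ((**) (t *\<^sub>R A) ^^ k) (mat 1)) sums S"
    unfolding sums_def pow
  proof (intro vec_tendstoI)
    fix i j
    have "(\<lambda>n. \<Sum>k<n. ?P k $ i $ j / fact k * t ^ k) \<longlonglongrightarrow> S $ i $ j"
      using summable_sums[OF summ[of i j]] by (simp add: sums_def S_def)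
    then show "(\<lambda>n. (\<Sum>k<n. (1 / fact k) *\<^sub>R t ^ k *\<^sub>R ?P k) $ i $ j) \<longlonglongrightarrow> S $ i $ j"
      by (simp add: mult_ac)
  qed
  then have "mat_exp (t *\<^sub>R A) = S" unfolding mat_exp_def by (rule sums_unique[symmetric])
  then show ?thesis using summable_sums[OF summ[of i j]] by (simp add: S_def)
qed

lemma mat_exp_0 [simp]: "mat_exp (0 :: real ^ 'n ^ 'n) = mat 1"
proof -
  have "mat_exp (0 :: real ^ 'n ^ 'n) $ i $ j = mat 1 $ i $ j" for i j
    using sums_unique2[OF mat_exp_scaled_sums[of "0 :: real ^ 'n ^ 'n" i j 0] powser_sums_zero]
    by simp
  then show ?thesis by (simp add: vec_eq_iff)
qed

lemma mat_exp_deriv: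
  fixes A :: "real ^ 'n ^ 'n"
  shows "matrix_deriv (\<lambda>t. mat_exp (t *\<^sub>R A)) (A ** mat_exp (t *\<^sub>R A)) t"
  unfolding matrix_deriv_def
proof (intro allI)
  fix i j
  let ?P = "\<lambda>k. ((**) A ^^ k) (mat 1)"
  let ?c = "\<lambda>k. ?P k $ i $ j / fact k"
  have "summable (\<lambda>k. ?c k * s ^ k)" for s using mat_exp_scaled_sums sums_summable by blast
  from termdiffs_strong_converges_everywhere[OF this]
  have "((\<lambda>s. \<Sum>k. ?c k * s ^ k) has_real_derivative (\<Sum>k. diffs ?c k * t ^ k)) (at t)" .
  moreover have "(\<Sum>k. ?c k * s ^ k) = mat_exp (s *\<^sub>R A) $ i $ j" for s
    using mat_exp_scaled_sums[of A i j s] by (rule sums_unique[symmetric])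
  moreover have "(\<Sum>k. diffs ?c k * t ^ k) = (A ** mat_exp (t *\<^sub>R A)) $ i $ j"
  proof -
    have "(\<lambda>k. \<Sum>l\<in>UNIV. A $ i $ l * (?P k $ l $ j / fact k * t ^ k)) sums (\<Sum>l\<in>UNIV. A $ i $ l * mat_exp (t *\<^sub>R A) $ l $ j)"
      by (intro sums_sum sums_mult mat_exp_scaled_sums)
    moreover have "diffs ?c k * t ^ k = (\<Sum>l\<in>UNIV. A $ i $ l * (?P k $ l $ j / fact k * t ^ k))" for k
    proof -
      have "real (Suc k) * (x / fact (Suc k)) = x / fact k" for x
        by (simp add: fact_Suc del: of_nat_Suc)
      then have "diffs ?c k = (\<Sum>l\<in>UNIV. A $ i $ l * ?P k $ l $ j) / fact k"
        unfolding diffs_def by (simp add: matrix_matrix_mult_def del: of_nat_Suc fact_Suc)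
      then show ?thesis by (simp add: sum_distrib_right sum_divide_distrib mult.assoc)
    qed
    ultimately show ?thesis by (simp add: sums_unique[symmetric] matrix_matrix_mult_def)
  qed
  ultimately show "((\<lambda>s. mat_exp (s *\<^sub>R A) $ i $ j) has_real_derivative (A ** mat_exp (t *\<^sub>R A)) $ i $ j) (at t)"
    by simp
qed

lemma mat_exp_commute:
  fixes A :: "real ^ 'n ^ 'n"
  shows "A ** mat_exp (t *\<^sub>R A) = mat_exp (t *\<^sub>R A) ** A"
proof -
  let ?P = "\<lambda>k. ((**) A ^^ k) (mat 1)"
  have comm: "A ** ?P k = ?P k ** A" for k
  proof (induction k)
    case (Suc k)
    then show ?case unfolding funpow.simps comp_apply by (metis matrix_mul_assoc)
  qed simp
  have "(A ** mat_exp (t *\<^sub>R A)) $ i $ j = (mat_exp (t *\<^sub>R A) ** A) $ i $ j" for i j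
  proof -
    have "(\<lambda>k. \<Sum>l\<in>UNIV. A $ i $ l * (?P k $ l $ j / fact k * t ^ k)) sums (\<Sum>l\<in>UNIV. A $ i $ l * mat_exp (t *\<^sub>R A) $ l $ j)"
      by (intro sums_sum sums_mult mat_exp_scaled_sums)
    moreover have "(\<lambda>k. \<Sum>l\<in>UNIV. (?P k $ i $ l / fact k * t ^ k) * A $ l $ j) sums (\<Sum>l\<in>UNIV. mat_exp (t *\<^sub>R A) $ i $ l * A $ l $ j)"
      by (intro sums_sum sums_mult2 mat_exp_scaled_sums)
    moreover have "(\<Sum>l\<in>UNIV. A $ i $ l * (?P k $ l $ j / fact k * t ^ k)) = (\<Sum>l\<in>UNIV. (?P k $ i $ l / fact k * t ^ k) * A $ l $ j)" for k
    proof -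
      have "(A ** ?P k) $ i $ j * (t ^ k / fact k) = (?P k ** A) $ i $ j * (t ^ k / fact k)" by (simp only: comm)
      then show ?thesis by (simp add: matrix_matrix_mult_def sum_distrib_left sum_distrib_right sum_divide_distrib mult_ac)
    qed
    ultimately show ?thesis using sums_unique2 by (simp add: matrix_matrix_mult_def) blast
  qed
  then show ?thesis by (simp add: vec_eq_iff)
qed

lemma mat_exp_neg_deriv:
  fixes A :: "real ^ 'n ^ 'n"
  shows "matrix_deriv (\<lambda>t. mat_exp ((- t) *\<^sub>R A)) (- (A ** mat_exp ((- t) *\<^sub>R A))) t"
  unfolding matrix_deriv_def
proof (intro allI)
  fix i j
  have "((\<lambda>s. mat_exp (s *\<^sub>R A) $ i $ j) has_real_derivative (A ** mat_exp ((- t) *\<^sub>R A)) $ i $ j) (at (- t))"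
    using mat_exp_deriv[of A "- t"] by (simp add: matrix_deriv_def)
  moreover have "(uminus has_real_derivative - 1) (at t)"
    by (auto intro!: derivative_eq_intros)
  ultimately have "((\<lambda>s. mat_exp ((- s) *\<^sub>R A) $ i $ j) has_real_derivative (A ** mat_exp ((- t) *\<^sub>R A)) $ i $ j * - 1) (at t)"
    by (rule DERIV_chain2[where f="\<lambda>s. mat_exp (s *\<^sub>R A) $ i $ j" and g=uminus])
  then show "((\<lambda>s. mat_exp ((- s) *\<^sub>R A) $ i $ j) has_real_derivative (- (A ** mat_exp ((- t) *\<^sub>R A))) $ i $ j) (at t)"
    by simp
qed

lemma matrix_mult_minus_left: "(- A) ** B = - (A ** B)" for A :: "real ^ 'n ^ 'm" and B :: "real ^ 'p ^ 'n"
  by (simp add: vec_eq_iff matrix_matrix_mult_def sum_negf)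

lemma matrix_mult_minus_right: "A ** (- B) = - (A ** B)" for A :: "real ^ 'n ^ 'm" and B :: "real ^ 'p ^ 'n"
  by (simp add: vec_eq_iff matrix_matrix_mult_def sum_negf)

text \<open>
  Since \<open>A\<close> commutes with its exponential, the derivative of this product vanishes.
\<close>

lemma mat_exp_neg_flow:
  fixes A :: "real ^ 'n ^ 'n"
  assumes X: "\<And>t. matrix_deriv X (A ** X t) t"
  shows "mat_exp ((- t) *\<^sub>R A) ** X t = X 0"
proof -
  have "matrix_deriv (\<lambda>t. mat_exp ((- t) *\<^sub>R A) ** X t) 0 t" for t
  proof -
    have "- (A ** mat_exp ((- t) *\<^sub>R A)) ** X t + mat_exp ((- t) *\<^sub>R A) ** (A ** X t) = 0"
      unfolding mat_exp_commute matrix_mult_minus_left by (simp add: matrix_mul_assoc)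
    with matrix_deriv_mult[OF mat_exp_neg_deriv X, of A t] show ?thesis by simp
  qed
  from matrix_deriv_zero_imp_const[of "\<lambda>t. mat_exp ((- t) *\<^sub>R A) ** X t", OF this] show ?thesis by simp
qed

lemma mat_exp_neg_mult: "mat_exp ((- t) *\<^sub>R A) ** mat_exp (t *\<^sub>R A) = mat 1" for A :: "real ^ 'n ^ 'n"
  using mat_exp_neg_flow[of "\<lambda>t. mat_exp (t *\<^sub>R A)", OF mat_exp_deriv] by simp

lemma mat_exp_flow_unique:
  fixes A :: "real ^ 'n ^ 'n"
  assumes X: "\<And>t. matrix_deriv X (A ** X t) t"
  shows "X t = mat_exp (t *\<^sub>R A) ** X 0"
proof -
  have "mat_exp (t *\<^sub>R A) ** (mat_exp ((- t) *\<^sub>R A) ** X t) = X t"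
    using mat_exp_neg_mult[of "- t" A] by (simp add: matrix_mul_assoc)
  then show ?thesis unfolding mat_exp_neg_flow[OF X] by simp
qed

lemma mat_exp_k_so: "mat_exp (s *\<^sub>R k_so) = of_rows (Complex (cos (s/2)) (- sin (s/2))) (Complex (sin (s/2)) (cos (s/2)))"
proof -
  let ?R = "\<lambda>s. of_rows (Complex (cos (s/2)) (- sin (s/2))) (Complex (sin (s/2)) (cos (s/2)))"
  have "matrix_deriv ?R (k_so ** ?R t) t" for t
    unfolding matrix_deriv_def forall_2 matrix_mult_entry basis_entries
    by (auto simp: of_rows_def intro!: derivative_eq_intros)
  from mat_exp_flow_unique[OF this, of s] have "?R s = mat_exp (s *\<^sub>R k_so) ** ?R 0" .
  moreover have "?R 0 = mat 1" by (simp add: mat2_eq_iff of_rows_def mat_1_entries)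
  ultimately show ?thesis by simp
qed

text \<open>
  The adjoint action of \<open>exp (s k)\<close> on the plane of \<open>p1\<close> and \<open>p2\<close> is the rotation by \<open>s\<close>, although
  \<open>exp (s k)\<close> itself is the rotation by \<open>s / 2\<close>.
\<close>

lemma rotation_conj_horiz:
  "mat_exp (s *\<^sub>R k_so) ** horiz u ** mat_exp ((- s) *\<^sub>R k_so) = horiz (exp (\<i> * of_real s) * u)"
proof -
  define c d where "c = cos (s/2)" and "d = sin (s/2)"
  have s: "cos s = c * c - d * d" "sin s = 2 * (c * d)"
    using cos_double[of "s/2"] sin_double[of "s/2"] by (simp_all add: c_def d_def power2_eq_square)
  have "Re (exp (\<i> * of_real s) * u) = (c * c - d * d) * Re u - 2 * (c * d) * Im u"
    "Im (exp (\<i> * of_real s) * u) = (c * c - d * d) * Im u + 2 * (c * d) * Re u"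
    by (simp_all add: s[symmetric] exp_Euler cos_of_real sin_of_real)
  then show ?thesis
    unfolding mat_exp_k_so
    by (simp add: mat2_eq_iff matrix_mult_entry horiz_entries of_rows_def c_def[symmetric] d_def[symmetric]) (simp add: field_simps)
qed

definition geodesic_formula :: "real \<Rightarrow> real \<Rightarrow> real \<Rightarrow> mat2" where
  "geodesic_formula \<phi> \<beta> t = mat_exp (t *\<^sub>R (cos \<phi> *\<^sub>R p1 + sin \<phi> *\<^sub>R p2 + \<beta> *\<^sub>R k_so)) **
             mat_exp (- (t * \<beta>) *\<^sub>R k_so)"

lemma geodesic_formula_0: "geodesic_formula \<phi> \<beta> 0 = mat 1"
  by (simp add: geodesic_formula_def)

text \<open>
  With \<open>A = u + B\<close>, \<open>B = \<beta> k\<close>, the derivative of \<open>exp (t A) exp (- t B)\<close> is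
  \<open>exp (t A) u exp (- t B)\<close>; moving \<open>exp (- t B)\<close> to the left conjugates \<open>u\<close> by \<open>exp (t B)\<close>.
\<close>

lemma geodesic_formula_deriv:
  "matrix_deriv (geodesic_formula \<phi> \<beta>) (geodesic_formula \<phi> \<beta> t ** horiz (exp (\<i> * of_real \<phi>) * exp (\<i> * of_real (\<beta> * t)))) t"
proof -
  define A where "A = cos \<phi> *\<^sub>R p1 + sin \<phi> *\<^sub>R p2 + \<beta> *\<^sub>R k_so"
  define B where "B = \<beta> *\<^sub>R k_so"
  have F: "geodesic_formula \<phi> \<beta> = (\<lambda>t. mat_exp (t *\<^sub>R A) ** mat_exp ((- t) *\<^sub>R B))"
    by (simp add: fun_eq_iff geodesic_formula_def A_def B_def)
  have AB: "A = horiz (exp (\<i> * of_real \<phi>)) + B"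
    by (simp add: A_def B_def horiz_def exp_Euler cos_of_real sin_of_real)
  let ?E = "mat_exp (t *\<^sub>R A)" and ?N = "mat_exp ((- t) *\<^sub>R B)" and ?M = "mat_exp (t *\<^sub>R B)"
  have "matrix_deriv (geodesic_formula \<phi> \<beta>) (A ** ?E ** ?N + ?E ** - (B ** ?N)) t"
    unfolding F by (rule matrix_deriv_mult[OF mat_exp_deriv mat_exp_neg_deriv])
  moreover have "A ** ?E ** ?N + ?E ** - (B ** ?N) = ?E ** horiz (exp (\<i> * of_real \<phi>)) ** ?N"
  proof -
    have "A ** ?E ** ?N = ?E ** (horiz (exp (\<i> * of_real \<phi>)) + B) ** ?N" by (simp add: mat_exp_commute AB)
    then show ?thesis by (simp add: matrix_add_ldistrib matrix_add_mult_right matrix_mult_minus_right matrix_mul_assoc)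
  qed
  moreover have "?N ** ?M = mat 1" by (rule mat_exp_neg_mult)
  then have "?E ** horiz (exp (\<i> * of_real \<phi>)) ** ?N = (?E ** ?N) ** (?M ** horiz (exp (\<i> * of_real \<phi>)) ** ?N)"
    by (metis matrix_mul_assoc matrix_mul_rid)
  moreover have "?M ** horiz (exp (\<i> * of_real \<phi>)) ** ?N = horiz (exp (\<i> * of_real \<phi>) * exp (\<i> * of_real (\<beta> * t)))"
    using rotation_conj_horiz[of "t * \<beta>" "exp (\<i> * of_real \<phi>)"] by (simp add: B_def mult.commute)
  ultimately show ?thesis by (simp add: F)
qed

lemma matrix_deriv_imp_row:
  fixes F :: "real \<Rightarrow> mat2"
  assumes "matrix_deriv F F' t"
  shows "((\<lambda>t. cplx_row i (F t)) has_vector_derivative cplx_row i F') (at t)"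
proof -
  have "((\<lambda>s. F s $ i $ j) has_vector_derivative F' $ i $ j) (at t)" for j
    using assms by (simp add: matrix_deriv_def has_real_derivative_iff_has_vector_derivative)
  then have "((\<lambda>s. of_real (F s $ i $ 1) + \<i> * of_real (F s $ i $ 2)) has_vector_derivative
      of_real (F' $ i $ 1) + \<i> * of_real (F' $ i $ 2)) (at t)"
    by (intro has_vector_derivative_add bounded_linear.has_vector_derivative[OF bounded_linear_of_real]
         bounded_linear.has_vector_derivative[OF bounded_linear_const_mult[OF bounded_linear_of_real]])
  moreover have "of_real (G $ i $ 1) + \<i> * of_real (G $ i $ 2) = cplx_row i G" for G :: mat2
    by (simp add: cplx_row_def complex_eq_iff)
  ultimately show ?thesis by simp
qed

lemma geodesic_formula_row_deriv:
  "((\<lambda>t. cplx_row i (geodesic_formula \<phi> \<beta> t)) has_vector_derivative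
     cnj (cplx_row i (geodesic_formula \<phi> \<beta> t)) * (exp (\<i> * of_real \<phi>) * exp (\<i> * of_real (\<beta> * t))) / 2) (at t)"
  using matrix_deriv_imp_row[OF geodesic_formula_deriv, of i \<phi> \<beta> t] by (simp only: cplx_row_mult_horiz)

text \<open>
  The derivative of \<open>cnj p * q\<close> is real.  For the two rows of a curve this is conservation of the
  determinant.
\<close>

lemma row_pairing_const:
  fixes p q :: "real \<Rightarrow> complex"
  assumes p: "\<And>t. (p has_vector_derivative cnj (p t) * U t / 2) (at t)"
    and q: "\<And>t. (q has_vector_derivative cnj (q t) * U t / 2) (at t)"
  shows "Im (cnj (p t) * q t) = Im (cnj (p 0) * q 0)"
proof -
  have "((\<lambda>t. Im (cnj (p t) * q t)) has_vector_derivative 0) (at t)" for t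
  proof (rule has_vector_derivative_eq_rhs[OF bounded_linear.has_vector_derivative[OF bounded_linear_Im
        has_vector_derivative_mult[OF has_vector_derivative_cnj[OF p] q]]])
    show "Im (cnj (p t) * (cnj (q t) * U t / 2) + cnj (cnj (p t) * U t / 2) * q t) = 0"
      by (simp add: field_simps)
  qed
  then have "((\<lambda>t. Im (cnj (p t) * q t)) has_real_derivative 0) (at t)" for t
    by (simp add: has_real_derivative_iff_has_vector_derivative)
  then show ?thesis by (intro DERIV_isconst_all) auto
qed

text \<open>
  The difference of corresponding rows solves the same real-linear equation with initial value
  zero.  Its pairings with the two rows of \<open>g\<close> are constant, hence zero, and these rows are
  linearly independent over the reals.
\<close>

lemma horizontal_flow_unique:
  assumes f: "\<And>t i. ((\<lambda>t. cplx_row i (f t)) has_vector_derivative cnj (cplx_row i (f t)) * U t / 2) (at t)"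
    and g: "\<And>t i. ((\<lambda>t. cplx_row i (g t)) has_vector_derivative cnj (cplx_row i (g t)) * U t / 2) (at t)"
    and eq: "f 0 = g 0" and SL: "g 0 \<in> SL2"
  shows "f t = g t"
proof -
  have "cplx_row i (f t) - cplx_row i (g t) = 0" for i
  proof -
    let ?w = "\<lambda>t. cplx_row i (f t) - cplx_row i (g t)"
    let ?p = "cplx_row 1 (g t)" and ?q = "cplx_row 2 (g t)"
    have w: "(?w has_vector_derivative cnj (?w t) * U t / 2) (at t)" for t
      by (rule has_vector_derivative_eq_rhs[OF has_vector_derivative_diff[OF f g]]) (simp add: field_simps)
    have "Im (cnj ?p * ?w t) = 0" "Im (cnj ?q * ?w t) = 0"
      using row_pairing_const[OF g w, where t=t] by (simp_all add: eq)
    moreover have "Im (cnj ?p * ?q) = 1"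
      using row_pairing_const[OF g g, where t=t] SL by (simp add: SL2_iff_rows)
    moreover have "of_real (Im (cnj p * q)) * v = of_real (Im (cnj p * v)) * q - of_real (Im (cnj q * v)) * p" for p q v :: complex
      by (simp add: complex_eq_iff algebra_simps)
    ultimately have "of_real 1 * ?w t = of_real 0 * ?q - of_real 0 * ?p" by metis
    then show ?thesis by simp
  qed
  then show ?thesis by (simp add: cplx_row_eq_iff)
qed

lemma geodesic_formula_SL2: "geodesic_formula \<phi> \<beta> t \<in> SL2"
  using row_pairing_const[OF geodesic_formula_row_deriv geodesic_formula_row_deriv, where t=t]
    mat_1_in_SL2 by (simp add: SL2_iff_rows geodesic_formula_0)

lemma geodesic_formula_horizontal:
  assumes "a \<le> b"
  shows "horizontal_curve a b (geodesic_formula \<phi> \<beta>) (\<lambda>t. exp (\<i> * of_real \<phi>) * exp (\<i> * of_real (\<beta> * t)))"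
  unfolding horizontal_curve_def
proof (intro conjI ballI allI assms geodesic_formula_SL2)
  show "(\<lambda>t. exp (\<i> * of_real \<phi>) * exp (\<i> * of_real (\<beta> * t))) absolutely_integrable_on {a..b}"
    by (intro absolutely_integrable_continuous_real continuous_intros)
  fix i
  have "continuous_on {a..b} (\<lambda>t. cplx_row i (geodesic_formula \<phi> \<beta> t))"
    by (intro continuous_at_imp_continuous_on ballI has_vector_derivative_continuous[OF geodesic_formula_row_deriv])
  then show "primitive_on a b (\<lambda>t. cplx_row i (geodesic_formula \<phi> \<beta> t))
     (\<lambda>t. cnj (cplx_row i (geodesic_formula \<phi> \<beta> t)) * (exp (\<i> * of_real \<phi>) * exp (\<i> * of_real (\<beta> * t))) / 2)"
    by (intro primitive_on_C1 has_vector_derivative_at_within[OF geodesic_formula_row_deriv] continuous_intros) auto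
qed

lemma geodesic_formula_has_sr_length:
  assumes "a \<le> b" shows "has_sr_length (geodesic_formula \<phi> \<beta>) a b (b - a)"
  using horizontal_imp_has_sr_length[OF geodesic_formula_horizontal[OF assms, of \<phi> \<beta>]] assms
  by (simp add: norm_mult)

text \<open>
  The size of \<open>\<epsilon>\<close> is chosen such that \<open>exp (2 \<epsilon>) - 1 = 1 / (1 + \<bar>\<beta>\<bar>)\<close>, which satisfies both
  smallness conditions of \<open>rotating_control_minimal\<close>.
\<close>

lemma geodesic_formula_geodesic: "geodesic (geodesic_formula \<phi> \<beta>)"
  unfolding geodesic_def
proof
  fix t
  let ?\<gamma> = "geodesic_formula \<phi> \<beta>"
  define \<epsilon> where "\<epsilon> = ln (1 + 1 / (1 + \<bar>\<beta>\<bar>)) / 2"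
  have e: "\<epsilon> > 0" by (simp add: \<epsilon>_def ln_gt_zero add_pos_nonneg)
  have ex: "exp (2 * \<epsilon>) - 1 = 1 / (1 + \<bar>\<beta>\<bar>)" by (simp add: \<epsilon>_def add_pos_pos)
  have 1: "\<bar>\<beta>\<bar> * (exp (t + \<epsilon> - (t - \<epsilon>)) - 1) < 1"
    using ex by (simp add: divide_less_eq)
  have "2 * \<epsilon> \<le> exp (2 * \<epsilon>) - 1" using exp_ge_add_one_self[of "2 * \<epsilon>"] by linarith
  also have "\<dots> \<le> 1" unfolding ex by (simp add: divide_le_eq)
  finally have 2: "t + \<epsilon> - (t - \<epsilon>) < 2 * pi" using pi_gt3 by linarith
  let ?J = "joining_lengths (?\<gamma> (t - \<epsilon>)) (?\<gamma> (t + \<epsilon>))"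
  have H: "horizontal_curve (t - \<epsilon>) (t + \<epsilon>) ?\<gamma> (\<lambda>t. exp (\<i> * of_real \<phi>) * exp (\<i> * of_real (\<beta> * t)))"
    using e by (intro geodesic_formula_horizontal) simp
  have low: "t + \<epsilon> - (t - \<epsilon>) \<le> l" if "l \<in> ?J" for l
    by (rule rotating_control_minimal[OF H _ _ _ 1 2 that]) (use e in auto)
  have len: "has_sr_length ?\<gamma> (t - \<epsilon>) (t + \<epsilon>) (t + \<epsilon> - (t - \<epsilon>))"
    using e by (intro geodesic_formula_has_sr_length) simp
  then have "t + \<epsilon> - (t - \<epsilon>) \<in> ?J" unfolding joining_lengths_def by blast
  with low have "Inf ?J = t + \<epsilon> - (t - \<epsilon>)" by (intro cInf_eq_minimum)
  then have "shortest_arc ?\<gamma> (t - \<epsilon>) (t + \<epsilon>)"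
    using len by (simp add: shortest_arc_def sr_dist_def geodesic_formula_SL2)
  with e show "\<exists>\<epsilon>>0. shortest_arc ?\<gamma> (t - \<epsilon>) (t + \<epsilon>)" by blast
qed

lemma rotation_parameters_unique:
  assumes I: "open I" "t \<in> I" and c: "cmod c = 1"
    and eq: "\<And>t. t \<in> I \<Longrightarrow> c * exp (\<i> * of_real (\<beta> * t)) = d * exp (\<i> * of_real (\<alpha> * t))"
  shows "\<beta> = \<alpha>" "c = d"
proof -
  note der = has_vector_derivative_rotation
  have "((\<lambda>t. d * exp (\<i> * of_real (\<alpha> * t))) has_vector_derivative \<i> * of_real \<beta> * (c * exp (\<i> * of_real (\<beta> * t)))) (at t)"
    by (rule has_vector_derivative_transform_within_open[OF der I]) (rule eq)
  from vector_derivative_unique_at[OF this der]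
  have "\<i> * of_real \<beta> * (c * exp (\<i> * of_real (\<beta> * t))) = \<i> * of_real \<alpha> * (c * exp (\<i> * of_real (\<beta> * t)))"
    using eq[OF I(2)] by simp
  moreover have "c * exp (\<i> * of_real (\<beta> * t)) \<noteq> 0" using c by auto
  ultimately show b: "\<beta> = \<alpha>" by simp
  show "c = d" using eq[OF I(2)] unfolding b by simp
qed

text \<open>
  On overlapping intervals the local parameters \<open>c\<close> and \<open>\<beta>\<close> agree, since the control is determined by
  the curve; being locally constant on a connected set, they are constant.
\<close>

lemma geodesic_rotating:
  assumes geo: "geodesic \<gamma>" and arc: "arclength_parametrized \<gamma>"
  shows "\<exists>c \<beta>. cmod c = 1 \<and> (\<forall>t i.
     ((\<lambda>t. cplx_row i (\<gamma> t)) has_vector_derivative cnj (cplx_row i (\<gamma> t)) * (c * exp (\<i> * of_real (\<beta> * t))) / 2) (at t))"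
proof -
  have "\<forall>s. \<exists>\<epsilon> c \<beta>. \<epsilon> > 0 \<and> cmod c = 1 \<and> (\<forall>t\<in>{s - \<epsilon><..<s + \<epsilon>}. \<forall>i.
     ((\<lambda>t. cplx_row i (\<gamma> t)) has_vector_derivative cnj (cplx_row i (\<gamma> t)) * (c * exp (\<i> * of_real (\<beta> * t))) / 2) (at t))"
    using geodesic_locally_rotating[OF geo arc] by blast
  then obtain \<epsilon> c \<beta> where e: "\<And>s. \<epsilon> s > 0" and c: "\<And>s. cmod (c s) = 1" and
    d: "\<And>s t i. t \<in> {s - \<epsilon> s<..<s + \<epsilon> s} \<Longrightarrow>
     ((\<lambda>t. cplx_row i (\<gamma> t)) has_vector_derivative cnj (cplx_row i (\<gamma> t)) * (c s * exp (\<i> * of_real (\<beta> s * t))) / 2) (at t)"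
    by metis
  have SL: "\<gamma> t \<in> SL2" for t
  proof -
    have "has_sr_length \<gamma> t t (t - t)" using arc unfolding arclength_parametrized_def by blast
    then have "\<forall>s\<in>{t..t}. \<gamma> s \<in> SL2" unfolding has_sr_length_def by (elim conjE)
    then show ?thesis by simp
  qed
  have loc: "(\<beta> s, c s) = (\<beta> r, c r)" if r: "r \<in> {s - \<epsilon> s<..<s + \<epsilon> s}" for r s
  proof -
    let ?I = "{s - \<epsilon> s<..<s + \<epsilon> s} \<inter> {r - \<epsilon> r<..<r + \<epsilon> r}"
    have I: "open ?I" "r \<in> ?I" using r e[of r] by auto
    have "c s * exp (\<i> * of_real (\<beta> s * t)) = c r * exp (\<i> * of_real (\<beta> r * t))" if t: "t \<in> ?I" for t
      using vector_derivative_unique_at[OF d[of t s 1] d[of t r 1]] t cplx_row_nonzero[OF SL, of 1 t] by simp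
    from rotation_parameters_unique[OF I c this] show ?thesis by simp
  qed
  have "(\<beta> s, c s) = (\<beta> 0, c 0)" for s
  proof (rule connected_local_const[of UNIV s 0 "\<lambda>s. (\<beta> s, c s)"])
    show "\<forall>a\<in>UNIV. \<forall>\<^sub>F b in at a within UNIV. (\<beta> a, c a) = (\<beta> b, c b)"
    proof
      fix a :: real
      show "\<forall>\<^sub>F b in at a within UNIV. (\<beta> a, c a) = (\<beta> b, c b)"
        by (rule eventually_at_in_open'[THEN eventually_mono, of "{a - \<epsilon> a<..<a + \<epsilon> a}"]) (use e loc in auto)
    qed
  qed auto
  then have const: "\<beta> s = \<beta> 0" "c s = c 0" for s by auto
  have "((\<lambda>t. cplx_row i (\<gamma> t)) has_vector_derivative cnj (cplx_row i (\<gamma> t)) * (c 0 * exp (\<i> * of_real (\<beta> 0 * t))) / 2) (at t)" for t i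
    using d[of t t i] e[of t] unfolding const[of t] by simp
  then show ?thesis using c by blast
qed

lemma geodesic_iff_formula:
  "geodesic \<gamma> \<and> arclength_parametrized \<gamma> \<and> \<gamma> 0 = mat 1 \<longleftrightarrow> (\<exists>\<phi> \<beta>. \<forall>t. \<gamma> t = geodesic_formula \<phi> \<beta> t)"
proof
  assume "geodesic \<gamma> \<and> arclength_parametrized \<gamma> \<and> \<gamma> 0 = mat 1"
  then have geo: "geodesic \<gamma>" "arclength_parametrized \<gamma>" and 0: "\<gamma> 0 = mat 1" by auto
  obtain c \<beta> where c: "cmod c = 1" and d: "\<And>t i.
     ((\<lambda>t. cplx_row i (\<gamma> t)) has_vector_derivative cnj (cplx_row i (\<gamma> t)) * (c * exp (\<i> * of_real (\<beta> * t))) / 2) (at t)"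
    using geodesic_rotating[OF geo] by blast
  have ca: "c = exp (\<i> * of_real (Arg c))" using Arg_eq[of c] c by fastforce
  have "\<gamma> t = geodesic_formula (Arg c) \<beta> t" for t
    by (rule horizontal_flow_unique[OF d geodesic_formula_row_deriv[of _ "Arg c" \<beta>, folded ca]])
      (simp_all add: 0 geodesic_formula_0 mat_1_in_SL2)
  then show "\<exists>\<phi> \<beta>. \<forall>t. \<gamma> t = geodesic_formula \<phi> \<beta> t" by blast
next
  assume "\<exists>\<phi> \<beta>. \<forall>t. \<gamma> t = geodesic_formula \<phi> \<beta> t"
  then obtain \<phi> \<beta> where "\<gamma> = geodesic_formula \<phi> \<beta>" by (auto simp: fun_eq_iff)
  then show "geodesic \<gamma> \<and> arclength_parametrized \<gamma> \<and> \<gamma> 0 = mat 1"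
    by (simp add: geodesic_formula_geodesic geodesic_formula_0 arclength_parametrized_def geodesic_formula_has_sr_length)
qed


section \<open>Bracket generation\<close>

lemma Ck_Suc_imp: "Ck (Suc n) f \<Longrightarrow> Ck n f"
proof (induction n arbitrary: f)
  case 0
  then show ?case by (auto intro!: continuous_at_imp_continuous_on differentiable_imp_continuous_within)
next
  case (Suc n)
  then show ?case by (metis Ck.simps(2))
qed

lemma Ck_differentiable: "Ck (Suc n) f \<Longrightarrow> f differentiable (at x)"
  by simp

lemma Ck_directional: "Ck (Suc n) f \<Longrightarrow> Ck n (\<lambda>x. frechet_derivative f (at x) v)"
  by simp

lemma Ck_const: "Ck n (\<lambda>x. c)"
proof (induction n arbitrary: c)
  case (Suc n)
  have "frechet_derivative (\<lambda>x. c) (at x) v = 0" for x v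
    using frechet_derivative_at[OF has_derivative_const, of c] by metis
  then show ?case using Suc by simp
qed simp

lemma Ck_linear_compose:
  assumes h: "bounded_linear h" shows "Ck n f \<Longrightarrow> Ck n (\<lambda>x. h (f x))"
proof (induction n arbitrary: f)
  case 0
  then show ?case using bounded_linear.continuous_on[OF h] by simp
next
  case (Suc n)
  have d: "((\<lambda>x. h (f x)) has_derivative (\<lambda>v. h (frechet_derivative f (at x) v))) (at x)" for x
    using Suc.prems bounded_linear.has_derivative[OF h] frechet_derivative_works[of f "at x"] by auto
  have "frechet_derivative (\<lambda>x. h (f x)) (at x) v = h (frechet_derivative f (at x) v)" for x v
    using frechet_derivative_at[OF d[of x]] by metis
  then show ?case using Suc differentiableI[OF d] by simp
qed

lemma Ck_add: "Ck n f \<Longrightarrow> Ck n g \<Longrightarrow> Ck n (\<lambda>x. f x + g x)"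
proof (induction n arbitrary: f g)
  case 0
  then show ?case by (auto intro: continuous_intros)
next
  case (Suc n)
  have d: "((\<lambda>x. f x + g x) has_derivative (\<lambda>v. frechet_derivative f (at x) v + frechet_derivative g (at x) v)) (at x)" for x
    using Suc.prems by (intro has_derivative_add) (simp_all add: frechet_derivative_works[symmetric])
  have "frechet_derivative (\<lambda>x. f x + g x) (at x) v = frechet_derivative f (at x) v + frechet_derivative g (at x) v" for x v
    using frechet_derivative_at[OF d[of x]] by metis
  then show ?case using Suc differentiableI[OF d] by simp
qed

lemma Ck_scaleR: 
  fixes r :: "_ \<Rightarrow> real"
  shows "Ck n r \<Longrightarrow> Ck n f \<Longrightarrow> Ck n (\<lambda>x. r x *\<^sub>R f x)"
proof (induction n arbitrary: r f)
  case 0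
  then show ?case by (auto intro: continuous_intros)
next
  case (Suc n)
  have d: "((\<lambda>x. r x *\<^sub>R f x) has_derivative (\<lambda>v. r x *\<^sub>R frechet_derivative f (at x) v + frechet_derivative r (at x) v *\<^sub>R f x)) (at x)" for x
    using Suc.prems by (intro has_derivative_scaleR) (simp_all add: frechet_derivative_works[symmetric])
  have "frechet_derivative (\<lambda>x. r x *\<^sub>R f x) (at x) v = r x *\<^sub>R frechet_derivative f (at x) v + frechet_derivative r (at x) v *\<^sub>R f x" for x v
    using frechet_derivative_at[OF d[of x]] by metis
  moreover have "Ck n (\<lambda>x. r x *\<^sub>R frechet_derivative f (at x) v + frechet_derivative r (at x) v *\<^sub>R f x)" for v
    by (intro Ck_add Suc.IH Ck_directional Ck_Suc_imp[OF Suc.prems(1)] Ck_Suc_imp[OF Suc.prems(2)] Suc.prems)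
  ultimately show ?case using differentiableI[OF d] by simp
qed

lemma Ck_sum: "finite A \<Longrightarrow> (\<And>a. a \<in> A \<Longrightarrow> Ck n (f a)) \<Longrightarrow> Ck n (\<lambda>x. \<Sum>a\<in>A. f a x)"
  by (induction A rule: finite_induct) (simp_all add: Ck_const Ck_add)

text \<open>
  The derivative in the direction \<open>X x\<close> is expanded in a basis, which reduces it to products of
  component functions with directional derivatives in fixed directions.
\<close>

lemma Ck_derivative_along_field:
  fixes X :: "'a::euclidean_space \<Rightarrow> 'a" and Y :: "'a \<Rightarrow> 'b::real_normed_vector"
  assumes Y: "Ck (Suc n) Y" and X: "Ck n X"
  shows "Ck n (\<lambda>x. frechet_derivative Y (at x) (X x))"
proof -
  have "frechet_derivative Y (at x) (X x) = (\<Sum>b\<in>Basis. (X x \<bullet> b) *\<^sub>R frechet_derivative Y (at x) b)" for x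
  proof -
    have lin: "linear (frechet_derivative Y (at x))" using Y by (simp add: linear_frechet_derivative)
    have "frechet_derivative Y (at x) (X x) = frechet_derivative Y (at x) (\<Sum>b\<in>Basis. (X x \<bullet> b) *\<^sub>R b)"
      by (simp add: euclidean_representation)
    then show ?thesis by (simp add: linear_sum[OF lin] linear_cmul[OF lin])
  qed
  moreover have "Ck n (\<lambda>x. \<Sum>b\<in>Basis. (X x \<bullet> b) *\<^sub>R frechet_derivative Y (at x) b)"
    by (intro Ck_sum Ck_scaleR Ck_directional[OF Y] Ck_linear_compose[OF bounded_linear_inner_left X] finite_Basis)
  ultimately show ?thesis by simp
qed

lemma smooth_lie_bracket:
  assumes "smooth X" "smooth Y" shows "smooth (lie_bracket X Y)"
  unfolding smooth_def
proof
  fix n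
  have "Ck n (\<lambda>g. frechet_derivative Y (at g) (X g) + - frechet_derivative X (at g) (Y g))"
    using assms unfolding smooth_def
    by (intro Ck_add Ck_linear_compose[OF bounded_linear_minus[OF bounded_linear_ident]] Ck_derivative_along_field) auto
  then show "Ck n (lie_bracket X Y)" by (simp add: lie_bracket_def[abs_def])
qed

lemma smooth_bounded_linear:
  assumes h: "bounded_linear h" shows "smooth h"
  unfolding smooth_def
proof
  fix n
  have d: "frechet_derivative h (at x) = h" for x
    using frechet_derivative_at[OF bounded_linear_imp_has_derivative[OF h]] by metis
  show "Ck n h"
    by (cases n) (use h in \<open>auto simp: d Ck_const linear_continuous_on bounded_linear_imp_differentiable\<close>)
qed

text \<open>
  The polarization of the determinant: its value at \<open>(g, h)\<close> is the derivative of \<open>det\<close> at \<open>g\<close>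
  in the direction \<open>h\<close>.
\<close>

definition polar_det :: "mat2 \<Rightarrow> mat2 \<Rightarrow> real" where
  "polar_det g h = g$1$1 * h$2$2 + g$2$2 * h$1$1 - g$1$2 * h$2$1 - g$2$1 * h$1$2"

lemma polar_det_sym: "polar_det g h = polar_det h g"
  by (simp add: polar_det_def)

lemma polar_det_linear:
  "polar_det g 0 = 0" "polar_det g (x + y) = polar_det g x + polar_det g y"
  "polar_det g (x - y) = polar_det g x - polar_det g y" "polar_det g (c *\<^sub>R x) = c * polar_det g x"
  by (simp_all add: polar_det_def algebra_simps)

lemma polar_det_mult: "polar_det g (g ** a) = det g * trace a"
  by (simp add: polar_det_def matrix_mult_entry det_2 trace_def sum_2 algebra_simps)

lemma tangent_SL2_iff:
  assumes g: "g \<in> SL2" shows "h \<in> tangent_SL2 g \<longleftrightarrow> polar_det g h = 0"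
proof
  assume "h \<in> tangent_SL2 g"
  then show "polar_det g h = 0" by (auto simp: tangent_SL2_def sl2_def polar_det_mult)
next
  assume "polar_det g h = 0"
  have h: "g ** (matrix_inv g ** h) = h" using SL2_matrix_inv(2)[OF g] by (simp add: matrix_mul_assoc)
  then have "polar_det g h = trace (matrix_inv g ** h)"
    using polar_det_mult[of g "matrix_inv g ** h"] g by (simp add: SL2_def)
  then have "matrix_inv g ** h \<in> sl2" using \<open>polar_det g h = 0\<close> by (simp add: sl2_def)
  then show "h \<in> tangent_SL2 g" unfolding tangent_SL2_def by (metis h image_eqI)
qed

lemma det_line: "det (g + s *\<^sub>R w) = det g + s * polar_det g w + s\<^sup>2 * det w" for g w :: mat2
  by (simp add: det_2 polar_det_def power2_eq_square algebra_simps)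

text \<open>
  The function \<open>x \<mapsto> polar_det x (X x)\<close> vanishes on SL(2), so its derivative in the tangent
  direction \<open>w\<close> vanishes.  The line \<open>g + s w\<close> leaves SL(2); dividing it by the square root of its
  determinant \<open>1 + s\<^sup>2 det w\<close> gives a curve in SL(2) with the same velocity at \<open>s = 0\<close>.
\<close>

lemma tangent_field_derivative:
  assumes X: "X differentiable (at g)" and tan: "\<And>x. x \<in> SL2 \<Longrightarrow> X x \<in> tangent_SL2 x"
    and g: "g \<in> SL2" and w: "w \<in> tangent_SL2 g"
  shows "polar_det w (X g) + polar_det g (frechet_derivative X (at g) w) = 0"
proof -
  let ?DX = "frechet_derivative X (at g)"
  define q where "q = (\<lambda>s::real. 1 + s\<^sup>2 * det w)"
  define c where "c = (\<lambda>s. (1 / sqrt (q s)) *\<^sub>R (g + s *\<^sub>R w))"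
  have q: "det (g + s *\<^sub>R w) = q s" for s
    using g w by (simp add: det_line tangent_SL2_iff q_def SL2_def)
  have cSL: "c s \<in> SL2" if "q s > 0" for s
  proof -
    have "det (c s) = (1 / sqrt (q s)) * (1 / sqrt (q s)) * det (g + s *\<^sub>R w)"
      by (simp add: c_def det_2 algebra_simps)
    also have "\<dots> = 1" unfolding q using that by (simp add: field_simps)
    finally show ?thesis by (simp add: SL2_def)
  qed
  have c0: "c 0 = g" by (simp add: c_def q_def)
  have rd: "((\<lambda>s. 1 / sqrt (q s)) has_real_derivative 0) (at 0)"
    unfolding q_def by (auto intro!: derivative_eq_intros)
  have cd: "(c has_vector_derivative w) (at 0)"
  proof -
    have "((\<lambda>s. g + s *\<^sub>R w) has_vector_derivative w) (at 0)"
      by (auto intro!: derivative_eq_intros)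
    from has_vector_derivative_scaleR[OF rd this] show ?thesis by (simp add: c_def[abs_def] q_def)
  qed
  have "(X has_derivative ?DX) (at (c 0))" using X unfolding c0 by (rule frechet_derivative_works[THEN iffD1])
  from has_derivative_compose[OF cd[unfolded has_vector_derivative_def] this]
  have Xc: "((\<lambda>s. X (c s)) has_vector_derivative ?DX w) (at 0)"
    unfolding has_vector_derivative_def
    by (simp add: linear_cmul[OF linear_frechet_derivative[OF X]])
  have ent: "((\<lambda>s. F s $ i $ j) has_real_derivative F' $ i $ j) (at 0)" if "(F has_vector_derivative F') (at 0)" for F F' and i j :: 2
    unfolding has_real_derivative_iff_has_vector_derivative
    by (intro bounded_linear.has_vector_derivative[OF bounded_linear_vec_nth] that)
  have "((\<lambda>s. polar_det (c s) (X (c s))) has_real_derivative polar_det w (X g) + polar_det g (?DX w)) (at 0)"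
    unfolding polar_det_def using c0
    by (auto intro!: derivative_eq_intros ent[OF cd] ent[OF Xc])
  moreover have "((\<lambda>s. polar_det (c s) (X (c s))) has_real_derivative 0) (at 0)"
  proof (rule has_field_derivative_transform_within_open[OF DERIV_const])
    show "open {s. 0 < q s}" unfolding q_def by (intro open_Collect_less continuous_intros)
    show "0 \<in> {s. 0 < q s}" by (simp add: q_def)
    show "0 = polar_det (c s) (X (c s))" if "s \<in> {s. 0 < q s}" for s
      using tan[OF cSL] that by (simp add: tangent_SL2_iff[OF cSL])
  qed
  ultimately show ?thesis by (rule DERIV_unique)
qed

text \<open>
  The two derivative identities for \<open>X\<close> along \<open>Y\<close> and for \<open>Y\<close> along \<open>X\<close> are subtracted; the
  zeroth-order terms cancel by symmetry of \<open>polar_det\<close>.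
\<close>

lemma lie_bracket_tangent:
  assumes X: "X differentiable (at g)" "\<And>x. x \<in> SL2 \<Longrightarrow> X x \<in> tangent_SL2 x"
    and Y: "Y differentiable (at g)" "\<And>x. x \<in> SL2 \<Longrightarrow> Y x \<in> tangent_SL2 x" and g: "g \<in> SL2"
  shows "lie_bracket X Y g \<in> tangent_SL2 g"
proof -
  have "polar_det (Y g) (X g) + polar_det g (frechet_derivative X (at g) (Y g)) = 0"
    by (rule tangent_field_derivative[OF X g Y(2)[OF g]])
  moreover have "polar_det (X g) (Y g) + polar_det g (frechet_derivative Y (at g) (X g)) = 0"
    by (rule tangent_field_derivative[OF Y g X(2)[OF g]])
  ultimately show ?thesis
    unfolding tangent_SL2_iff[OF g] lie_bracket_def by (simp add: polar_det_linear polar_det_sym[of "X g"])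
qed

lemma D_subset_tangent: "D g \<subseteq> tangent_SL2 g"
  unfolding D_def tangent_SL2_def De_eq by (auto simp: sl2_def trace_def sum_2 horiz_entries)

text \<open>
  Smoothness has to be carried through the induction, since the bracket of fields that are not
  differentiable is unspecified.
\<close>

lemma iterated_brackets_tangent:
  assumes "Z \<in> iterated_brackets (sections D)"
  shows "smooth Z \<and> (\<forall>g\<in>SL2. Z g \<in> tangent_SL2 g)"
  using assms
proof (induction rule: iterated_brackets.induct)
  case (base X)
  then show ?case using D_subset_tangent by (auto simp: sections_def)
next
  case (bracket X Y)
  have "smooth F \<Longrightarrow> F differentiable (at g)" for F :: "mat2 \<Rightarrow> mat2" and g
    unfolding smooth_def using Ck_differentiable by blast
  with bracket.IH show ?case by (auto intro!: smooth_lie_bracket lie_bracket_tangent)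
qed

lemma bounded_linear_mult_right_matrix: "bounded_linear (\<lambda>g::mat2. g ** a)" for a :: mat2
  by (intro linear_conv_bounded_linear[THEN iffD1] linearI)
    (simp_all add: matrix_add_mult_right mat2_eq_iff matrix_mult_entry algebra_simps)

lemma lie_bracket_left_invariant: "lie_bracket (\<lambda>g. g ** a) (\<lambda>g. g ** b) g = g ** (a ** b - b ** a)"
  for a b :: mat2
proof -
  have d: "frechet_derivative (\<lambda>g::mat2. g ** a) (at x) = (\<lambda>g. g ** a)" for a x :: mat2
    using frechet_derivative_at[OF bounded_linear_imp_has_derivative[OF bounded_linear_mult_right_matrix]] by metis
  show ?thesis by (simp add: lie_bracket_def d mat2_eq_iff matrix_mult_entry algebra_simps)
qed

lemma commutator_p1_p2: "p1 ** p2 - p2 ** p1 = - k_so"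
  by (simp add: mat2_eq_iff matrix_mult_entry basis_entries)

text \<open>
  The fields \<open>g p1\<close> and \<open>g p2\<close> are sections of \<open>D\<close>, and their bracket is \<open>- g k\<close>; the matrices
  \<open>p1\<close>, \<open>p2\<close>, \<open>k\<close> span the traceless ones.
\<close>

lemma totally_nonholonomic_D: "totally_nonholonomic D"
  unfolding totally_nonholonomic_def
proof
  fix g assume g: "g \<in> SL2"
  let ?S = "span {Z g | Z. Z \<in> iterated_brackets (sections D)}"
  show "?S = tangent_SL2 g"
  proof
    show "?S \<subseteq> tangent_SL2 g"
    proof (rule span_minimal)
      show "{Z g | Z. Z \<in> iterated_brackets (sections D)} \<subseteq> tangent_SL2 g"
        using iterated_brackets_tangent g by auto
      show "subspace (tangent_SL2 g)"
        by (simp add: subspace_def tangent_SL2_iff[OF g] polar_det_linear)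
    qed
    have field: "(\<lambda>g. g ** p) \<in> iterated_brackets (sections D)" if "p \<in> {p1, p2}" for p
    proof (rule iterated_brackets.base)
      have "p \<in> De" unfolding De_def using that by (rule span_base)
      then show "(\<lambda>g. g ** p) \<in> sections D"
        unfolding sections_def D_def using smooth_bounded_linear[OF bounded_linear_mult_right_matrix] by blast
    qed
    have 1: "g ** p1 \<in> ?S" "g ** p2 \<in> ?S" using field by (auto intro!: span_base)
    have "lie_bracket (\<lambda>g. g ** p1) (\<lambda>g. g ** p2) g \<in> ?S"
      using iterated_brackets.bracket[OF field field, of p1 p2] by (intro span_base) blast
    then have 2: "g ** (- k_so) \<in> ?S" by (simp only: lie_bracket_left_invariant commutator_p1_p2)
    show "tangent_SL2 g \<subseteq> ?S"
    proof
      fix h assume "h \<in> tangent_SL2 g"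
      then obtain a where a: "h = g ** a" "a$2$2 = - a$1$1"
        by (auto simp: tangent_SL2_def sl2_def trace_def sum_2)
      have "h = (2 * a$1$1) *\<^sub>R (g ** p1) + (a$1$2 + a$2$1) *\<^sub>R (g ** p2) + (a$1$2 - a$2$1) *\<^sub>R (g ** (- k_so))"
        using a(2) by (simp add: a(1) mat2_eq_iff matrix_mult_entry basis_entries field_simps)
      then show "h \<in> ?S" using 1 2 by (simp add: span_add span_scale)
    qed
  qed
qed


theorem theorem2:
  shows "totally_nonholonomic D
    \<and> (\<forall>x\<in>SL2. \<forall>y\<in>SL2. joining_lengths x y \<noteq> {})
    \<and> Metric_space SL2 sr_dist
    \<and> (\<forall>g\<in>SL2. \<forall>x\<in>SL2. \<forall>y\<in>SL2. sr_dist (g ** x) (g ** y) = sr_dist x y)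
    \<and> (\<forall>\<gamma> :: real \<Rightarrow> real ^ 2 ^ 2.
          geodesic \<gamma> \<and> arclength_parametrized \<gamma> \<and> \<gamma> 0 = mat 1 \<longleftrightarrow>
          (\<exists>\<phi> \<beta>. \<forall>t. \<gamma> t =
             mat_exp (t *\<^sub>R (cos \<phi> *\<^sub>R p1 + sin \<phi> *\<^sub>R p2 + \<beta> *\<^sub>R k_so)) **
             mat_exp (- (t * \<beta>) *\<^sub>R k_so)))"
  using totally_nonholonomic_D joining_lengths_nonempty Metric_space_sr_dist sr_dist_left_invariant
    geodesic_iff_formula[unfolded geodesic_formula_def] by (intro conjI ballI allI) blast+

end
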